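(* Let $T$ be an inverse semigroup and $A$ a $T$-module. There is a (well-defined) map from $H^3_\le(T^1,A^1)$ to $\mathcal{E}(T,A)$, which sends the class of a normalized order-preserving cocycle $c\in Z^3_\le(T^1,A^1)$ to the equivalence class of the crossed module extension $A\xrightarrow{i}N\xrightarrow{\beta}S\xrightarrow{\pi}T$ (with crossed $S$-module structure $(\alpha,\lambda,\beta)$ on $N$) constructed from $c$ as described in the context. (Every class in $H^3_\le(T^1,A^1)$ contains a normalized representative.)
   Context: **Basics.** For an inverse semigroup $T$, $E(T)$ is its semilattice of idempotents, $\le$ is the natural partial order, $\mathbf r(t)=tt^{-1}$, $\mathbf d(t)=t^{-1}t$. A semilattice of groups is an inverse semigroup $A$ that is a disjoint union of groups (equivalently, whose idempotents are central); for $e\in E(A)$, $A_e=\{a\in A: aa^{-1}=a^{-1}a=e\}$. An endomorphism $\varphi$ of a semilattice of groups $A$ is relatively invertible if there are $\bar\varphi\in\operatorname{End}A$ and $e_\varphi\in E(A)$ such that $\bar\varphi(\varphi(a))=e_\varphi a$ and $\varphi(\bar\varphi(a))=\varphi(e_\varphi)a$ for all $a\in A$, $e_\varphi$ is the identity of $\bar\varphi(A)$ and $\varphi(e_\varphi)$ is the identity of $\varphi(A)$; $\operatorname{end}A$ is the set of these, an inverse subsemigroup of $\operatorname{End}A$. **Modules and cocycles.** A $T$-module is a semilattice of abelian groups $A$ with an isomorphism $\theta:E(T)\to E(A)$ and a homomorphism $\eta:T\to\operatorname{end}A$ such that $\eta_e(a)=\theta(e)a$, $\eta_t(\theta(e))=\theta(tet^{-1})$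 for $e\in E(T)$, $t\in T$, $a\in A$. $C^n(T^1,A^1)$ is the group of functions $f:T^n\to A$ with $f(x_1,\dots,x_n)\in A_{\theta(\mathbf r(x_1\cdots x_n))}$; $(\delta^nf)(x_1,\dots,x_{n+1})=\eta_{x_1}(f(x_2,\dots,x_{n+1}))\prod_{i=1}^nf(x_1,\dots,x_ix_{i+1},\dots,x_{n+1})^{(-1)^i}f(x_1,\dots,x_n)^{(-1)^{n+1}}$. $f$ is order-preserving if $x_j\le y_j$ for all $j$ implies $f(x_1,\dots,x_n)\le f(y_1,\dots,y_n)$; $C^n_\le(T^1,A^1)$ is the group of order-preserving cochains, $Z^3_\le(T^1,A^1)=\ker\delta^3\cap C^3_\le(T^1,A^1)$, $B^3_\le(T^1,A^1)=\delta^2(C^2_\le(T^1,A^1))$, $H^3_\le(T^1,A^1)=Z^3_\le(T^1,A^1)/B^3_\le(T^1,A^1)$. A $3$-cochain $c$ is normalized if $c(e,ex,y)=\theta(\mathbf r(exy))$, $c(xe,e,ey)=\theta(\mathbf r(xey))$ and $c(x,ye,e)=\theta(\mathbf r(xye))$ for all $x,y\in T$, $e\in E(T)$. **Crossed modules and extensions.** A crossed $S$-module ($S$ an inverse semigroup) is a semilattice of groups $N$ with $(\alpha,\lambda,\beta)$, where $\alpha:E(S)\to E(N)$ is an isomorphism, $\lambda:S\to\operatorname{end}N$ a homomorphism, $\beta:N\to S$ a homomorphism injective on idempotents with $\beta|_{E(N)}=\alpha^{-1}$, such that $\lambda_e(n)=\alpha(e)n$, $\lambda_s(\alpha(e))=\alpha(ses^{-1})$,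 $\lambda_{\beta(n)}(n')=nn'n^{-1}$, $\beta(\lambda_s(n))=s\beta(n)s^{-1}$ for all $e\in E(S)$, $s\in S$, $n,n'\in N$. A crossed module extension of $A$ by $T$ is a sequence $A\xrightarrow{i}N\xrightarrow{\beta}S\xrightarrow{\pi}T$ where $N$ is a crossed $S$-module with structure $(\alpha,\lambda,\beta)$, $i$ is a monomorphism, $\pi$ an epimorphism injective on idempotents, $i(A)=\beta^{-1}(E(S))$, $\beta(N)=\pi^{-1}(E(T))$. The induced $T$-module structure on $A$ is $i^{-1}\circ\alpha\circ(\pi|_{E(S)})^{-1}$ on $E(T)$, and $t\mapsto i^{-1}\circ\lambda_s\circ i$ (any $s$ with $\pi(s)=t$) on $T$; for a $T$-module $A$ only extensions inducing the given structure are considered. Equivalence is the smallest equivalence relation identifying $A\xrightarrow{i}N\xrightarrow{\beta}S\xrightarrow{\pi}T$ with $A\xrightarrow{i'}N'\xrightarrow{\beta'}S'\xrightarrow{\pi'}T$ whenever there are homomorphisms $\varphi_1:N\to N'$, $\varphi_2:S\to S'$ with $\varphi_1\circ i=i'$, $\beta'\circ\varphi_1=\varphi_2\circ\beta$, $\pi'\circ\varphi_2=\pi$ and $\varphi_1\circ\lambda_s=\lambda'_{\varphi_2(s)}\circ\varphi_1$ for all $s\in S$. $\mathcal{E}(T,A)$ is the set of equivalence classes of crossed module extensions of the $T$-module $A$ by $T$. **Construction: the semigroups $S$ and $N$.** $F(X)$, $F(X)^1$, $FG(X)$ are the free semigroup, monoid, group on $X$. View $T$ as an alphabet of letters $[t]$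 ($t\in T$), and let $T^{-1}$ be a disjoint alphabet of letters $[t]^{-1}$ ($t\in T$). Let $\varphi:F(T\sqcup T^{-1})\to T$ be the homomorphism with $[t]\mapsto t$, $[t]^{-1}\mapsto t^{-1}$. Let $\epsilon$ be the identity of $FG(T)$ (the free group on the letters $[t]$); for $w\in FG(T)\setminus\{\epsilon\}$ let $\operatorname{irr}(w)\in F(T\sqcup T^{-1})$ be the reduced word representing $w$. Let $T^1=T\sqcup\{1\}$ with a new identity $1$ (so $t\le1$ iff $t\in E(T)$), and define $\nu:FG(T)\to T^1$ by $\nu(w)=\varphi(\operatorname{irr}(w))$ if $w\ne\epsilon$, $\nu(\epsilon)=1$. Put $S=\{(t,w)\in T\times FG(T): t\le\nu(w)\}$ with coordinatewise multiplication (an inverse semigroup with $E(S)=E(T)\times\{\epsilon\}$), $\pi:S\to T$, $\pi(t,w)=t$. Put $N=\{(a,e,w)\in A\times E(T)\times FG(T): a\in A_{\theta(e)},\ e\le\nu(w)\}$ with coordinatewise multiplication. Define $i(a)=(a,\theta^{-1}(aa^{-1}),\epsilon)$, $\alpha(e,\epsilon)=(\theta(e),e,\epsilon)$, $\beta(a,e,w)=(e,w)$. **Construction: the map $\lambda$.** For $t\in T$ define $\xi_t:F(T\sqcup T^{-1})\to A$ recursively, for $x,y\in T$, $u,v\in F(T\sqcup T^{-1})^1$: $\xi_t([x]^{-1}u)=c(t,x^{-1},x)^{-1}\xi_t([x^{-1}]u)$; $\xi_t([x])=\theta(\mathbf r(tx))$; $\xi_t([x][y]v)=c(t,x,y)\,\xi_t([xy]v)$;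 $\xi_t([x][y]^{-1}v)=c(t,xy^{-1},y)^{-1}\xi_t([xy^{-1}]v)$. Define $\zeta_t:FG(T)\to A$ by $\zeta_t(w)=\xi_t(\operatorname{irr}(w))$ for $w\ne\epsilon$ and $\zeta_t(\epsilon)=\theta(\mathbf r(t))$. Define maps $\gamma_t,\gamma_t^{-1}:N\to N$ by $\gamma_t(a,e,w)=(\zeta_t(w)\eta_t(a),tet^{-1},[t]w[t]^{-1})$ and $\gamma_t^{-1}(a,e,w)=(\zeta_{t^{-1}}(w)\eta_{t^{-1}}(a),t^{-1}et,[t]^{-1}w[t])$. For $s=(t,u)\in S$ and $n\in N$ put $\lambda_s(n)=\alpha(\mathbf r(s))\,(\gamma_{t_1}^{\varepsilon_1}\circ\dots\circ\gamma_{t_k}^{\varepsilon_k})(n)$ if $u\ne\epsilon$ and $\operatorname{irr}(u)=[t_1]^{\varepsilon_1}\cdots[t_k]^{\varepsilon_k}$ ($\varepsilon_j\in\{-1,1\}$), and $\lambda_s(n)=\alpha(s)n$ if $u=\epsilon$. *)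

theory Defs
  imports "HOL-Algebra.Coset" "HOL-Library.Disjoint_Sets"
begin

section \<open>Inverse semigroups\<close>

text \<open>Inverse semigroups need not have an identity, so the \<open>monoid\<close> record of HOL-Algebra
  (which carries a field \<open>one\<close>) is used for the groups only.\<close>

record 'a sgroup = "'a partial_object" +
  sgmult :: "'a \<Rightarrow> 'a \<Rightarrow> 'a" (infixl "\<cdot>\<index>" 70)

definition inverse_semigroup :: "'a sgroup \<Rightarrow> bool" where
  "inverse_semigroup S \<longleftrightarrow>
     (\<forall>x\<in>carrier S. \<forall>y\<in>carrier S. x \<cdot>\<^bsub>S\<^esub> y \<in> carrier S) \<and>
     (\<forall>x\<in>carrier S. \<forall>y\<in>carrier S. \<forall>z\<in>carrier S. (x \<cdot>\<^bsub>S\<^esub> y) \<cdot>\<^bsub>S\<^esub> z = x \<cdot>\<^bsub>S\<^esub> (y \<cdot>\<^bsub>S\<^esub> z)) \<and>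
     (\<forall>x\<in>carrier S. \<exists>!y. y \<in> carrier S \<and> x \<cdot>\<^bsub>S\<^esub> y \<cdot>\<^bsub>S\<^esub> x = x \<and> y \<cdot>\<^bsub>S\<^esub> x \<cdot>\<^bsub>S\<^esub> y = y)"

definition sinv :: "'a sgroup \<Rightarrow> 'a \<Rightarrow> 'a" where
  "sinv S x = (THE y. y \<in> carrier S \<and> x \<cdot>\<^bsub>S\<^esub> y \<cdot>\<^bsub>S\<^esub> x = x \<and> y \<cdot>\<^bsub>S\<^esub> x \<cdot>\<^bsub>S\<^esub> y = y)"

definition rng :: "'a sgroup \<Rightarrow> 'a \<Rightarrow> 'a" where
  "rng S x = x \<cdot>\<^bsub>S\<^esub> sinv S x"

definition idems :: "'a sgroup \<Rightarrow> 'a set" where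
  "idems S = {e \<in> carrier S. e \<cdot>\<^bsub>S\<^esub> e = e}"

definition idem_sgroup :: "'a sgroup \<Rightarrow> 'a sgroup" where
  "idem_sgroup S = S\<lparr>carrier := idems S\<rparr>"

definition nat_le :: "'a sgroup \<Rightarrow> 'a \<Rightarrow> 'a \<Rightarrow> bool" where
  "nat_le S x y \<longleftrightarrow> (\<exists>e\<in>idems S. x = e \<cdot>\<^bsub>S\<^esub> y)"

definition shom :: "'a sgroup \<Rightarrow> 'b sgroup \<Rightarrow> ('a \<Rightarrow> 'b) set" where
  "shom S S' = {f \<in> carrier S \<rightarrow> carrier S'.
     \<forall>x\<in>carrier S. \<forall>y\<in>carrier S. f (x \<cdot>\<^bsub>S\<^esub> y) = f x \<cdot>\<^bsub>S'\<^esub> f y}"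

definition siso :: "'a sgroup \<Rightarrow> 'b sgroup \<Rightarrow> ('a \<Rightarrow> 'b) set" where
  "siso S S' = {f \<in> shom S S'. bij_betw f (carrier S) (carrier S')}"

text \<open>Product of a nonempty list.\<close>

fun sprod :: "'a sgroup \<Rightarrow> 'a list \<Rightarrow> 'a" where
  "sprod S [] = undefined"
| "sprod S [x] = x"
| "sprod S (x # y # zs) = x \<cdot>\<^bsub>S\<^esub> sprod S (y # zs)"

section \<open>Semilattices of groups\<close>

definition semilattice_of_groups :: "'a sgroup \<Rightarrow> bool" where
  "semilattice_of_groups A \<longleftrightarrow> inverse_semigroup A \<and>
     (\<exists>\<G>. partition_on (carrier A) \<G> \<and>
        (\<forall>G\<in>\<G>. \<exists>e. group \<lparr>carrier = G, mult = sgmult A, one = e\<rparr>))"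

definition component :: "'a sgroup \<Rightarrow> 'a \<Rightarrow> 'a set" where
  "component A e = {a \<in> carrier A. a \<cdot>\<^bsub>A\<^esub> sinv A a = e \<and> sinv A a \<cdot>\<^bsub>A\<^esub> a = e}"

definition semilattice_of_abelian_groups :: "'a sgroup \<Rightarrow> bool" where
  "semilattice_of_abelian_groups A \<longleftrightarrow> semilattice_of_groups A \<and>
     (\<forall>e\<in>idems A. comm_group \<lparr>carrier = component A e, mult = sgmult A, one = e\<rparr>)"

text \<open>Endomorphisms are extensional functions on the carrier, so that equality of
  endomorphisms is equality in HOL.\<close>

definition endos :: "'a sgroup \<Rightarrow> ('a \<Rightarrow> 'a) set" where
  "endos A = shom A A \<inter> extensional (carrier A)"

definition is_identity_of :: "'a sgroup \<Rightarrow> 'a \<Rightarrow> 'a set \<Rightarrow> bool" where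
  "is_identity_of A e B \<longleftrightarrow> e \<in> B \<and> (\<forall>b\<in>B. e \<cdot>\<^bsub>A\<^esub> b = b \<and> b \<cdot>\<^bsub>A\<^esub> e = b)"

definition rel_invertible :: "'a sgroup \<Rightarrow> ('a \<Rightarrow> 'a) \<Rightarrow> bool" where
  "rel_invertible A \<phi> \<longleftrightarrow> (\<exists>\<psi>\<in>endos A. \<exists>e\<in>idems A.
     (\<forall>a\<in>carrier A. \<psi> (\<phi> a) = e \<cdot>\<^bsub>A\<^esub> a \<and> \<phi> (\<psi> a) = \<phi> e \<cdot>\<^bsub>A\<^esub> a) \<and>
     is_identity_of A e (\<psi> ` carrier A) \<and>
     is_identity_of A (\<phi> e) (\<phi> ` carrier A))"

definition rel_end :: "'a sgroup \<Rightarrow> ('a \<Rightarrow> 'a) sgroup" where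
  "rel_end A = \<lparr>carrier = {\<phi> \<in> endos A. rel_invertible A \<phi>}, sgmult = compose (carrier A)\<rparr>"

section \<open>Modules and order-preserving cohomology\<close>

definition T_module :: "'t sgroup \<Rightarrow> 'a sgroup \<Rightarrow> ('t \<Rightarrow> 'a) \<Rightarrow> ('t \<Rightarrow> 'a \<Rightarrow> 'a) \<Rightarrow> bool" where
  "T_module T A \<theta> \<eta> \<longleftrightarrow>
     semilattice_of_abelian_groups A \<and>
     \<theta> \<in> siso (idem_sgroup T) (idem_sgroup A) \<and>
     \<eta> \<in> shom T (rel_end A) \<and>
     (\<forall>e\<in>idems T. \<forall>a\<in>carrier A. \<eta> e a = \<theta> e \<cdot>\<^bsub>A\<^esub> a) \<and>
     (\<forall>t\<in>carrier T. \<forall>e\<in>idems T. \<eta> t (\<theta> e) = \<theta> (t \<cdot>\<^bsub>T\<^esub> e \<cdot>\<^bsub>T\<^esub> sinv T t))"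

text \<open>Points of \<open>T\<^sup>n\<close> are lists of length \<open>n\<close>; cochains are extensional on them.  Everything
  below is meant for \<open>n \<ge> 1\<close>.\<close>

definition tuples :: "'t sgroup \<Rightarrow> nat \<Rightarrow> 't list set" where
  "tuples T n = {xs. length xs = n \<and> set xs \<subseteq> carrier T}"

definition cochain_group ::
    "'t sgroup \<Rightarrow> 'a sgroup \<Rightarrow> ('t \<Rightarrow> 'a) \<Rightarrow> nat \<Rightarrow> ('t list \<Rightarrow> 'a) monoid" where
  "cochain_group T A \<theta> n =
    \<lparr>carrier = {f \<in> extensional (tuples T n).
                  \<forall>xs\<in>tuples T n. f xs \<in> component A (\<theta> (rng T (sprod T xs)))},
     mult = (\<lambda>f g. \<lambda>xs\<in>tuples T n. f xs \<cdot>\<^bsub>A\<^esub> g xs),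
     one = (\<lambda>xs\<in>tuples T n. \<theta> (rng T (sprod T xs)))\<rparr>"

text \<open>\<open>merge_at T i (x\<^sub>1, \<dots>, x\<^sub>m) = (x\<^sub>1, \<dots>, x\<^sub>i x\<^sub>i\<^sub>+\<^sub>1, \<dots>, x\<^sub>m)\<close> with positions counted from 1,
  and \<open>sgn_pow A a i\<close> is \<open>a\<close> to the power \<open>(-1)\<^sup>i\<close>.\<close>

definition merge_at :: "'t sgroup \<Rightarrow> nat \<Rightarrow> 't list \<Rightarrow> 't list" where
  "merge_at T i xs = take (i - 1) xs @ (xs ! (i - 1) \<cdot>\<^bsub>T\<^esub> xs ! i) # drop (i + 1) xs"

definition sgn_pow :: "'a sgroup \<Rightarrow> 'a \<Rightarrow> nat \<Rightarrow> 'a" where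
  "sgn_pow A a i = (if even i then a else sinv A a)"

definition coboundary ::
    "'t sgroup \<Rightarrow> 'a sgroup \<Rightarrow> ('t \<Rightarrow> 'a \<Rightarrow> 'a) \<Rightarrow> nat \<Rightarrow> ('t list \<Rightarrow> 'a) \<Rightarrow> 't list \<Rightarrow> 'a" where
  "coboundary T A \<eta> n f = (\<lambda>xs\<in>tuples T (n + 1).
     sprod A (\<eta> (hd xs) (f (tl xs))
              # map (\<lambda>i. sgn_pow A (f (merge_at T i xs)) i) [1..<n + 1]
              @ [sgn_pow A (f (butlast xs)) (n + 1)]))"

definition ord_cochains ::
    "'t sgroup \<Rightarrow> 'a sgroup \<Rightarrow> ('t \<Rightarrow> 'a) \<Rightarrow> nat \<Rightarrow> ('t list \<Rightarrow> 'a) set" where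
  "ord_cochains T A \<theta> n = {f \<in> carrier (cochain_group T A \<theta> n).
     \<forall>xs\<in>tuples T n. \<forall>ys\<in>tuples T n. list_all2 (nat_le T) xs ys \<longrightarrow> nat_le A (f xs) (f ys)}"

definition ord_cocycles ::
    "'t sgroup \<Rightarrow> 'a sgroup \<Rightarrow> ('t \<Rightarrow> 'a) \<Rightarrow> ('t \<Rightarrow> 'a \<Rightarrow> 'a) \<Rightarrow> ('t list \<Rightarrow> 'a) set" where
  "ord_cocycles T A \<theta> \<eta> =
     kernel (cochain_group T A \<theta> 3) (cochain_group T A \<theta> 4) (coboundary T A \<eta> 3)
     \<inter> ord_cochains T A \<theta> 3"

definition ord_coboundaries ::
    "'t sgroup \<Rightarrow> 'a sgroup \<Rightarrow> ('t \<Rightarrow> 'a) \<Rightarrow> ('t \<Rightarrow> 'a \<Rightarrow> 'a) \<Rightarrow> ('t list \<Rightarrow> 'a) set" where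
  "ord_coboundaries T A \<theta> \<eta> = coboundary T A \<eta> 2 ` ord_cochains T A \<theta> 2"

definition ord_cocycle_group ::
    "'t sgroup \<Rightarrow> 'a sgroup \<Rightarrow> ('t \<Rightarrow> 'a) \<Rightarrow> ('t \<Rightarrow> 'a \<Rightarrow> 'a) \<Rightarrow> ('t list \<Rightarrow> 'a) monoid" where
  "ord_cocycle_group T A \<theta> \<eta> = (cochain_group T A \<theta> 3)\<lparr>carrier := ord_cocycles T A \<theta> \<eta>\<rparr>"

definition ord_cohomology ::
    "'t sgroup \<Rightarrow> 'a sgroup \<Rightarrow> ('t \<Rightarrow> 'a) \<Rightarrow> ('t \<Rightarrow> 'a \<Rightarrow> 'a) \<Rightarrow> ('t list \<Rightarrow> 'a) set monoid" where
  "ord_cohomology T A \<theta> \<eta> = ord_cocycle_group T A \<theta> \<eta> Mod ord_coboundaries T A \<theta> \<eta>"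

definition cohomology_class ::
    "'t sgroup \<Rightarrow> 'a sgroup \<Rightarrow> ('t \<Rightarrow> 'a) \<Rightarrow> ('t \<Rightarrow> 'a \<Rightarrow> 'a) \<Rightarrow> ('t list \<Rightarrow> 'a)
      \<Rightarrow> ('t list \<Rightarrow> 'a) set" where
  "cohomology_class T A \<theta> \<eta> c = ord_coboundaries T A \<theta> \<eta> #>\<^bsub>ord_cocycle_group T A \<theta> \<eta>\<^esub> c"

definition normalized :: "'t sgroup \<Rightarrow> ('t \<Rightarrow> 'a) \<Rightarrow> ('t list \<Rightarrow> 'a) \<Rightarrow> bool" where
  "normalized T \<theta> c \<longleftrightarrow> (\<forall>x\<in>carrier T. \<forall>y\<in>carrier T. \<forall>e\<in>idems T.
     c [e, e \<cdot>\<^bsub>T\<^esub> x, y] = \<theta> (rng T (e \<cdot>\<^bsub>T\<^esub> x \<cdot>\<^bsub>T\<^esub> y)) \<and>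
     c [x \<cdot>\<^bsub>T\<^esub> e, e, e \<cdot>\<^bsub>T\<^esub> y] = \<theta> (rng T (x \<cdot>\<^bsub>T\<^esub> e \<cdot>\<^bsub>T\<^esub> y)) \<and>
     c [x, y \<cdot>\<^bsub>T\<^esub> e, e] = \<theta> (rng T (x \<cdot>\<^bsub>T\<^esub> y \<cdot>\<^bsub>T\<^esub> e)))"

section \<open>Crossed modules and crossed module extensions\<close>

definition crossed_module :: "'s sgroup \<Rightarrow> 'n sgroup \<Rightarrow> ('s \<Rightarrow> 'n) \<Rightarrow> ('s \<Rightarrow> 'n \<Rightarrow> 'n)
    \<Rightarrow> ('n \<Rightarrow> 's) \<Rightarrow> bool" where
  "crossed_module S N \<alpha> \<Lambda> \<beta> \<longleftrightarrow>
     inverse_semigroup S \<and> semilattice_of_groups N \<and>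
     \<alpha> \<in> siso (idem_sgroup S) (idem_sgroup N) \<and>
     \<Lambda> \<in> shom S (rel_end N) \<and>
     \<beta> \<in> shom N S \<and> inj_on \<beta> (idems N) \<and>
     (\<forall>f\<in>idems N. \<beta> f = inv_into (idems S) \<alpha> f) \<and>
     (\<forall>e\<in>idems S. \<forall>n\<in>carrier N. \<Lambda> e n = \<alpha> e \<cdot>\<^bsub>N\<^esub> n) \<and>
     (\<forall>s\<in>carrier S. \<forall>e\<in>idems S. \<Lambda> s (\<alpha> e) = \<alpha> (s \<cdot>\<^bsub>S\<^esub> e \<cdot>\<^bsub>S\<^esub> sinv S s)) \<and>
     (\<forall>n\<in>carrier N. \<forall>n'\<in>carrier N. \<Lambda> (\<beta> n) n' = n \<cdot>\<^bsub>N\<^esub> n' \<cdot>\<^bsub>N\<^esub> sinv N n) \<and>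
     (\<forall>s\<in>carrier S. \<forall>n\<in>carrier N. \<beta> (\<Lambda> s n) = s \<cdot>\<^bsub>S\<^esub> \<beta> n \<cdot>\<^bsub>S\<^esub> sinv S s)"

record ('t, 'a, 'n, 's) cm_ext =
  ext_N :: "'n sgroup"
  ext_S :: "'s sgroup"
  ext_alpha :: "'s \<Rightarrow> 'n"
  ext_lambda :: "'s \<Rightarrow> 'n \<Rightarrow> 'n"
  ext_beta :: "'n \<Rightarrow> 's"
  ext_i :: "'a \<Rightarrow> 'n"
  ext_pi :: "'s \<Rightarrow> 't"

text \<open>The last two conditions say that the induced module structure is the given one.\<close>

definition cm_exts :: "'t sgroup \<Rightarrow> 'a sgroup \<Rightarrow> ('t \<Rightarrow> 'a) \<Rightarrow> ('t \<Rightarrow> 'a \<Rightarrow> 'a)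
    \<Rightarrow> ('t, 'a, 'n, 's) cm_ext set" where
  "cm_exts T A \<theta> \<eta> = {X.
     crossed_module (ext_S X) (ext_N X) (ext_alpha X) (ext_lambda X) (ext_beta X) \<and>
     ext_i X \<in> shom A (ext_N X) \<and> inj_on (ext_i X) (carrier A) \<and>
     ext_pi X \<in> shom (ext_S X) T \<and> ext_pi X ` carrier (ext_S X) = carrier T \<and>
     inj_on (ext_pi X) (idems (ext_S X)) \<and>
     ext_i X ` carrier A = {n \<in> carrier (ext_N X). ext_beta X n \<in> idems (ext_S X)} \<and>
     ext_beta X ` carrier (ext_N X) = {s \<in> carrier (ext_S X). ext_pi X s \<in> idems T} \<and>
     (\<forall>e\<in>idems T. \<theta> e =
        inv_into (carrier A) (ext_i X) (ext_alpha X (inv_into (idems (ext_S X)) (ext_pi X) e))) \<and>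
     (\<forall>t\<in>carrier T. \<forall>s\<in>carrier (ext_S X). ext_pi X s = t \<longrightarrow>
        (\<forall>a\<in>carrier A. \<eta> t a = inv_into (carrier A) (ext_i X) (ext_lambda X s (ext_i X a))))}"

definition cm_ext_hom :: "'a sgroup \<Rightarrow> ('t, 'a, 'n, 's) cm_ext
    \<Rightarrow> ('t, 'a, 'n, 's) cm_ext \<Rightarrow> bool" where
  "cm_ext_hom A X X' \<longleftrightarrow>
     (\<exists>\<phi>\<^sub>1\<in>shom (ext_N X) (ext_N X'). \<exists>\<phi>\<^sub>2\<in>shom (ext_S X) (ext_S X').
        (\<forall>a\<in>carrier A. \<phi>\<^sub>1 (ext_i X a) = ext_i X' a) \<and>
        (\<forall>n\<in>carrier (ext_N X). ext_beta X' (\<phi>\<^sub>1 n) = \<phi>\<^sub>2 (ext_beta X n)) \<and>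
        (\<forall>s\<in>carrier (ext_S X). ext_pi X' (\<phi>\<^sub>2 s) = ext_pi X s) \<and>
        (\<forall>s\<in>carrier (ext_S X). \<forall>n\<in>carrier (ext_N X).
           \<phi>\<^sub>1 (ext_lambda X s n) = ext_lambda X' (\<phi>\<^sub>2 s) (\<phi>\<^sub>1 n)))"

definition cm_ext_equiv :: "'t sgroup \<Rightarrow> 'a sgroup \<Rightarrow> ('t \<Rightarrow> 'a) \<Rightarrow> ('t \<Rightarrow> 'a \<Rightarrow> 'a)
    \<Rightarrow> ('t, 'a, 'n, 's) cm_ext rel" where
  "cm_ext_equiv T A \<theta> \<eta> = \<Inter>{R. equiv (cm_exts T A \<theta> \<eta>) R \<and>
     (\<forall>X\<in>cm_exts T A \<theta> \<eta>. \<forall>X'\<in>cm_exts T A \<theta> \<eta>. cm_ext_hom A X X' \<longrightarrow> (X, X') \<in> R)}"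

definition cm_ext_classes :: "'t sgroup \<Rightarrow> 'a sgroup \<Rightarrow> ('t \<Rightarrow> 'a) \<Rightarrow> ('t \<Rightarrow> 'a \<Rightarrow> 'a)
    \<Rightarrow> ('t, 'a, 'n, 's) cm_ext set set" where
  "cm_ext_classes T A \<theta> \<eta> = cm_exts T A \<theta> \<eta> // cm_ext_equiv T A \<theta> \<eta>"

text \<open>A type variable cannot be quantified inside a formula, so \<open>cm_ext_classes\<close> is relative to
  the types \<open>'n\<close> and \<open>'s\<close> in which the carriers of \<open>N\<close> and \<open>S\<close> live.  An extension enters other
  types as an isomorphic copy along injections of these carriers; this way the theorem covers
  every pair of types with room for the constructed extension.\<close>

definition transport_sgroup :: "('x \<Rightarrow> 'y) \<Rightarrow> 'x sgroup \<Rightarrow> 'y sgroup" where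
  "transport_sgroup j S = \<lparr>carrier = j ` carrier S,
     sgmult = (\<lambda>x y. j (inv_into (carrier S) j x \<cdot>\<^bsub>S\<^esub> inv_into (carrier S) j y))\<rparr>"

definition transport_ext :: "('n \<Rightarrow> 'm) \<Rightarrow> ('s \<Rightarrow> 'r) \<Rightarrow> ('t, 'a, 'n, 's) cm_ext
    \<Rightarrow> ('t, 'a, 'm, 'r) cm_ext" where
  "transport_ext jN jS X =
    (let kN = inv_into (carrier (ext_N X)) jN; kS = inv_into (carrier (ext_S X)) jS in
     \<lparr>ext_N = transport_sgroup jN (ext_N X),
      ext_S = transport_sgroup jS (ext_S X),
      ext_alpha = (\<lambda>s. jN (ext_alpha X (kS s))),
      ext_lambda = (\<lambda>s. \<lambda>n\<in>jN ` carrier (ext_N X). jN (ext_lambda X (kS s) (kN n))),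
      ext_beta = (\<lambda>n. jS (ext_beta X (kN n))),
      ext_i = (\<lambda>a. jN (ext_i X a)),
      ext_pi = (\<lambda>s. ext_pi X (kS s))\<rparr>)"

section \<open>Free groups\<close>

text \<open>\<open>Pos t\<close> is the letter \<open>[t]\<close> and \<open>Neg t\<close> the letter \<open>[t]\<^sup>-\<^sup>1\<close>.  The free group is taken in
  its reduced-word model, so an element \<open>w\<close> is its own reduced word \<open>irr(w)\<close> and
  the identity is the empty word.\<close>

datatype 't letter = Pos (letter_base: 't) | Neg (letter_base: 't)

fun letter_inv :: "'t letter \<Rightarrow> 't letter" where
  "letter_inv (Pos t) = Neg t"
| "letter_inv (Neg t) = Pos t"

definition reduced :: "'t letter list \<Rightarrow> bool" where
  "reduced w \<longleftrightarrow> successively (\<lambda>l m. m \<noteq> letter_inv l) w"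

fun red_cons :: "'t letter \<Rightarrow> 't letter list \<Rightarrow> 't letter list" where
  "red_cons l [] = [l]"
| "red_cons l (m # w) = (if m = letter_inv l then w else l # m # w)"

definition reduce :: "'t letter list \<Rightarrow> 't letter list" where
  "reduce w = foldr red_cons w []"

definition free_group :: "'t set \<Rightarrow> 't letter list monoid" where
  "free_group X = \<lparr>carrier = {w. reduced w \<and> letter_base ` set w \<subseteq> X},
     mult = (\<lambda>u v. reduce (u @ v)), one = []\<rparr>"

lemma letter_inv_inv [simp]: "letter_inv (letter_inv l) = l"
  by (cases l) auto

lemma letter_base_inv [simp]: "letter_base (letter_inv l) = letter_base l"
  by (cases l) auto

lemma reduced_Nil [simp]: "reduced []"
  by (simp add: reduced_def)

lemma reduced_tl: "reduced (l # w) \<Longrightarrow> reduced w"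
  by (cases w) (auto simp: reduced_def)

lemma reduced_red_cons: "reduced w \<Longrightarrow> reduced (red_cons l w)"
  by (cases w) (auto simp: reduced_tl, auto simp: reduced_def)

lemma red_cons_reduced: "reduced (l # w) \<Longrightarrow> red_cons l w = l # w"
  by (cases w) (auto simp: reduced_def)

lemma red_cons_inv: "reduced w \<Longrightarrow> red_cons l (red_cons (letter_inv l) w) = w"
  by (cases w) (auto simp: red_cons_reduced)

lemma foldr_red_cons_reduced: "reduced w \<Longrightarrow> reduced (foldr red_cons u w)"
  by (induction u) (auto simp: reduced_red_cons)

lemma reduced_reduce: "reduced (reduce w)"
  by (simp add: reduce_def foldr_red_cons_reduced)

lemma reduce_reduced: "reduced w \<Longrightarrow> reduce w = w"
proof (induction w)
  case (Cons l w)
  then show ?case using reduced_tl[of l w] red_cons_reduced[of l w] by (simp add: reduce_def)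
qed (simp add: reduce_def)

lemma reduce_append: "reduce (u @ v) = foldr red_cons u (reduce v)"
  by (simp add: reduce_def)

lemma foldr_red_cons_red_cons:
  "reduced w \<Longrightarrow> foldr red_cons (red_cons l v) w = red_cons l (foldr red_cons v w)"
  by (cases v) (auto simp: red_cons_inv foldr_red_cons_reduced)

lemma foldr_reduce: "reduced w \<Longrightarrow> foldr red_cons (reduce u) w = foldr red_cons u w"
  by (induction u) (auto simp: reduce_def foldr_red_cons_red_cons)

lemma reduce_append_reduce:
  "reduce (reduce u @ v) = reduce (u @ v)"
  "reduce (u @ reduce v) = reduce (u @ v)"
  by (simp_all add: reduce_append foldr_reduce reduced_reduce reduce_reduced)

lemma set_red_cons: "set (red_cons l w) \<subseteq> insert l (set w)"
  by (cases w) auto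

lemma set_reduce: "set (reduce w) \<subseteq> set w"
proof (induction w)
  case (Cons l w)
  then show ?case using set_red_cons[of l "reduce w"] by (auto simp: reduce_def)
qed (simp add: reduce_def)

lemma letter_base_reduce:
  assumes "letter_base ` set w \<subseteq> X"
  shows "letter_base ` set (reduce w) \<subseteq> X"
  using image_mono[OF set_reduce] assms by (rule subset_trans)

lemma reduce_rev_inv: "reduced w \<Longrightarrow> reduce (rev (map letter_inv w) @ w) = []"
proof (induction w)
  case (Cons l w)
  have "reduce (rev (map letter_inv (l # w)) @ l # w)
      = foldr red_cons (rev (map letter_inv w)) (red_cons (letter_inv l) (l # w))"
    using reduce_append[of "rev (map letter_inv (l # w))" "l # w"] reduce_reduced[OF Cons.prems]
    by simp
  also have "\<dots> = []"
    using Cons reduced_tl[of l w] by (simp add: reduce_append reduce_reduced)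
  finally show ?case .
qed (simp add: reduce_def)

theorem group_free_group: "group (free_group X)"
proof (rule groupI)
  fix w assume w: "w \<in> carrier (free_group X)"
  show "\<exists>v\<in>carrier (free_group X). v \<otimes>\<^bsub>free_group X\<^esub> w = \<one>\<^bsub>free_group X\<^esub>"
  proof (rule bexI)
    show "reduce (rev (map letter_inv w)) \<otimes>\<^bsub>free_group X\<^esub> w = \<one>\<^bsub>free_group X\<^esub>"
      using w by (simp add: free_group_def reduce_append_reduce reduce_rev_inv)
    show "reduce (rev (map letter_inv w)) \<in> carrier (free_group X)"
      using w letter_base_reduce[of "rev (map letter_inv w)" X]
      by (simp add: free_group_def reduced_reduce image_image)
  qed
next
  fix u v assume "u \<in> carrier (free_group X)" "v \<in> carrier (free_group X)"
  then show "u \<otimes>\<^bsub>free_group X\<^esub> v \<in> carrier (free_group X)"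
    using letter_base_reduce[of "u @ v" X]
    by (simp add: free_group_def reduced_reduce image_Un)
qed (auto simp: free_group_def reduce_append_reduce reduce_reduced)

section \<open>The extension constructed from a cocycle\<close>

definition adjoin_one :: "'t sgroup \<Rightarrow> 't option sgroup" where
  "adjoin_one T = \<lparr>carrier = insert None (Some ` carrier T),
     sgmult = (\<lambda>x y. case x of None \<Rightarrow> y
                 | Some s \<Rightarrow> (case y of None \<Rightarrow> x | Some t \<Rightarrow> Some (s \<cdot>\<^bsub>T\<^esub> t)))\<rparr>"

fun letter_val :: "'t sgroup \<Rightarrow> 't letter \<Rightarrow> 't" where
  "letter_val T (Pos t) = t"
| "letter_val T (Neg t) = sinv T t"

definition nu :: "'t sgroup \<Rightarrow> 't letter list \<Rightarrow> 't option" where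
  "nu T w = (if w = [] then None else Some (sprod T (map (letter_val T) w)))"

definition constr_S :: "'t sgroup \<Rightarrow> ('t \<times> 't letter list) sgroup" where
  "constr_S T =
    \<lparr>carrier = {(t, w). t \<in> carrier T \<and> w \<in> carrier (free_group (carrier T)) \<and>
                        nat_le (adjoin_one T) (Some t) (nu T w)},
     sgmult = (\<lambda>(t, w) (t', w'). (t \<cdot>\<^bsub>T\<^esub> t', w \<otimes>\<^bsub>free_group (carrier T)\<^esub> w'))\<rparr>"

definition constr_N :: "'t sgroup \<Rightarrow> 'a sgroup \<Rightarrow> ('t \<Rightarrow> 'a)
    \<Rightarrow> ('a \<times> 't \<times> 't letter list) sgroup" where
  "constr_N T A \<theta> =
    \<lparr>carrier = {(a, e, w). a \<in> component A (\<theta> e) \<and> e \<in> idems T \<and>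
                           w \<in> carrier (free_group (carrier T)) \<and>
                           nat_le (adjoin_one T) (Some e) (nu T w)},
     sgmult = (\<lambda>(a, e, w) (a', e', w').
       (a \<cdot>\<^bsub>A\<^esub> a', e \<cdot>\<^bsub>T\<^esub> e', w \<otimes>\<^bsub>free_group (carrier T)\<^esub> w'))\<rparr>"

definition constr_i :: "'t sgroup \<Rightarrow> 'a sgroup \<Rightarrow> ('t \<Rightarrow> 'a) \<Rightarrow> 'a
    \<Rightarrow> 'a \<times> 't \<times> 't letter list" where
  "constr_i T A \<theta> a = (a, inv_into (idems T) \<theta> (a \<cdot>\<^bsub>A\<^esub> sinv A a), [])"

definition constr_alpha :: "('t \<Rightarrow> 'a) \<Rightarrow> 't \<times> 't letter list \<Rightarrow> 'a \<times> 't \<times> 't letter list" where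
  "constr_alpha \<theta> = (\<lambda>(e, w). (\<theta> e, e, []))"

definition constr_beta :: "'a \<times> 't \<times> 't letter list \<Rightarrow> 't \<times> 't letter list" where
  "constr_beta = (\<lambda>(a, e, w). (e, w))"

function xi :: "'t sgroup \<Rightarrow> 'a sgroup \<Rightarrow> ('t \<Rightarrow> 'a) \<Rightarrow> ('t list \<Rightarrow> 'a) \<Rightarrow> 't
    \<Rightarrow> 't letter list \<Rightarrow> 'a" where
  "xi T A \<theta> c t [] = undefined"
| "xi T A \<theta> c t (Neg x # u) =
     sinv A (c [t, sinv T x, x]) \<cdot>\<^bsub>A\<^esub> xi T A \<theta> c t (Pos (sinv T x) # u)"
| "xi T A \<theta> c t [Pos x] = \<theta> (rng T (t \<cdot>\<^bsub>T\<^esub> x))"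
| "xi T A \<theta> c t (Pos x # Pos y # v) = c [t, x, y] \<cdot>\<^bsub>A\<^esub> xi T A \<theta> c t (Pos (x \<cdot>\<^bsub>T\<^esub> y) # v)"
| "xi T A \<theta> c t (Pos x # Neg y # v) =
     sinv A (c [t, x \<cdot>\<^bsub>T\<^esub> sinv T y, y]) \<cdot>\<^bsub>A\<^esub> xi T A \<theta> c t (Pos (x \<cdot>\<^bsub>T\<^esub> sinv T y) # v)"
  by pat_completeness auto
termination
  by (relation "measure (\<lambda>(T, A, \<theta>, c, t, w).
        2 * length w + (case w of Neg x # u \<Rightarrow> 1 | _ \<Rightarrow> 0))") auto

definition zeta :: "'t sgroup \<Rightarrow> 'a sgroup \<Rightarrow> ('t \<Rightarrow> 'a) \<Rightarrow> ('t list \<Rightarrow> 'a) \<Rightarrow> 't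
    \<Rightarrow> 't letter list \<Rightarrow> 'a" where
  "zeta T A \<theta> c t w = (if w = [] then \<theta> (rng T t) else xi T A \<theta> c t w)"

text \<open>\<open>gamma\<close> at the letter \<open>Pos t\<close> is \<open>\<gamma>\<^sub>t\<close>, at \<open>Neg t\<close> it is \<open>\<gamma>\<^sub>t\<^sup>-\<^sup>1\<close>.\<close>

fun gamma :: "'t sgroup \<Rightarrow> 'a sgroup \<Rightarrow> ('t \<Rightarrow> 'a) \<Rightarrow> ('t \<Rightarrow> 'a \<Rightarrow> 'a) \<Rightarrow> ('t list \<Rightarrow> 'a)
    \<Rightarrow> 't letter \<Rightarrow> 'a \<times> 't \<times> 't letter list \<Rightarrow> 'a \<times> 't \<times> 't letter list" where
  "gamma T A \<theta> \<eta> c (Pos t) (a, e, w) =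
     (zeta T A \<theta> c t w \<cdot>\<^bsub>A\<^esub> \<eta> t a,
      t \<cdot>\<^bsub>T\<^esub> e \<cdot>\<^bsub>T\<^esub> sinv T t,
      [Pos t] \<otimes>\<^bsub>free_group (carrier T)\<^esub> w \<otimes>\<^bsub>free_group (carrier T)\<^esub> [Neg t])"
| "gamma T A \<theta> \<eta> c (Neg t) (a, e, w) =
     (zeta T A \<theta> c (sinv T t) w \<cdot>\<^bsub>A\<^esub> \<eta> (sinv T t) a,
      sinv T t \<cdot>\<^bsub>T\<^esub> e \<cdot>\<^bsub>T\<^esub> t,
      [Neg t] \<otimes>\<^bsub>free_group (carrier T)\<^esub> w \<otimes>\<^bsub>free_group (carrier T)\<^esub> [Pos t])"

definition constr_lambda :: "'t sgroup \<Rightarrow> 'a sgroup \<Rightarrow> ('t \<Rightarrow> 'a) \<Rightarrow> ('t \<Rightarrow> 'a \<Rightarrow> 'a)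
    \<Rightarrow> ('t list \<Rightarrow> 'a) \<Rightarrow> 't \<times> 't letter list
    \<Rightarrow> 'a \<times> 't \<times> 't letter list \<Rightarrow> 'a \<times> 't \<times> 't letter list" where
  "constr_lambda T A \<theta> \<eta> c s = (\<lambda>n\<in>carrier (constr_N T A \<theta>).
     if snd s = [] then constr_alpha \<theta> s \<cdot>\<^bsub>constr_N T A \<theta>\<^esub> n
     else constr_alpha \<theta> (rng (constr_S T) s)
            \<cdot>\<^bsub>constr_N T A \<theta>\<^esub> foldr (gamma T A \<theta> \<eta> c) (snd s) n)"

definition constr_ext :: "'t sgroup \<Rightarrow> 'a sgroup \<Rightarrow> ('t \<Rightarrow> 'a) \<Rightarrow> ('t \<Rightarrow> 'a \<Rightarrow> 'a)
    \<Rightarrow> ('t list \<Rightarrow> 'a)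
    \<Rightarrow> ('t, 'a, 'a \<times> 't \<times> 't letter list, 't \<times> 't letter list) cm_ext" where
  "constr_ext T A \<theta> \<eta> c =
     \<lparr>ext_N = constr_N T A \<theta>, ext_S = constr_S T,
      ext_alpha = constr_alpha \<theta>, ext_lambda = constr_lambda T A \<theta> \<eta> c,
      ext_beta = constr_beta, ext_i = constr_i T A \<theta>, ext_pi = fst\<rparr>"

end

theory Submission
  imports Defs
begin

text \<open>The maps \<open>\<lambda>\<^sub>s\<close> have a closed form: \<open>\<lambda>\<close> at \<open>(t, u)\<close> sends \<open>(a, e, w)\<close> to
  \<open>(X t e w \<bullet> \<eta> t a, t e t\<^sup>-\<^sup>1, u w u\<^sup>-\<^sup>1)\<close>, where \<open>X t e w\<close> is the product of the
  \<open>c(t, p, x)\<^sup>\<plusminus>\<^sup>1\<close> over the edges \<open>p \<rightarrow> p x\<close> traversed when the word \<open>w\<close> is read starting from the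
  prefix \<open>e\<close>; here \<open>e \<le> \<nu>(w)\<close> says that the walk returns to \<open>e\<close>.  Since \<open>c\<close> is
  order-preserving, such products only depend on the reduced word.  The cocycle identity rewrites
  \<open>\<eta> t (c(x, p, y)) c(t, x p, y)\<close> as \<open>c(t x, p, y)\<close> times a factor that telescopes along a closed
  walk; this gives \<open>\<eta> t (X x e w) \<bullet> X t (x e) w = X (t x) e w\<close>, so \<open>\<lambda>\<close> is a homomorphism.
  If \<open>c'\<close> is \<open>c\<close> times the coboundary of \<open>h\<close>, the same telescoping shows that
  \<open>(a, e, w) \<mapsto> ((H e w)\<^sup>-\<^sup>1 \<bullet> a, e, w)\<close>, with \<open>H\<close> the product of the \<open>h(p, x)\<close> along \<open>w\<close>, and the
  identity of \<open>S\<close> form a morphism between the two extensions.\<close>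


section \<open>Inverse semigroups\<close>

text \<open>Three points shape the proof. In an inverse semigroup
  \<open>p x x\<^sup>-\<^sup>1\<close> is only below \<open>p\<close>, so cancelling letters changes
  a walk. Each product along a word is therefore kept together with an idempotent \<open>g\<close>
  naming the component of its endpoint: reducing the word or restricting the starting prefix alters
  the product only by such an idempotent, and on a closed walk at \<open>e\<close> it is absorbed.
  Secondly, the prescribed recursion for \<open>\<xi>\<close> starts its walk at the first letter of
  \<open>w\<close> and not at \<open>e\<close>. For a first letter \<open>[x]\<close> the missing
  edge is \<open>c(t, e, x) = c(t e, e, e x)\<close>, which is trivial by normalization.
  Normalization also makes the twist by an idempotent trivial; hence idempotents act through
  \<open>\<alpha>\<close>, and \<open>\<beta>(n)\<close> acts as conjugation by \<open>n\<close>.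
  Thirdly, the given \<open>\<lambda>\<close> is a composite over letters. It is compared with the
  closed form by the homomorphism property of the closed form and the factorization
  \<open>(t, u) = (t t\<^sup>-\<^sup>1, \<epsilon>) (\<nu>(u), u)\<close>.\<close>

locale inv_semigroup =
  fixes S :: "'a sgroup" (structure)
  assumes inverse_semigroup: "inverse_semigroup S"
begin

lemma closed [simp, intro]: "x \<in> carrier S \<Longrightarrow> y \<in> carrier S \<Longrightarrow> x \<cdot> y \<in> carrier S"
  using inverse_semigroup by (simp add: inverse_semigroup_def)

lemma assoc:
  "x \<in> carrier S \<Longrightarrow> y \<in> carrier S \<Longrightarrow> z \<in> carrier S \<Longrightarrow> (x \<cdot> y) \<cdot> z = x \<cdot> (y \<cdot> z)"
  using inverse_semigroup by (simp add: inverse_semigroup_def)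

lemma ex1_inverse: "x \<in> carrier S \<Longrightarrow> \<exists>!y. y \<in> carrier S \<and> x \<cdot> y \<cdot> x = x \<and> y \<cdot> x \<cdot> y = y"
  using inverse_semigroup by (simp add: inverse_semigroup_def)

lemma
  assumes "x \<in> carrier S"
  shows sinv_closed [simp, intro]: "sinv S x \<in> carrier S"
    and mult_sinv_mult: "x \<cdot> (sinv S x \<cdot> x) = x"
    and sinv_mult_sinv: "sinv S x \<cdot> (x \<cdot> sinv S x) = sinv S x"
proof -
  have "sinv S x \<in> carrier S \<and> x \<cdot> sinv S x \<cdot> x = x \<and> sinv S x \<cdot> x \<cdot> sinv S x = sinv S x"
    unfolding sinv_def by (rule theI'[OF ex1_inverse[OF assms]])
  then show "sinv S x \<in> carrier S" "x \<cdot> (sinv S x \<cdot> x) = x"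
    "sinv S x \<cdot> (x \<cdot> sinv S x) = sinv S x"
    using assoc[of x "sinv S x" x] assoc[of "sinv S x" x "sinv S x"] assms by auto
qed

lemma sinv_eqI:
  assumes "x \<in> carrier S" "y \<in> carrier S" "x \<cdot> (y \<cdot> x) = x" "y \<cdot> (x \<cdot> y) = y"
  shows "sinv S x = y"
  unfolding sinv_def
  by (rule the1_equality[OF ex1_inverse]) (use assms assoc[of x y x] assoc[of y x y] in auto)

lemma mult_sinv_mult_left [simp]:
  "x \<in> carrier S \<Longrightarrow> y \<in> carrier S \<Longrightarrow> x \<cdot> (sinv S x \<cdot> (x \<cdot> y)) = x \<cdot> y"
  using assoc[of x "sinv S x \<cdot> x" y] mult_sinv_mult[of x] by (simp add: assoc)

lemma sinv_mult_sinv_left [simp]: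
  "x \<in> carrier S \<Longrightarrow> y \<in> carrier S \<Longrightarrow> sinv S x \<cdot> (x \<cdot> (sinv S x \<cdot> y)) = sinv S x \<cdot> y"
  using assoc[of "sinv S x" "x \<cdot> sinv S x" y] sinv_mult_sinv[of x] by (simp add: assoc)

declare mult_sinv_mult [simp] sinv_mult_sinv [simp]

lemma sinv_sinv [simp]: "x \<in> carrier S \<Longrightarrow> sinv S (sinv S x) = x"
  by (rule sinv_eqI) auto

lemma idems_carrier [simp, intro]: "e \<in> idems S \<Longrightarrow> e \<in> carrier S"
  by (simp add: idems_def)

lemma idemsI: "e \<in> carrier S \<Longrightarrow> e \<cdot> e = e \<Longrightarrow> e \<in> idems S"
  unfolding idems_def by blast

lemma idem_idem [simp]: "e \<in> idems S \<Longrightarrow> e \<cdot> e = e"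
  unfolding idems_def by blast

lemma idem_idem_left [simp]: "e \<in> idems S \<Longrightarrow> x \<in> carrier S \<Longrightarrow> e \<cdot> (e \<cdot> x) = e \<cdot> x"
  by (subst assoc[symmetric]) auto

lemma sinv_idem [simp]: "e \<in> idems S \<Longrightarrow> sinv S e = e"
  by (rule sinv_eqI) auto

text \<open>Uniqueness of inverses does the work: with \<open>x\<close> the inverse of
  \<open>e \<cdot> f\<close>, the element \<open>f \<cdot> (x \<cdot> e)\<close> is an inverse of it
  as well, hence equals \<open>x\<close>. It is visibly idempotent, and an idempotent is its own
  inverse.\<close>

lemma idem_mult_idem:
  assumes e: "e \<in> idems S" and f: "f \<in> idems S"
  shows "e \<cdot> f \<in> idems S"
proof -
  define x where "x = sinv S (e \<cdot> f)"
  have c: "e \<in> carrier S" "f \<in> carrier S" "x \<in> carrier S"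
    using e f by (auto simp: x_def)
  have 1: "e \<cdot> (f \<cdot> (x \<cdot> (e \<cdot> f))) = e \<cdot> f" and 2: "x \<cdot> (e \<cdot> (f \<cdot> x)) = x"
    using mult_sinv_mult[of "e \<cdot> f"] sinv_mult_sinv[of "e \<cdot> f"] c
    by (auto simp: x_def[symmetric] assoc simp del: mult_sinv_mult sinv_mult_sinv)
  have x: "x = f \<cdot> (x \<cdot> e)"
    unfolding x_def
  proof (rule sinv_eqI; (fold x_def)?)
    show "e \<cdot> f \<cdot> (f \<cdot> (x \<cdot> e) \<cdot> (e \<cdot> f)) = e \<cdot> f"
      using 1 e f c by (simp add: assoc)
    have "f \<cdot> (x \<cdot> e) \<cdot> (e \<cdot> f \<cdot> (f \<cdot> (x \<cdot> e))) = f \<cdot> (x \<cdot> (e \<cdot> (f \<cdot> x))) \<cdot> e"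
      using e f c by (simp add: assoc)
    then show "f \<cdot> (x \<cdot> e) \<cdot> (e \<cdot> f \<cdot> (f \<cdot> (x \<cdot> e))) = f \<cdot> (x \<cdot> e)"
      using 2 c by (simp add: assoc)
  qed (use c in auto)
  have "f \<cdot> (x \<cdot> e) \<cdot> (f \<cdot> (x \<cdot> e)) = f \<cdot> (x \<cdot> (e \<cdot> (f \<cdot> x))) \<cdot> e"
    using c by (simp add: assoc)
  also have "\<dots> = f \<cdot> (x \<cdot> e)"
    using 2 c by (simp add: assoc)
  finally have "f \<cdot> (x \<cdot> e) \<in> idems S"
    using c by (intro idemsI) auto
  then have "x \<in> idems S"
    by (subst x)
  moreover have "sinv S x = e \<cdot> f"
    using c by (simp add: x_def)
  ultimately show ?thesis
    by simp
qed

text \<open>Once products of idempotents are idempotent, \<open>f \<cdot> e\<close> is an inverse of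
  \<open>e \<cdot> f\<close>, which is also its own inverse; uniqueness identifies the two.\<close>

lemma idem_commute:
  assumes e: "e \<in> idems S" and f: "f \<in> idems S"
  shows "e \<cdot> f = f \<cdot> e"
proof -
  have c: "e \<in> carrier S" "f \<in> carrier S"
    using e f by auto
  have "sinv S (e \<cdot> f) = f \<cdot> e"
  proof (rule sinv_eqI)
    show "e \<cdot> f \<cdot> (f \<cdot> e \<cdot> (e \<cdot> f)) = e \<cdot> f"
      using idem_idem[OF idem_mult_idem[OF e f]] e f c by (simp add: assoc)
    show "f \<cdot> e \<cdot> (e \<cdot> f \<cdot> (f \<cdot> e)) = f \<cdot> e"
      using idem_idem[OF idem_mult_idem[OF f e]] e f c by (simp add: assoc)
  qed (use c in auto)
  then show ?thesis
    using sinv_idem[OF idem_mult_idem[OF e f]] by simp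
qed

lemma mult_sinv_idem [simp, intro]: "x \<in> carrier S \<Longrightarrow> x \<cdot> sinv S x \<in> idems S"
  by (rule idemsI) (auto simp: assoc)

lemma sinv_mult_idem [simp, intro]: "x \<in> carrier S \<Longrightarrow> sinv S x \<cdot> x \<in> idems S"
  by (rule idemsI) (auto simp: assoc)

lemma sinv_mult:
  assumes x: "x \<in> carrier S" and y: "y \<in> carrier S"
  shows "sinv S (x \<cdot> y) = sinv S y \<cdot> sinv S x"
proof (rule sinv_eqI)
  have comm: "(sinv S x \<cdot> x) \<cdot> (y \<cdot> sinv S y) = (y \<cdot> sinv S y) \<cdot> (sinv S x \<cdot> x)"
    using x y by (intro idem_commute) auto
  have "x \<cdot> y \<cdot> (sinv S y \<cdot> sinv S x \<cdot> (x \<cdot> y)) = x \<cdot> ((y \<cdot> sinv S y) \<cdot> (sinv S x \<cdot> x)) \<cdot> y"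
    using x y by (simp add: assoc)
  also have "\<dots> = x \<cdot> y"
    unfolding comm[symmetric] using x y by (simp add: assoc)
  finally show "x \<cdot> y \<cdot> (sinv S y \<cdot> sinv S x \<cdot> (x \<cdot> y)) = x \<cdot> y" .
  have "sinv S y \<cdot> sinv S x \<cdot> (x \<cdot> y \<cdot> (sinv S y \<cdot> sinv S x))
      = sinv S y \<cdot> ((sinv S x \<cdot> x) \<cdot> (y \<cdot> sinv S y)) \<cdot> sinv S x"
    using x y by (simp add: assoc)
  also have "\<dots> = sinv S y \<cdot> sinv S x"
    unfolding comm using x y by (simp add: assoc)
  finally show "sinv S y \<cdot> sinv S x \<cdot> (x \<cdot> y \<cdot> (sinv S y \<cdot> sinv S x)) = sinv S y \<cdot> sinv S x" .
qed (use x y in auto)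

lemma rng_idem [simp, intro]: "x \<in> carrier S \<Longrightarrow> rng S x \<in> idems S"
  by (simp add: rng_def)

lemma rng_of_idem [simp]: "e \<in> idems S \<Longrightarrow> rng S e = e"
  by (simp add: rng_def)

lemma rng_mult_self [simp]: "x \<in> carrier S \<Longrightarrow> rng S x \<cdot> x = x"
  by (simp add: rng_def assoc)

lemma rng_mult_self_left [simp]:
  "x \<in> carrier S \<Longrightarrow> y \<in> carrier S \<Longrightarrow> rng S x \<cdot> (x \<cdot> y) = x \<cdot> y"
  by (subst assoc[symmetric]) auto

lemma conj_idem [simp, intro]:
  assumes "x \<in> carrier S" "e \<in> idems S"
  shows "x \<cdot> e \<cdot> sinv S x \<in> idems S"
proof -
  have "x \<cdot> e \<cdot> sinv S x = (x \<cdot> e) \<cdot> sinv S (x \<cdot> e)"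
    using assms by (simp add: sinv_mult assoc)
  then show ?thesis
    using assms by simp
qed

lemma rng_mult:
  assumes "x \<in> carrier S" "y \<in> carrier S"
  shows "rng S (x \<cdot> y) = x \<cdot> rng S y \<cdot> sinv S x"
  using assms by (simp add: rng_def sinv_mult assoc)

lemma rng_idem_mult:
  assumes "e \<in> idems S" "y \<in> carrier S"
  shows "rng S (e \<cdot> y) = e \<cdot> rng S y"
  using assms idem_commute[of e "rng S y"] by (simp add: rng_mult assoc)

lemma rng_mult_le [simp]:
  assumes "x \<in> carrier S" "y \<in> carrier S"
  shows "rng S (x \<cdot> y) \<cdot> rng S x = rng S (x \<cdot> y)"
  using assms by (simp add: rng_def assoc sinv_mult)

text \<open>The natural order is defined by idempotents on the left; this passage from right to left
  makes it two-sided and is behind its compatibility with products and inverses.\<close>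

lemma mult_idem_eq:
  assumes "x \<in> carrier S" "e \<in> idems S"
  shows "x \<cdot> e = (x \<cdot> e \<cdot> sinv S x) \<cdot> x"
proof -
  have "x \<cdot> e = x \<cdot> (sinv S x \<cdot> x) \<cdot> e"
    using assms by simp
  also have "\<dots> = x \<cdot> ((sinv S x \<cdot> x) \<cdot> e)"
    using assms by (intro assoc) auto
  also have "(sinv S x \<cdot> x) \<cdot> e = e \<cdot> (sinv S x \<cdot> x)"
    using assms by (intro idem_commute) auto
  finally show ?thesis
    using assms by (simp add: assoc)
qed

lemma nat_leD: "nat_le S x y \<Longrightarrow> y \<in> carrier S \<Longrightarrow> x = rng S x \<cdot> y"
  by (auto simp: nat_le_def rng_idem_mult assoc)

lemma nat_leI: "e \<in> idems S \<Longrightarrow> nat_le S (e \<cdot> x) x"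
  by (auto simp: nat_le_def)

lemma nat_le_refl [simp, intro]: "x \<in> carrier S \<Longrightarrow> nat_le S x x"
  by (metis nat_leI rng_idem rng_mult_self)

lemma nat_le_multI: "x \<in> carrier S \<Longrightarrow> e \<in> idems S \<Longrightarrow> nat_le S (x \<cdot> e) x"
  using mult_idem_eq[of x e] nat_leI[OF conj_idem, of x e x] by simp

lemma nat_le_trans: "nat_le S x y \<Longrightarrow> nat_le S y z \<Longrightarrow> z \<in> carrier S \<Longrightarrow> nat_le S x z"
  using nat_leI[OF idem_mult_idem] by (auto simp: nat_le_def assoc[symmetric])

lemma nat_le_mult:
  assumes "nat_le S x x'" "nat_le S y y'" "x' \<in> carrier S" "y' \<in> carrier S"
  shows "nat_le S (x \<cdot> y) (x' \<cdot> y')"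
proof -
  obtain e f where e: "e \<in> idems S" "x = e \<cdot> x'" and f: "f \<in> idems S" "y = f \<cdot> y'"
    using assms by (auto simp: nat_le_def)
  have "x \<cdot> y = e \<cdot> ((x' \<cdot> f) \<cdot> y')"
    using e f assms by (simp add: assoc)
  also have "\<dots> = e \<cdot> (((x' \<cdot> f \<cdot> sinv S x') \<cdot> x') \<cdot> y')"
    using mult_idem_eq[of x' f] f assms by simp
  also have "\<dots> = (e \<cdot> (x' \<cdot> f \<cdot> sinv S x')) \<cdot> (x' \<cdot> y')"
    using e f assms by (simp add: assoc)
  finally show ?thesis
    using nat_leI[OF idem_mult_idem[of e "x' \<cdot> f \<cdot> sinv S x'"]] e f assms by simp
qed

lemma nat_le_sinv:
  assumes "nat_le S x y" "y \<in> carrier S"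
  shows "nat_le S (sinv S x) (sinv S y)"
  using assms nat_le_multI[of "sinv S y"] by (auto simp: nat_le_def[of S x] sinv_mult)

lemma nat_le_carrier: "nat_le S x y \<Longrightarrow> y \<in> carrier S \<Longrightarrow> x \<in> carrier S"
  by (auto simp: nat_le_def)

text \<open>Anything below \<open>y\<close> is its own range times \<open>y\<close>, so ranges
  detect equality of comparable elements. This is how order preservation later yields
  equations.\<close>

lemma nat_le_eq_rng: "nat_le S x y \<Longrightarrow> y \<in> carrier S \<Longrightarrow> rng S x = rng S y \<Longrightarrow> x = y"
  by (metis nat_leD rng_mult_self)

end

lemma shom_closed: "f \<in> shom S S' \<Longrightarrow> x \<in> carrier S \<Longrightarrow> f x \<in> carrier S'"
  by (auto simp: shom_def)

lemma shom_mult: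
  "f \<in> shom S S' \<Longrightarrow> x \<in> carrier S \<Longrightarrow> y \<in> carrier S \<Longrightarrow> f (x \<cdot>\<^bsub>S\<^esub> y) = f x \<cdot>\<^bsub>S'\<^esub> f y"
  by (auto simp: shom_def)

lemma shom_sinv:
  assumes "inverse_semigroup S" "inverse_semigroup S'" "f \<in> shom S S'" "x \<in> carrier S"
  shows "f (sinv S x) = sinv S' (f x)"
proof -
  interpret S: inv_semigroup S by unfold_locales fact
  interpret S': inv_semigroup S' by unfold_locales fact
  note [simp] = shom_closed[OF assms(3)] shom_mult[OF assms(3), symmetric] assms(4)
  show ?thesis
    by (rule S'.sinv_eqI[symmetric]) auto
qed

lemma shom_idems:
  assumes "f \<in> shom S S'" "e \<in> idems S"
  shows "f e \<in> idems S'"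
  using assms shom_mult[OF assms(1), of e e, symmetric] by (auto simp: idems_def shom_closed)

section \<open>Semilattices of abelian groups\<close>

locale comm_inv_semigroup = inv_semigroup A for A :: "'a sgroup" (structure) +
  assumes commute: "x \<in> carrier A \<Longrightarrow> y \<in> carrier A \<Longrightarrow> x \<cdot> y = y \<cdot> x"
begin

lemma left_commute:
  "x \<in> carrier A \<Longrightarrow> y \<in> carrier A \<Longrightarrow> z \<in> carrier A \<Longrightarrow> x \<cdot> (y \<cdot> z) = y \<cdot> (x \<cdot> z)"
  using commute[of x y] assoc[of x y z] assoc[of y x z] by simp

lemmas ac = assoc commute left_commute

lemma component_iff: "a \<in> component A e \<longleftrightarrow> a \<in> carrier A \<and> rng A a = e"
  using commute by (auto simp: component_def rng_def)

lemma sinv_mult_comm: "x \<in> carrier A \<Longrightarrow> y \<in> carrier A \<Longrightarrow> sinv A (x \<cdot> y) = sinv A x \<cdot> sinv A y"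
  by (simp add: sinv_mult commute)

lemma rng_mult_comm: "x \<in> carrier A \<Longrightarrow> y \<in> carrier A \<Longrightarrow> rng A (x \<cdot> y) = rng A x \<cdot> rng A y"
  by (simp add: rng_def sinv_mult_comm ac)

lemma rng_sinv [simp]: "x \<in> carrier A \<Longrightarrow> rng A (sinv A x) = rng A x"
  by (simp add: rng_def commute)

lemma rng_mult_absorb:
  "a \<in> carrier A \<Longrightarrow> e \<in> idems A \<Longrightarrow> rng A a \<cdot> e = rng A a \<Longrightarrow> e \<cdot> a = a"
  using assoc[of e "rng A a" a] commute[of e "rng A a"] by simp

end

text \<open>The inverse of \<open>a\<close> inside its block of the partition satisfies the
  equations that define \<open>sinv\<close>, so by uniqueness it is \<open>sinv A a\<close>, and it
  commutes with \<open>a\<close>.\<close>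

lemma semilattice_of_groups_rng:
  assumes "semilattice_of_groups A" "a \<in> carrier A"
  shows "a \<cdot>\<^bsub>A\<^esub> sinv A a = sinv A a \<cdot>\<^bsub>A\<^esub> a"
proof -
  interpret inv_semigroup A
    using assms by unfold_locales (simp add: semilattice_of_groups_def)
  obtain \<G> where \<G>: "partition_on (carrier A) \<G>"
    and grp: "\<And>G. G \<in> \<G> \<Longrightarrow> \<exists>e. group \<lparr>carrier = G, mult = sgmult A, one = e\<rparr>"
    using assms(1) by (auto simp: semilattice_of_groups_def)
  obtain G where G: "G \<in> \<G>" "a \<in> G" "G \<subseteq> carrier A"
    using partition_onD1[OF \<G>] assms(2) by blast
  obtain e where "group \<lparr>carrier = G, mult = sgmult A, one = e\<rparr>"
    using grp G by blast
  then interpret G: group "\<lparr>carrier = G, mult = sgmult A, one = e\<rparr>" .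
  obtain b where b: "b \<in> G" "b \<cdot>\<^bsub>A\<^esub> a = e" "a \<cdot>\<^bsub>A\<^esub> b = e"
    using G.r_inv_ex[of a] G.l_inv_ex[of a] G.inv_closed[of a] G.l_inv[of a] G.r_inv[of a] G by force
  have "a \<cdot>\<^bsub>A\<^esub> e = a" "b \<cdot>\<^bsub>A\<^esub> e = b"
    using G.r_one[of a] G.r_one[of b] b G by auto
  then have "sinv A a = b"
    using b G assms(2) by (intro sinv_eqI) auto
  then show ?thesis
    using b by simp
qed

text \<open>The groups are the fibres of \<open>rng\<close>. The hypothesis makes \<open>e\<close>
  both the left and the right idempotent of each element of its fibre, and this closes the fibre
  under products.\<close>

lemma semilattice_of_groupsI:
  assumes S: "inverse_semigroup S"
    and flip: "\<And>x. x \<in> carrier S \<Longrightarrow> x \<cdot>\<^bsub>S\<^esub> sinv S x = sinv S x \<cdot>\<^bsub>S\<^esub> x"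
  shows "semilattice_of_groups S"
proof -
  interpret inv_semigroup S
    by unfold_locales (rule S)
  define G where "G e = {x \<in> carrier S. rng S x = e}" for e
  have "partition_on (carrier S) (G ` idems S)"
  proof (rule partition_onI)
    have "e \<in> G e" if "e \<in> idems S" for e
      using that by (simp add: G_def)
    then show "{} \<notin> G ` idems S"
      by fastforce
  qed (auto simp: G_def disjnt_def)
  moreover have "group \<lparr>carrier = G e, mult = sgmult S, one = e\<rparr>" if e: "e \<in> idems S" for e
  proof (rule groupI; simp)
    show "x \<cdot>\<^bsub>S\<^esub> y \<in> G e" if "x \<in> G e" "y \<in> G e" for x y
    proof -
      have xy: "x \<in> carrier S" "y \<in> carrier S" "rng S y = e"
        and ex: "e = x \<cdot>\<^bsub>S\<^esub> sinv S x" "e = sinv S x \<cdot>\<^bsub>S\<^esub> x"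
        using that flip[of x] by (auto simp: G_def rng_def)
      have "rng S (x \<cdot>\<^bsub>S\<^esub> y) = x \<cdot>\<^bsub>S\<^esub> (sinv S x \<cdot>\<^bsub>S\<^esub> x) \<cdot>\<^bsub>S\<^esub> sinv S x"
        using xy by (simp add: rng_mult flip: ex(2))
      also have "\<dots> = e"
        unfolding ex(1) using xy by (simp add: assoc)
      finally show ?thesis
        using xy by (simp add: G_def)
    qed
    show "e \<in> G e"
      using e by (simp add: G_def)
    show "x \<cdot>\<^bsub>S\<^esub> y \<cdot>\<^bsub>S\<^esub> z = x \<cdot>\<^bsub>S\<^esub> (y \<cdot>\<^bsub>S\<^esub> z)" if "x \<in> G e" "y \<in> G e" "z \<in> G e" for x y z
      using that by (intro assoc) (auto simp: G_def)
    show "e \<cdot>\<^bsub>S\<^esub> x = x" if "x \<in> G e" for x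
      using that rng_mult_self[of x] by (simp add: G_def)
    show "\<exists>y\<in>G e. y \<cdot>\<^bsub>S\<^esub> x = e" if "x \<in> G e" for x
      using that flip[of x] flip[of "sinv S x"] by (intro bexI[of _ "sinv S x"]) (auto simp: G_def rng_def)
  qed
  ultimately show ?thesis
    using S unfolding semilattice_of_groups_def by blast
qed

text \<open>Applying \<open>a a\<^sup>-\<^sup>1 = a\<^sup>-\<^sup>1 a\<close> to \<open>e a\<close>
  in place of \<open>a\<close> gives \<open>a\<^sup>-\<^sup>1 e a = e a a\<^sup>-\<^sup>1\<close>;
  multiplication by \<open>a\<close> on the left turns this into centrality.\<close>

lemma semilattice_of_groups_central:
  assumes "semilattice_of_groups A" and e: "e \<in> idems A" and a: "a \<in> carrier A"
  shows "e \<cdot>\<^bsub>A\<^esub> a = a \<cdot>\<^bsub>A\<^esub> e"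
proof -
  interpret inv_semigroup A
    using assms by unfold_locales (simp add: semilattice_of_groups_def)
  note flip = semilattice_of_groups_rng[OF assms(1)]
  have comm: "a \<cdot>\<^bsub>A\<^esub> (sinv A a \<cdot>\<^bsub>A\<^esub> e) = e \<cdot>\<^bsub>A\<^esub> (a \<cdot>\<^bsub>A\<^esub> sinv A a)"
    using idem_commute[of e "a \<cdot>\<^bsub>A\<^esub> sinv A a"] a e by (simp add: assoc)
  have "sinv A a \<cdot>\<^bsub>A\<^esub> (e \<cdot>\<^bsub>A\<^esub> a) = e \<cdot>\<^bsub>A\<^esub> (a \<cdot>\<^bsub>A\<^esub> (sinv A a \<cdot>\<^bsub>A\<^esub> e))"
    using flip[of "e \<cdot>\<^bsub>A\<^esub> a"] a e by (simp add: sinv_mult assoc)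
  also have "\<dots> = e \<cdot>\<^bsub>A\<^esub> (a \<cdot>\<^bsub>A\<^esub> sinv A a)"
    unfolding comm using a e by simp
  finally have "a \<cdot>\<^bsub>A\<^esub> (e \<cdot>\<^bsub>A\<^esub> (a \<cdot>\<^bsub>A\<^esub> sinv A a)) = a \<cdot>\<^bsub>A\<^esub> (sinv A a \<cdot>\<^bsub>A\<^esub> (e \<cdot>\<^bsub>A\<^esub> a))"
    by simp
  also have "\<dots> = (a \<cdot>\<^bsub>A\<^esub> sinv A a) \<cdot>\<^bsub>A\<^esub> e \<cdot>\<^bsub>A\<^esub> a"
    using a e by (simp add: assoc)
  also have "\<dots> = e \<cdot>\<^bsub>A\<^esub> a"
    using a e idem_commute[of "a \<cdot>\<^bsub>A\<^esub> sinv A a" e] by (simp add: assoc)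
  finally have 1: "e \<cdot>\<^bsub>A\<^esub> a = a \<cdot>\<^bsub>A\<^esub> (e \<cdot>\<^bsub>A\<^esub> (a \<cdot>\<^bsub>A\<^esub> sinv A a))" ..
  have "e \<cdot>\<^bsub>A\<^esub> (a \<cdot>\<^bsub>A\<^esub> sinv A a) = sinv A a \<cdot>\<^bsub>A\<^esub> a \<cdot>\<^bsub>A\<^esub> e"
    using a e idem_commute[of e "a \<cdot>\<^bsub>A\<^esub> sinv A a"] flip[of a] by simp
  then show ?thesis
    using 1 a e by (simp add: assoc)
qed

text \<open>Commutativity is assumed inside single components. Multiplying \<open>x\<close> and
  \<open>y\<close> by the product \<open>e\<close> of their ranges moves both into the component of
  \<open>e\<close>, and central idempotents leave the products \<open>x y\<close> and
  \<open>y x\<close> unchanged.\<close>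

lemma semilattice_of_abelian_groups_comm:
  assumes "semilattice_of_abelian_groups A"
  shows "comm_inv_semigroup A"
proof -
  interpret inv_semigroup A
    using assms by unfold_locales
      (simp add: semilattice_of_abelian_groups_def semilattice_of_groups_def)
  have sg: "semilattice_of_groups A"
    using assms by (simp add: semilattice_of_abelian_groups_def)
  note flip = semilattice_of_groups_rng[OF sg]
  note central = semilattice_of_groups_central[OF sg]
  show ?thesis
  proof unfold_locales
    fix x y assume x: "x \<in> carrier A" and y: "y \<in> carrier A"
    define e where "e = rng A x \<cdot>\<^bsub>A\<^esub> rng A y"
    have e: "e \<in> idems A"
      using x y by (auto simp: e_def idem_mult_idem)
    have comp: "e \<cdot>\<^bsub>A\<^esub> z \<in> component A e" if "z = x \<or> z = y" for z
    proof -
      have z: "z \<in> carrier A" "e \<cdot>\<^bsub>A\<^esub> rng A z = e"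
        using that x y idem_commute[of "rng A x" "rng A y"] by (auto simp: e_def assoc)
      then have "(e \<cdot>\<^bsub>A\<^esub> z) \<cdot>\<^bsub>A\<^esub> sinv A (e \<cdot>\<^bsub>A\<^esub> z) = e"
        using rng_idem_mult[OF e z(1)] by (simp add: rng_def)
      then show ?thesis
        using z e flip[of "e \<cdot>\<^bsub>A\<^esub> z"] by (simp add: component_def)
    qed
    have "comm_group \<lparr>carrier = component A e, mult = sgmult A, one = e\<rparr>"
      using assms e by (simp add: semilattice_of_abelian_groups_def)
    then interpret G: comm_group "\<lparr>carrier = component A e, mult = sgmult A, one = e\<rparr>" .
    have com: "(e \<cdot>\<^bsub>A\<^esub> x) \<cdot>\<^bsub>A\<^esub> (e \<cdot>\<^bsub>A\<^esub> y) = (e \<cdot>\<^bsub>A\<^esub> y) \<cdot>\<^bsub>A\<^esub> (e \<cdot>\<^bsub>A\<^esub> x)"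
      using G.m_comm[of "e \<cdot>\<^bsub>A\<^esub> x" "e \<cdot>\<^bsub>A\<^esub> y"] comp by simp
    have "e \<cdot>\<^bsub>A\<^esub> (x \<cdot>\<^bsub>A\<^esub> y) = x \<cdot>\<^bsub>A\<^esub> y" if "x \<in> carrier A" "y \<in> carrier A"
      "e = rng A x \<cdot>\<^bsub>A\<^esub> rng A y \<or> e = rng A y \<cdot>\<^bsub>A\<^esub> rng A x" for x y
    proof -
      have "e = rng A x \<cdot>\<^bsub>A\<^esub> rng A y"
        using that idem_commute[of "rng A x" "rng A y"] by auto
      moreover have "rng A y \<cdot>\<^bsub>A\<^esub> (x \<cdot>\<^bsub>A\<^esub> y) = x \<cdot>\<^bsub>A\<^esub> y"
        using that central[of "rng A y" x] assoc[of "rng A y" x y] assoc[of x "rng A y" y] by simp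
      ultimately show ?thesis
        using that by (simp add: assoc)
    qed
    moreover have "(e \<cdot>\<^bsub>A\<^esub> z) \<cdot>\<^bsub>A\<^esub> (e \<cdot>\<^bsub>A\<^esub> z') = e \<cdot>\<^bsub>A\<^esub> (z \<cdot>\<^bsub>A\<^esub> z')"
      if "z \<in> carrier A" "z' \<in> carrier A" for z z'
    proof -
      have "(e \<cdot>\<^bsub>A\<^esub> z) \<cdot>\<^bsub>A\<^esub> (e \<cdot>\<^bsub>A\<^esub> z') = e \<cdot>\<^bsub>A\<^esub> ((z \<cdot>\<^bsub>A\<^esub> e) \<cdot>\<^bsub>A\<^esub> z')"
        using that e by (simp add: assoc)
      then show ?thesis
        unfolding central[OF e that(1), symmetric] using that e by (simp add: assoc)
    qed
    ultimately show "x \<cdot>\<^bsub>A\<^esub> y = y \<cdot>\<^bsub>A\<^esub> x"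
      using com x y idem_commute[of "rng A x" "rng A y"] by (metis e_def)
  qed
qed

section \<open>Products along words\<close>

text \<open>A word is read from left to right starting at a prefix \<open>p\<close>.  The letter \<open>[x]\<close> contributes
  \<open>f p x\<close> and moves to \<open>p x\<close>; the letter \<open>[x]\<^sup>-\<^sup>1\<close> traverses the same edge backwards.\<close>

fun step :: "'t sgroup \<Rightarrow> 'a sgroup \<Rightarrow> ('t \<Rightarrow> 't \<Rightarrow> 'a) \<Rightarrow> 't \<Rightarrow> 't letter \<Rightarrow> 'a" where
  "step T A f p (Pos x) = f p x"
| "step T A f p (Neg x) = sinv A (f (p \<cdot>\<^bsub>T\<^esub> sinv T x) x)"

text \<open>\<open>A\<close> has no identity, so a value for the empty product has to be supplied:
  \<open>g p\<close> is meant to be the identity of the component that belongs to the prefix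
  \<open>p\<close>.\<close>

fun run :: "'t sgroup \<Rightarrow> 'a sgroup \<Rightarrow> ('t \<Rightarrow> 'a) \<Rightarrow> ('t \<Rightarrow> 't \<Rightarrow> 'a) \<Rightarrow> 't \<Rightarrow> 't letter list \<Rightarrow> 'a" where
  "run T A g f p [] = g p"
| "run T A g f p (l # w) = step T A f p l \<cdot>\<^bsub>A\<^esub> run T A g f (p \<cdot>\<^bsub>T\<^esub> letter_val T l) w"

fun endpt :: "'t sgroup \<Rightarrow> 't \<Rightarrow> 't letter list \<Rightarrow> 't" where
  "endpt T p [] = p"
| "endpt T p (l # w) = endpt T (p \<cdot>\<^bsub>T\<^esub> letter_val T l) w"

definition letters_in :: "'t letter list \<Rightarrow> 't set \<Rightarrow> bool" where
  "letters_in w X \<longleftrightarrow> letter_base ` set w \<subseteq> X"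

lemma letters_in_simps [simp]:
  "letters_in [] X"
  "letters_in (l # w) X \<longleftrightarrow> letter_base l \<in> X \<and> letters_in w X"
  "letters_in (u @ v) X \<longleftrightarrow> letters_in u X \<and> letters_in v X"
  by (auto simp: letters_in_def)

lemma letters_in_reduce [simp]: "letters_in w X \<Longrightarrow> letters_in (reduce w) X"
  using letter_base_reduce by (simp add: letters_in_def)

definition winv :: "'t letter list \<Rightarrow> 't letter list" where
  "winv w = rev (map letter_inv w)"

lemma winv_simps [simp]: "winv [] = []" "winv (l # w) = winv w @ [letter_inv l]"
  by (auto simp: winv_def)

lemma letters_in_winv [simp]: "letters_in (winv w) X \<longleftrightarrow> letters_in w X"
  by (simp add: letters_in_def winv_def image_image)

lemma reduced_winv: "reduced w \<Longrightarrow> reduced (winv w)"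
  unfolding reduced_def winv_def successively_rev successively_map
  by (erule successively_mono) (metis letter_inv_inv)

lemma winv_winv [simp]: "winv (winv w) = w"
  by (simp add: winv_def rev_map comp_def)

lemma reduce_winv_append: "reduced w \<Longrightarrow> reduce (winv w @ w) = []"
  using reduce_rev_inv by (simp add: winv_def)

lemma reduce_append_winv: "reduced w \<Longrightarrow> reduce (w @ winv w) = []"
  using reduce_winv_append[OF reduced_winv[of w]] by simp

section \<open>Endpoints of walks, and the inequality caused by cancelling letters\<close>

context inv_semigroup
begin

lemma letter_val_closed [simp]: "letter_base l \<in> carrier S \<Longrightarrow> letter_val S l \<in> carrier S"
  by (cases l) auto

lemma letter_val_inv [simp]:
  "letter_base l \<in> carrier S \<Longrightarrow> letter_val S (letter_inv l) = sinv S (letter_val S l)"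
  by (cases l) auto

lemma endpt_closed [simp]: "p \<in> carrier S \<Longrightarrow> letters_in w (carrier S) \<Longrightarrow> endpt S p w \<in> carrier S"
  by (induction w arbitrary: p) auto

lemma endpt_append [simp]: "endpt S p (u @ v) = endpt S (endpt S p u) v"
  by (induction u arbitrary: p) auto

lemma endpt_mult:
  "p \<in> carrier S \<Longrightarrow> q \<in> carrier S \<Longrightarrow> letters_in w (carrier S) \<Longrightarrow> endpt S (p \<cdot> q) w = p \<cdot> endpt S q w"
  by (induction w arbitrary: q) (auto simp: assoc)

text \<open>Going along \<open>x\<close> and back shrinks the prefix \<open>p\<close> to a
  restriction of itself. This is the source of every inequality between a word and its reduced
  form.\<close>

lemma mult_sinv_right_le:
  assumes "p \<in> carrier S" "x \<in> carrier S"
  shows "p \<cdot> x \<cdot> sinv S x = rng S (p \<cdot> x) \<cdot> p"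
  using assms mult_idem_eq[of p "x \<cdot> sinv S x"] by (simp add: rng_def sinv_mult assoc)

text \<open>A cancelled pair contributes only the idempotent \<open>rng (p x)\<close> on the left,
  and left factors pass through the rest of the walk by \<open>endpt_mult\<close>.\<close>

lemma endpt_red_cons:
  assumes "p \<in> carrier S" "letters_in (l # w) (carrier S)"
  shows "nat_le S (endpt S p (l # w)) (endpt S p (red_cons l w))"
proof (cases w)
  case (Cons m v)
  show ?thesis
  proof (cases "m = letter_inv l")
    case True
    then have "endpt S p (l # w) = rng S (p \<cdot> letter_val S l) \<cdot> endpt S p v"
      using assms Cons by (simp add: mult_sinv_right_le endpt_mult)
    then show ?thesis
      using assms Cons True by (simp add: nat_leI)
  qed (use assms Cons in auto)
qed (use assms in auto)

lemma endpt_reduce: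
  "p \<in> carrier S \<Longrightarrow> letters_in w (carrier S) \<Longrightarrow> nat_le S (endpt S p w) (endpt S p (reduce w))"
proof (induction w arbitrary: p)
  case (Cons l w)
  have red: "reduce (l # w) = red_cons l (reduce w)"
    by (simp add: reduce_def)
  have lw: "letters_in (l # reduce w) (carrier S)" "letters_in (reduce (l # w)) (carrier S)"
    using Cons.prems letters_in_reduce[of "l # w"] by auto
  have "nat_le S (endpt S p (l # w)) (endpt S p (l # reduce w))"
    using Cons by simp
  also note endpt_red_cons[OF Cons.prems(1) lw(1)]
  finally (nat_le_trans) show ?case
    using lw Cons.prems by (simp add: red)
qed (auto simp: reduce_def)

lemma endpt_winv:
  "p \<in> carrier S \<Longrightarrow> letters_in w (carrier S) \<Longrightarrow>
    endpt S (endpt S p w) (winv w) = rng S (endpt S p w) \<cdot> p"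
proof (induction w arbitrary: p)
  case (Cons l w)
  let ?x = "letter_val S l"
  have c: "?x \<in> carrier S" "p \<in> carrier S" "letters_in w (carrier S)"
    using Cons.prems by auto
  have "endpt S (endpt S p (l # w)) (winv (l # w))
      = rng S (endpt S (p \<cdot> ?x) w) \<cdot> (p \<cdot> ?x \<cdot> sinv S ?x)"
    using Cons c by (simp add: assoc)
  also have "\<dots> = (rng S (endpt S (p \<cdot> ?x) w) \<cdot> rng S (p \<cdot> ?x)) \<cdot> p"
    using c by (subst mult_sinv_right_le) (auto simp: assoc)
  \<comment> \<open>Writing \<open>p \<cdot> ?x\<close> as itself times its source idempotent
    exhibits the endpoint as a right multiple of \<open>p \<cdot> ?x\<close>, so that
    \<open>rng_mult_le\<close> applies.\<close>
  also have "rng S (endpt S (p \<cdot> ?x) w) \<cdot> rng S (p \<cdot> ?x) = rng S (endpt S (p \<cdot> ?x) w)"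
    using c endpt_mult[of "p \<cdot> ?x" "sinv S (p \<cdot> ?x) \<cdot> (p \<cdot> ?x)" w]
      rng_mult_le[of "p \<cdot> ?x" "endpt S (sinv S (p \<cdot> ?x) \<cdot> (p \<cdot> ?x)) w"] by simp
  finally show ?case
    by simp
qed simp

end

section \<open>Modules\<close>

locale inv_module =
  fixes T :: "'t sgroup" and A :: "'a sgroup"
    and \<theta> :: "'t \<Rightarrow> 'a" and \<eta> :: "'t \<Rightarrow> 'a \<Rightarrow> 'a"
  assumes T: "inverse_semigroup T"
    and module: "T_module T A \<theta> \<eta>"
begin

sublocale T: inv_semigroup T
  by unfold_locales (rule T)

sublocale A: comm_inv_semigroup A
  using module by (intro semilattice_of_abelian_groups_comm) (simp add: T_module_def)

abbreviation tmult (infixl "\<odot>" 75) where "x \<odot> y \<equiv> x \<cdot>\<^bsub>T\<^esub> y"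
abbreviation amult (infixl "\<bullet>" 70) where "a \<bullet> b \<equiv> a \<cdot>\<^bsub>A\<^esub> b"

abbreviation \<rho> where "\<rho> x \<equiv> \<theta> (rng T x)"

lemma
  shows \<theta>_shom: "\<theta> \<in> shom (idem_sgroup T) (idem_sgroup A)"
    and \<theta>_bij: "bij_betw \<theta> (idems T) (idems A)"
  using module by (auto simp: T_module_def siso_def idem_sgroup_def)

lemma \<theta>_idem [simp, intro]: "e \<in> idems T \<Longrightarrow> \<theta> e \<in> idems A"
  using \<theta>_bij bij_betwE by blast

lemma \<theta>_mult: "e \<in> idems T \<Longrightarrow> f \<in> idems T \<Longrightarrow> \<theta> (e \<odot> f) = \<theta> e \<bullet> \<theta> f"
  using shom_mult[OF \<theta>_shom, of e f] by (simp add: idem_sgroup_def)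

lemma \<theta>_surj:
  assumes "f \<in> idems A"
  obtains e where "e \<in> idems T" "\<theta> e = f"
proof -
  have "f \<in> \<theta> ` idems T"
    using \<theta>_bij assms by (simp add: bij_betw_imp_surj_on)
  then show thesis
    by (elim imageE) (use that in simp)
qed

lemma \<eta>_rel_end: "t \<in> carrier T \<Longrightarrow> \<eta> t \<in> carrier (rel_end A)"
  using module by (auto simp: T_module_def shom_def)

lemma \<eta>_shom: "t \<in> carrier T \<Longrightarrow> \<eta> t \<in> shom A A"
  using \<eta>_rel_end by (auto simp: rel_end_def endos_def)

lemma \<eta>_closed [simp, intro]: "t \<in> carrier T \<Longrightarrow> a \<in> carrier A \<Longrightarrow> \<eta> t a \<in> carrier A"
  by (rule shom_closed[OF \<eta>_shom])

lemma \<eta>_mult: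
  "t \<in> carrier T \<Longrightarrow> a \<in> carrier A \<Longrightarrow> b \<in> carrier A \<Longrightarrow> \<eta> t (a \<bullet> b) = \<eta> t a \<bullet> \<eta> t b"
  by (rule shom_mult[OF \<eta>_shom])

lemma \<eta>_sinv: "t \<in> carrier T \<Longrightarrow> a \<in> carrier A \<Longrightarrow> \<eta> t (sinv A a) = sinv A (\<eta> t a)"
  by (rule shom_sinv[OF A.inverse_semigroup A.inverse_semigroup \<eta>_shom])

lemma \<eta>_rng: "t \<in> carrier T \<Longrightarrow> a \<in> carrier A \<Longrightarrow> rng A (\<eta> t a) = \<eta> t (rng A a)"
  by (simp add: rng_def \<eta>_mult \<eta>_sinv)

lemma \<eta>_comp:
  assumes "s \<in> carrier T" "t \<in> carrier T" "a \<in> carrier A"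
  shows "\<eta> (s \<odot> t) a = \<eta> s (\<eta> t a)"
proof -
  have "\<eta> (s \<odot> t) = compose (carrier A) (\<eta> s) (\<eta> t)"
    using module assms by (auto simp: T_module_def shom_def rel_end_def)
  then show ?thesis
    using assms by (simp add: compose_def)
qed

lemma \<eta>_idem: "e \<in> idems T \<Longrightarrow> a \<in> carrier A \<Longrightarrow> \<eta> e a = \<theta> e \<bullet> a"
  using module by (simp add: T_module_def)

lemma \<eta>_\<theta>: "t \<in> carrier T \<Longrightarrow> e \<in> idems T \<Longrightarrow> \<eta> t (\<theta> e) = \<theta> (t \<odot> e \<odot> sinv T t)"
  using module by (simp add: T_module_def)

lemma \<eta>_\<rho>: "t \<in> carrier T \<Longrightarrow> x \<in> carrier T \<Longrightarrow> \<eta> t (\<rho> x) = \<rho> (t \<odot> x)"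
  by (simp add: \<eta>_\<theta> T.rng_mult)

lemma \<rho>_le [simp]:
  "x \<in> carrier T \<Longrightarrow> y \<in> carrier T \<Longrightarrow> \<rho> (x \<odot> y) \<bullet> \<rho> x = \<rho> (x \<odot> y)"
  by (simp flip: \<theta>_mult)

lemma \<rho>_idem_mult: "e \<in> idems T \<Longrightarrow> x \<in> carrier T \<Longrightarrow> \<rho> (e \<odot> x) = \<theta> e \<bullet> \<rho> x"
  by (simp add: T.rng_idem_mult \<theta>_mult)

subsection \<open>Products of order-preserving functions\<close>

text \<open>The instances are \<open>\<rho>\<close> and its translates
  \<open>\<lambda>p. \<rho> (t \<odot> p)\<close>: \<open>g p\<close> is the identity of the
  component of a product whose walk has reached \<open>p\<close>. It can only decrease when the walk
  continues or when \<open>p\<close> is restricted.\<close>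

definition weight :: "('t \<Rightarrow> 'a) \<Rightarrow> bool" where
  "weight g \<longleftrightarrow> (\<forall>p\<in>carrier T. g p \<in> idems A \<and> (\<forall>x\<in>carrier T. g (p \<odot> x) \<bullet> g p = g (p \<odot> x)) \<and>
     (\<forall>e\<in>idems T. g (e \<odot> p) \<bullet> g p = g (e \<odot> p)))"

text \<open>The last clause is order preservation in the prefix, put as an equation: over a smaller
  prefix, \<open>f\<close> is cut down to the smaller component.\<close>

definition weighted :: "('t \<Rightarrow> 'a) \<Rightarrow> ('t \<Rightarrow> 't \<Rightarrow> 'a) \<Rightarrow> bool" where
  "weighted g f \<longleftrightarrow> (\<forall>p\<in>carrier T. \<forall>x\<in>carrier T. f p x \<in> carrier A \<and> rng A (f p x) = g (p \<odot> x) \<and>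
     (\<forall>e\<in>idems T. f (e \<odot> p) x = g (e \<odot> p \<odot> x) \<bullet> f p x))"

abbreviation (input) "stp \<equiv> step T A"
abbreviation (input) "prd \<equiv> run T A"
abbreviation (input) "fin \<equiv> endpt T"
abbreviation (input) "val \<equiv> letter_val T"

lemma weight_translate: "t \<in> carrier T \<Longrightarrow> weight (\<lambda>p. \<rho> (t \<odot> p))"
  unfolding weight_def
proof (intro ballI conjI)
  fix p e assume *: "t \<in> carrier T" "p \<in> carrier T" "e \<in> idems T"
  have "t \<odot> (e \<odot> p) = (t \<odot> e \<odot> sinv T t) \<odot> (t \<odot> p)"
    using * T.mult_idem_eq[of t e] by (simp add: T.assoc[symmetric])
  then have "\<rho> (t \<odot> (e \<odot> p)) = \<theta> (t \<odot> e \<odot> sinv T t) \<bullet> \<rho> (t \<odot> p)"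
    using * \<rho>_idem_mult[of "t \<odot> e \<odot> sinv T t" "t \<odot> p"] by simp
  then show "\<rho> (t \<odot> (e \<odot> p)) \<bullet> \<rho> (t \<odot> p) = \<rho> (t \<odot> (e \<odot> p))"
    using * by (simp add: A.assoc)
qed (auto simp: T.assoc[symmetric])

lemma weight_\<rho>: "weight \<rho>"
  unfolding weight_def by (auto simp: \<rho>_idem_mult A.assoc)

lemma run_closed_gen:
  assumes "\<And>p. p \<in> carrier T \<Longrightarrow> g p \<in> carrier A"
    and "\<And>p x. p \<in> carrier T \<Longrightarrow> x \<in> carrier T \<Longrightarrow> f p x \<in> carrier A"
    and "p \<in> carrier T" "letters_in w (carrier T)"
  shows "prd g f p w \<in> carrier A"
  using assms(3,4)
proof (induction w arbitrary: p)
  case (Cons l w)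
  then show ?case
    using assms(2) by (cases l) auto
qed (use assms in auto)

lemma run_cong:
  assumes "\<And>p. p \<in> carrier T \<Longrightarrow> g p = g' p"
    and "\<And>p x. p \<in> carrier T \<Longrightarrow> x \<in> carrier T \<Longrightarrow> f p x = f' p x"
    and "p \<in> carrier T" "letters_in w (carrier T)"
  shows "prd g f p w = prd g' f' p w"
  using assms(3,4)
proof (induction w arbitrary: p)
  case (Cons l w)
  then show ?case
    using assms(2) by (cases l) auto
qed (use assms in auto)

lemma run_\<eta>:
  assumes "t \<in> carrier T" "\<And>p. p \<in> carrier T \<Longrightarrow> g p \<in> carrier A"
    and "\<And>p x. p \<in> carrier T \<Longrightarrow> x \<in> carrier T \<Longrightarrow> f p x \<in> carrier A"
    and "p \<in> carrier T" "letters_in w (carrier T)"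
  shows "\<eta> t (prd g f p w) = prd (\<lambda>p. \<eta> t (g p)) (\<lambda>p x. \<eta> t (f p x)) p w"
  using assms(4,5)
proof (induction w arbitrary: p)
  case (Cons l w)
  then show ?case
    using assms(1-3) run_closed_gen[of g f]
    by (cases l) (auto simp: \<eta>_mult \<eta>_sinv)
qed simp

lemma run_translate:
  assumes "t \<in> carrier T" "p \<in> carrier T" "letters_in w (carrier T)"
  shows "prd g f (t \<odot> p) w = prd (\<lambda>p. g (t \<odot> p)) (\<lambda>p x. f (t \<odot> p) x) p w"
  using assms(2,3)
proof (induction w arbitrary: p)
  case (Cons l w)
  then show ?case
    using assms(1) by (cases l) (auto simp: T.assoc)
qed simp

lemma run_mult:
  assumes g: "\<And>p. p \<in> carrier T \<Longrightarrow> g p \<in> idems A"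
    and f: "\<And>p x. p \<in> carrier T \<Longrightarrow> x \<in> carrier T \<Longrightarrow> f p x \<in> carrier A"
    and f': "\<And>p x. p \<in> carrier T \<Longrightarrow> x \<in> carrier T \<Longrightarrow> f' p x \<in> carrier A"
    and "p \<in> carrier T" "letters_in w (carrier T)"
  shows "prd g (\<lambda>p x. f p x \<bullet> f' p x) p w = prd g f p w \<bullet> prd g f' p w"
  using assms(4,5)
proof (induction w arbitrary: p)
  case (Cons l w)
  then have "prd g f (p \<odot> val l) w \<in> carrier A" "prd g f' (p \<odot> val l) w \<in> carrier A"
    using g f f' by (auto intro!: run_closed_gen)
  then show ?case
    using Cons f f' by (cases l) (auto simp: A.sinv_mult_comm A.ac)
qed (use g in auto)

lemma run_sinv:
  assumes g: "\<And>p. p \<in> carrier T \<Longrightarrow> g p \<in> idems A"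
    and f: "\<And>p x. p \<in> carrier T \<Longrightarrow> x \<in> carrier T \<Longrightarrow> f p x \<in> carrier A"
    and "p \<in> carrier T" "letters_in w (carrier T)"
  shows "prd g (\<lambda>p x. sinv A (f p x)) p w = sinv A (prd g f p w)"
  using assms(3,4)
proof (induction w arbitrary: p)
  case (Cons l w)
  then have "prd g f (p \<odot> val l) w \<in> carrier A"
    using g f by (auto intro!: run_closed_gen)
  then show ?case
    using Cons f by (cases l) (auto simp: A.sinv_mult_comm)
qed (use g in auto)

section \<open>Products of order-preserving functions under restriction and reduction\<close>

context
  fixes g
  assumes g: "weight g"
begin

lemma
  assumes "p \<in> carrier T"
  shows g_idem [simp]: "g p \<in> idems A"
    and g_carrier [simp]: "g p \<in> carrier A"
    and g_mult_le: "x \<in> carrier T \<Longrightarrow> g (p \<odot> x) \<bullet> g p = g (p \<odot> x)"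
    and g_idem_le: "e \<in> idems T \<Longrightarrow> g (e \<odot> p) \<bullet> g p = g (e \<odot> p)"
  using g assms by (auto simp: weight_def)

text \<open>Each of \<open>p x\<^sup>-\<^sup>1\<close> and \<open>p x\<^sup>-\<^sup>1 x\<close> is a
  right multiple of the other, so their weights bound each other.\<close>

lemma g_mult_sinv:
  assumes "p \<in> carrier T" "x \<in> carrier T"
  shows "g (p \<odot> sinv T x \<odot> x) = g (p \<odot> sinv T x)"
proof -
  have "g (p \<odot> sinv T x) = g (p \<odot> sinv T x \<odot> x \<odot> sinv T x) \<bullet> g (p \<odot> sinv T x \<odot> x)"
    using assms g_mult_le[of "p \<odot> sinv T x \<odot> x" "sinv T x"] by (simp add: T.assoc)
  also have "\<dots> = g (p \<odot> sinv T x \<odot> x) \<bullet> g (p \<odot> sinv T x)"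
    using assms by (simp add: T.assoc A.commute)
  finally show ?thesis
    using assms g_mult_le[of "p \<odot> sinv T x" x] by simp
qed

lemma g_endpt: "p \<in> carrier T \<Longrightarrow> letters_in w (carrier T) \<Longrightarrow> g (fin p w) \<bullet> g p = g (fin p w)"
proof (induction w arbitrary: p)
  case (Cons l w)
  then have "g (fin (p \<odot> val l) w) \<bullet> g (p \<odot> val l) = g (fin (p \<odot> val l) w)"
    "g (p \<odot> val l) \<bullet> g p = g (p \<odot> val l)"
    by (auto intro: g_mult_le)
  then show ?case
    using Cons.prems A.assoc[of "g (fin (p \<odot> val l) w)" "g (p \<odot> val l)" "g p"] by simp
qed auto

lemma g_nat_le: "nat_le T p q \<Longrightarrow> q \<in> carrier T \<Longrightarrow> g p \<bullet> g q = g p"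
  by (auto simp: nat_le_def g_idem_le)

context
  fixes f
  assumes f: "weighted g f"
begin

lemma f_closed: "p \<in> carrier T \<Longrightarrow> x \<in> carrier T \<Longrightarrow> f p x \<in> carrier A"
  using f by (simp add: weighted_def)

lemma f_restrict:
  "p \<in> carrier T \<Longrightarrow> x \<in> carrier T \<Longrightarrow> e \<in> idems T \<Longrightarrow> f (e \<odot> p) x = g (e \<odot> p \<odot> x) \<bullet> f p x"
  using f by (simp add: weighted_def)

lemma step_closed: "p \<in> carrier T \<Longrightarrow> letter_base l \<in> carrier T \<Longrightarrow> stp f p l \<in> carrier A"
  by (cases l) (auto simp: f_closed)

lemma f_rng: "p \<in> carrier T \<Longrightarrow> x \<in> carrier T \<Longrightarrow> rng A (f p x) = g (p \<odot> x)"
  using f by (simp add: weighted_def)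

lemma step_rng:
  "p \<in> carrier T \<Longrightarrow> letter_base l \<in> carrier T \<Longrightarrow> rng A (stp f p l) = g (p \<odot> val l)"
  by (cases l) (auto simp: f_closed f_rng g_mult_sinv)

lemma step_restrict:
  assumes "p \<in> carrier T" "letter_base l \<in> carrier T" "e \<in> idems T"
  shows "stp f (e \<odot> p) l = g (e \<odot> p \<odot> val l) \<bullet> stp f p l"
proof (cases l)
  case (Pos x)
  then show ?thesis
    using assms by (simp add: f_restrict)
next
  case (Neg x)
  then show ?thesis
    using assms f_restrict[of "p \<odot> sinv T x" x e] g_mult_sinv[of "e \<odot> p" x]
    by (simp add: T.assoc f_closed A.sinv_mult_comm)
qed

text \<open>After going along \<open>x\<close>, the way back evaluates \<open>f\<close> at the
  smaller prefix \<open>p x x\<^sup>-\<^sup>1\<close>. The value there is still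
  \<open>f p x\<close>, because its restriction is to \<open>g (p x)\<close>, which is already the
  range of \<open>f p x\<close>.\<close>

lemma step_letter_inv:
  assumes "p \<in> carrier T" "letter_base l \<in> carrier T"
  shows "stp f p l \<bullet> stp f (p \<odot> val l) (letter_inv l) = g (p \<odot> val l)"
proof (cases l)
  case (Pos x)
  have "rng T (p \<odot> x) \<odot> p \<odot> x = p \<odot> x"
    using assms Pos by (simp add: T.assoc)
  then have "f (p \<odot> x \<odot> sinv T x) x = f p x"
    using assms Pos f_restrict[of p x "rng T (p \<odot> x)"] A.rng_mult_self[of "f p x"]
    by (simp add: T.mult_sinv_right_le f_closed f_rng)
  then show ?thesis
    using assms Pos f_rng[of p x] by (simp add: rng_def)
next
  case (Neg x)
  then show ?thesis
    using assms f_rng[of "p \<odot> sinv T x" x] by (simp add: rng_def g_mult_sinv A.commute f_closed)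
qed

lemma run_closed: "p \<in> carrier T \<Longrightarrow> letters_in w (carrier T) \<Longrightarrow> prd g f p w \<in> carrier A"
  by (rule run_closed_gen) (auto simp: f_closed)

lemma run_rng:
  "p \<in> carrier T \<Longrightarrow> letters_in w (carrier T) \<Longrightarrow> rng A (prd g f p w) = g (fin p w)"
proof (induction w arbitrary: p)
  case (Cons l w)
  then show ?case
    using g_endpt[of "p \<odot> val l" w]
    by (simp add: A.rng_mult_comm step_closed run_closed step_rng A.commute)
qed auto

text \<open>The weight of the endpoint is the identity of the component of the whole product, so
  larger idempotents are absorbed. This is the usual way to remove stray idempotents below.\<close>

lemma run_absorb:
  assumes "p \<in> carrier T" "letters_in w (carrier T)" "e \<in> idems A" "g (fin p w) \<bullet> e = g (fin p w)"
  shows "e \<bullet> prd g f p w = prd g f p w"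
  using assms by (intro A.rng_mult_absorb) (auto simp: run_closed run_rng)

lemma run_append:
  "p \<in> carrier T \<Longrightarrow> letters_in u (carrier T) \<Longrightarrow> letters_in v (carrier T) \<Longrightarrow>
    prd g f p (u @ v) = prd g f p u \<bullet> prd g f (fin p u) v"
proof (induction u arbitrary: p)
  case Nil
  then show ?case
    by (simp add: run_absorb g_endpt)
next
  case (Cons l u)
  then show ?case
    by (simp add: A.assoc step_closed run_closed)
qed

text \<open>Each step picks up the weight of an intermediate prefix; these weights dominate that of
  the final endpoint, which absorbs them.\<close>

lemma run_restrict:
  "p \<in> carrier T \<Longrightarrow> letters_in w (carrier T) \<Longrightarrow> e \<in> idems T \<Longrightarrow>
    prd g f (e \<odot> p) w = g (fin (e \<odot> p) w) \<bullet> prd g f p w"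
proof (induction w arbitrary: p)
  case Nil
  then show ?case
    by (simp add: g_idem_le)
next
  case (Cons l w)
  let ?p = "p \<odot> val l" and ?q = "e \<odot> (p \<odot> val l)"
  have c: "?p \<in> carrier T" "p \<in> carrier T" "e \<in> carrier T" "letters_in w (carrier T)"
    "letter_base l \<in> carrier T"
    using Cons.prems by auto
  have "prd g f (e \<odot> p) (l # w) = (g ?q \<bullet> stp f p l) \<bullet> (g (fin ?q w) \<bullet> prd g f ?p w)"
    using c Cons by (simp add: step_restrict T.assoc)
  also have "\<dots> = (g (fin ?q w) \<bullet> g ?q) \<bullet> (stp f p l \<bullet> prd g f ?p w)"
    using c by (simp add: A.ac step_closed run_closed)
  also have "g (fin ?q w) \<bullet> g ?q = g (fin ?q w)"
    using c by (intro g_endpt) auto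
  finally show ?case
    using c by (simp add: T.assoc)
qed

text \<open>A cancelled pair crosses one edge in both directions and leaves only an idempotent. The
  rest of the walk starts at the restricted prefix \<open>rng (p x) p\<close>, and
  \<open>run_restrict\<close> compares it with the walk from \<open>p\<close>.\<close>

lemma run_red_cons:
  assumes "p \<in> carrier T" "letters_in (l # w) (carrier T)"
  shows "prd g f p (l # w) = g (fin p (l # w)) \<bullet> prd g f p (red_cons l w)"
proof (cases "\<exists>v. w = letter_inv l # v")
  case True
  then obtain v where w: "w = letter_inv l # v"
    by blast
  define e where "e = rng T (p \<odot> val l)"
  have c: "val l \<in> carrier T" "e \<in> idems T" "letters_in v (carrier T)"
    using assms w by (auto simp: e_def)
  have pe: "p \<odot> val l \<odot> sinv T (val l) = e \<odot> p"
    using assms c by (simp add: e_def T.mult_sinv_right_le)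
  have "prd g f p (l # w)
      = (stp f p l \<bullet> stp f (p \<odot> val l) (letter_inv l)) \<bullet> prd g f (e \<odot> p) v"
    using assms w c pe by (simp add: A.assoc step_closed run_closed)
  also have "stp f p l \<bullet> stp f (p \<odot> val l) (letter_inv l) = g (p \<odot> val l)"
    using assms by (intro step_letter_inv) auto
  also have "g (p \<odot> val l) \<bullet> prd g f (e \<odot> p) v = prd g f (e \<odot> p) v"
  proof (rule run_absorb)
    have "g (fin (p \<odot> val l) w) \<bullet> g (p \<odot> val l) = g (fin (p \<odot> val l) w)"
      using assms c w by (intro g_endpt) auto
    then show "g (fin (e \<odot> p) v) \<bullet> g (p \<odot> val l) = g (fin (e \<odot> p) v)"
      using w pe assms by simp
  qed (use assms c in auto)
  also have "\<dots> = g (fin (e \<odot> p) v) \<bullet> prd g f p v"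
    using assms c by (intro run_restrict) auto
  finally show ?thesis
    using w pe assms by simp
next
  case False
  then have "red_cons l w = l # w"
    by (cases w) auto
  moreover have "g (fin p (l # w)) \<bullet> prd g f p (l # w) = prd g f p (l # w)"
    using assms by (intro run_absorb) auto
  ultimately show ?thesis
    by simp
qed

lemma run_reduce:
  "p \<in> carrier T \<Longrightarrow> letters_in w (carrier T) \<Longrightarrow>
    prd g f p w = g (fin p w) \<bullet> prd g f p (reduce w)"
proof (induction w arbitrary: p)
  case (Cons l w)
  let ?p = "p \<odot> val l"
  have red: "reduce (l # w) = red_cons l (reduce w)"
    by (simp add: reduce_def)
  have c: "letter_base l \<in> carrier T" "letters_in w (carrier T)" "p \<in> carrier T"
    "letters_in (reduce w) (carrier T)" "letters_in (reduce (l # w)) (carrier T)"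
    using Cons.prems letters_in_reduce[of "l # w"] by auto
  have "prd g f p (l # w) = stp f p l \<bullet> (g (fin ?p w) \<bullet> prd g f ?p (reduce w))"
    using Cons c by simp
  also have "\<dots> = g (fin ?p w) \<bullet> prd g f p (l # reduce w)"
    using c by (simp add: A.ac step_closed run_closed)
  also have "prd g f p (l # reduce w)
      = g (fin ?p (reduce w)) \<bullet> prd g f p (reduce (l # w))"
    using c by (subst run_red_cons) (auto simp: red)
  also have "g (fin ?p w) \<bullet> (g (fin ?p (reduce w)) \<bullet> prd g f p (reduce (l # w)))
      = (g (fin ?p w) \<bullet> g (fin ?p (reduce w))) \<bullet> prd g f p (reduce (l # w))"
    using c by (simp add: A.assoc run_closed)
  also have "g (fin ?p w) \<bullet> g (fin ?p (reduce w)) = g (fin ?p w)"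
    using c T.endpt_reduce[of ?p w] by (intro g_nat_le) auto
  finally show ?case
    by simp
qed (simp add: reduce_def)

text \<open>If reduction does not move the endpoint, the correcting idempotent of
  \<open>run_reduce\<close> is the identity of the component and disappears. Closed walks are the
  main case.\<close>

lemma run_eq_reduce:
  assumes "p \<in> carrier T" "letters_in w (carrier T)" "fin p w = fin p (reduce w)"
  shows "prd g f p (reduce w) = prd g f p w"
  using run_reduce[OF assms(1,2)] run_absorb[of p "reduce w" "g (fin p (reduce w))"] assms
    by simp

text \<open>The contributions of \<open>v\<close> and of its inverse cancel, because both cross the same edges.\<close>

lemma run_conj:
  assumes p: "p \<in> carrier T" and v: "letters_in v (carrier T)" "reduced v"
    and w: "letters_in w (carrier T)" and loop: "fin (fin p v) w = fin p v"
    and ret: "rng T (fin p v) \<odot> p = p"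
  shows "prd g f p (v @ w @ winv v) = prd g f (fin p v) w"
proof -
  have fb: "fin (fin p v) (winv v) = p"
    using p v ret by (simp add: T.endpt_winv)
  have "prd g f p v \<bullet> prd g f (fin p v) (winv v) = prd g f p (v @ winv v)"
    using p v by (simp add: run_append)
  also have "\<dots> = g p"
    using p v run_reduce[of p "v @ winv v"] by (simp add: reduce_append_winv fb)
  finally have cancel: "prd g f p v \<bullet> prd g f (fin p v) (winv v) = g p" .
  have "prd g f p (v @ w @ winv v)
      = (prd g f p v \<bullet> prd g f (fin p v) (winv v)) \<bullet> prd g f (fin p v) w"
    using p v w by (simp add: run_append loop run_closed A.ac)
  also have "\<dots> = g p \<bullet> prd g f (fin p v) w"
    by (simp add: cancel)
  also have "\<dots> = prd g f (fin p v) w"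
    using p v w by (intro run_absorb) (auto simp: loop g_endpt)
  finally show ?thesis .
qed

end

text \<open>The factors are the increments of the potential \<open>k\<close> along the edges, so
  only the two ends survive; on a closed walk at \<open>p\<close> just \<open>g p\<close> is
  left.\<close>

lemma run_telescope:
  assumes k: "\<And>p. p \<in> carrier T \<Longrightarrow> k p \<in> carrier A"
      "\<And>p. p \<in> carrier T \<Longrightarrow> rng A (k p) = g p"
      "\<And>e p. e \<in> idems T \<Longrightarrow> p \<in> carrier T \<Longrightarrow> k (e \<odot> p) = g (e \<odot> p) \<bullet> k p"
    and "p \<in> carrier T" "letters_in w (carrier T)"
  shows "prd g (\<lambda>p x. k (p \<odot> x) \<bullet> sinv A (k p)) p w = k (fin p w) \<bullet> sinv A (k p)"
  using assms(4,5)
proof (induction w arbitrary: p)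
  case Nil
  then show ?case
    using k by (simp add: rng_def)
next
  case (Cons l w)
  let ?q = "p \<odot> val l"
  let ?F = "\<lambda>p x. k (p \<odot> x) \<bullet> sinv A (k p)"
  have c: "p \<in> carrier T" "?q \<in> carrier T" "letters_in w (carrier T)"
    "k p \<in> carrier A" "k ?q \<in> carrier A" "k (fin ?q w) \<in> carrier A"
    using Cons.prems k by auto
  have step: "stp ?F p l = k ?q \<bullet> sinv A (k p)"
  proof (cases l)
    case (Neg x)
    have x: "x \<in> carrier T"
      using Cons.prems Neg by simp
    \<comment> \<open>The reversed edge ends at \<open>p x\<^sup>-\<^sup>1 x\<close>, a restriction
      of \<open>p\<close>, and not at \<open>p\<close>; the extra factor \<open>g ?q\<close> is
      absorbed by \<open>k ?q\<close>.\<close>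
    have "k (?q \<odot> x) = g ?q \<bullet> k p"
      using k(3)[of "rng T ?q" p] c x Neg T.mult_sinv_right_le[of p "sinv T x"] g_mult_sinv[of p x]
      by simp
    then have "stp ?F p l = (k ?q \<bullet> g ?q) \<bullet> sinv A (k p)"
      using c x Neg by (simp add: A.sinv_mult_comm A.ac)
    also have "k ?q \<bullet> g ?q = k ?q"
      using k(2)[OF c(2)] c A.rng_mult_self[of "k ?q"] by (simp add: A.commute)
    finally show ?thesis .
  qed simp
  have "prd g ?F p (l # w) = rng A (k ?q) \<bullet> k (fin ?q w) \<bullet> sinv A (k p)"
    using c Cons.IH[of ?q] by (simp add: step rng_def A.ac)
  also have "rng A (k ?q) \<bullet> k (fin ?q w) = k (fin ?q w)"
    using c k(2) g_endpt[of ?q w] by (intro A.rng_mult_absorb) auto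
  finally show ?case
    by simp
qed

end

end

section \<open>Order-preserving cochains\<close>

lemma tuples_2 [simp]: "[x, y] \<in> tuples T 2 \<longleftrightarrow> x \<in> carrier T \<and> y \<in> carrier T"
  and tuples_3 [simp]: "[x, y, z] \<in> tuples T 3 \<longleftrightarrow> x \<in> carrier T \<and> y \<in> carrier T \<and> z \<in> carrier T"
  and tuples_4 [simp]: "[x, y, z, w] \<in> tuples T 4 \<longleftrightarrow>
    x \<in> carrier T \<and> y \<in> carrier T \<and> z \<in> carrier T \<and> w \<in> carrier T"
  by (auto simp: tuples_def)

lemma tuples_2E:
  assumes "xs \<in> tuples T 2"
  obtains x y where "xs = [x, y]" "x \<in> carrier T" "y \<in> carrier T"
  using assms by (auto simp: tuples_def numeral_2_eq_2 length_Suc_conv)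

lemma tuples_3E:
  assumes "xs \<in> tuples T 3"
  obtains x y z where "xs = [x, y, z]" "x \<in> carrier T" "y \<in> carrier T" "z \<in> carrier T"
  using assms by (auto simp: tuples_def numeral_3_eq_3 length_Suc_conv)

lemma tuples_4E:
  assumes "xs \<in> tuples T 4"
  obtains x y z w where "xs = [x, y, z, w]" "x \<in> carrier T" "y \<in> carrier T" "z \<in> carrier T"
    "w \<in> carrier T"
  using assms by (auto simp: tuples_def numeral_eq_Suc length_Suc_conv)

context comm_inv_semigroup
begin

lemma nat_leD': "nat_le A a b \<Longrightarrow> b \<in> carrier A \<Longrightarrow> rng A a = e \<Longrightarrow> a = e \<cdot> b"
  using nat_leD by blast

text \<open>This solves the alternating cocycle identity for two of its factors. Only
  \<open>g\<close> may lie in a larger component than \<open>e\<close>: it stands for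
  \<open>c(x, y, z)\<close>, whose arguments omit the last entry \<open>w\<close>.\<close>

lemma cocycle_rearrange:
  assumes "a \<in> carrier A" "b \<in> carrier A" "d \<in> carrier A" "f \<in> carrier A" "g \<in> carrier A"
    and e: "a \<cdot> (sinv A b \<cdot> (d \<cdot> (sinv A f \<cdot> g))) = e"
    and r: "rng A a = e" "rng A b = e" "rng A f = e" "e \<cdot> rng A g = e"
  shows "a \<cdot> d = b \<cdot> (f \<cdot> sinv A g)"
proof -
  have c: "e \<in> idems A" "e \<in> carrier A" and ea: "e \<cdot> a = a" and eb: "e \<cdot> b = b"
    using r assms rng_mult_self[of a] rng_mult_self[of b] rng_idem[of a] by auto
  \<comment> \<open>Expanding \<open>e\<close> into ranges inserts each of \<open>b\<close>,
    \<open>f\<close>, \<open>g\<close> together with its inverse, which makes the left side of the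
    identity \<open>e\<close> appear as a factor.\<close>
  have "e = e \<cdot> rng A g \<cdot> rng A f \<cdot> rng A b"
    using r c by simp
  then have "a \<cdot> d = (e \<cdot> rng A g \<cdot> rng A f \<cdot> rng A b) \<cdot> (a \<cdot> d)"
    using assms(1,3) c ea assoc[of e a d] by simp
  also have "\<dots> = e \<cdot> (a \<cdot> (sinv A b \<cdot> (d \<cdot> (sinv A f \<cdot> g)))) \<cdot> (b \<cdot> (f \<cdot> sinv A g))"
    using assms(1-5) c by (simp add: rng_def ac)
  also have "\<dots> = e \<cdot> b \<cdot> (f \<cdot> sinv A g)"
    unfolding e using assms(1-5) c by (simp add: assoc)
  finally show ?thesis
    by (simp add: eb)
qed

text \<open>The formal part of \<open>\<delta> \<delta> = 1\<close>: each of the ten values occurs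
  exactly once with its inverse, so only its range remains.\<close>

lemma coboundary_cancel:
  assumes "a1 \<in> carrier A" "a2 \<in> carrier A" "a3 \<in> carrier A" "a4 \<in> carrier A" "b1 \<in> carrier A"
    "b2 \<in> carrier A" "b3 \<in> carrier A" "b4 \<in> carrier A" "b5 \<in> carrier A" "b6 \<in> carrier A"
  shows "(a1 \<cdot> (sinv A a2 \<cdot> (a3 \<cdot> sinv A a4))) \<cdot>
      (sinv A (a1 \<cdot> (sinv A b1 \<cdot> (b2 \<cdot> sinv A b3))) \<cdot>
       ((a2 \<cdot> (sinv A b1 \<cdot> (b4 \<cdot> sinv A b5))) \<cdot>
        (sinv A (a3 \<cdot> (sinv A b2 \<cdot> (b4 \<cdot> sinv A b6))) \<cdot>
         (a4 \<cdot> (sinv A b3 \<cdot> (b5 \<cdot> sinv A b6))))))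
    = rng A a1 \<cdot> (rng A a2 \<cdot> (rng A a3 \<cdot> (rng A a4 \<cdot> (rng A b1 \<cdot> (rng A b2 \<cdot>
       (rng A b3 \<cdot> (rng A b4 \<cdot> (rng A b5 \<cdot> rng A b6))))))))"
  using assms by (simp add: rng_def sinv_mult_comm ac)

end

section \<open>Coboundaries of order-preserving cochains and cohomology classes\<close>

context inv_module
begin

lemma ord_cochains_iff:
  "f \<in> ord_cochains T A \<theta> n \<longleftrightarrow> f \<in> extensional (tuples T n) \<and>
    (\<forall>xs\<in>tuples T n. f xs \<in> carrier A \<and> rng A (f xs) = \<rho> (sprod T xs)) \<and>
    (\<forall>xs\<in>tuples T n. \<forall>ys\<in>tuples T n. list_all2 (nat_le T) xs ys \<longrightarrow> nat_le A (f xs) (f ys))"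
  by (auto simp: ord_cochains_def cochain_group_def A.component_iff)

lemma ord_cochains_mult:
  assumes "f \<in> ord_cochains T A \<theta> n" "g \<in> ord_cochains T A \<theta> n"
  shows "(\<lambda>xs\<in>tuples T n. f xs \<bullet> g xs) \<in> ord_cochains T A \<theta> n"
proof -
  have "rng A (f xs \<bullet> g xs) = \<rho> (sprod T xs)" if "xs \<in> tuples T n" for xs
  proof -
    have "f xs \<in> carrier A" "g xs \<in> carrier A" "rng A (f xs) = \<rho> (sprod T xs)"
      "rng A (g xs) = \<rho> (sprod T xs)"
      using assms that by (auto simp: ord_cochains_iff)
    then show ?thesis
      using A.rng_idem[of "f xs"] by (simp add: A.rng_mult_comm)
  qed
  then show ?thesis
    using assms by (auto simp: ord_cochains_iff intro: A.nat_le_mult)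
qed

lemma ord_cochains_sinv:
  assumes "f \<in> ord_cochains T A \<theta> n"
  shows "(\<lambda>xs\<in>tuples T n. sinv A (f xs)) \<in> ord_cochains T A \<theta> n"
  using assms by (auto simp: ord_cochains_iff intro: A.nat_le_sinv)

lemma nat_le_\<rho>: "nat_le T x y \<Longrightarrow> y \<in> carrier T \<Longrightarrow> nat_le A (\<rho> x) (\<rho> y)"
  using A.nat_leI by (auto simp: nat_le_def[of T] \<rho>_idem_mult)

lemma \<eta>_nat_le:
  assumes "nat_le T x y" "y \<in> carrier T" "nat_le A a b" "b \<in> carrier A"
  shows "nat_le A (\<eta> x a) (\<eta> y b)"
proof -
  obtain e where e: "e \<in> idems T" "x = e \<odot> y"
    using assms(1) by (auto simp: nat_le_def)
  obtain u where u: "u \<in> idems A" "a = u \<bullet> b"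
    using assms(3) by (auto simp: nat_le_def)
  have "\<eta> y u \<in> idems A"
    by (rule shom_idems[OF \<eta>_shom]) (use assms u in auto)
  moreover have "\<eta> x a = (\<theta> e \<bullet> \<eta> y u) \<bullet> \<eta> y b"
    using assms e u by (simp add: \<eta>_comp \<eta>_idem \<eta>_mult A.ac)
  ultimately show ?thesis
    using e A.nat_leI A.idem_mult_idem by simp
qed

lemma one_ord_cochain: "(\<lambda>xs\<in>tuples T 2. \<rho> (sprod T xs)) \<in> ord_cochains T A \<theta> 2"
  unfolding ord_cochains_iff
proof (intro conjI ballI impI)
  fix xs ys assume "xs \<in> tuples T 2" "ys \<in> tuples T 2" "list_all2 (nat_le T) xs ys"
  then show "nat_le A ((\<lambda>xs\<in>tuples T 2. \<rho> (sprod T xs)) xs) ((\<lambda>xs\<in>tuples T 2. \<rho> (sprod T xs)) ys)"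
    by (elim tuples_2E) (auto intro!: nat_le_\<rho> T.nat_le_mult)
qed (auto elim: tuples_2E)

lemma cochain_2:
  assumes "h \<in> ord_cochains T A \<theta> 2" "x \<in> carrier T" "y \<in> carrier T"
  shows "h [x, y] \<in> carrier A" "rng A (h [x, y]) = \<rho> (x \<odot> y)"
  using assms by (simp_all add: ord_cochains_iff)

lemma cochain_2_mono:
  assumes "h \<in> ord_cochains T A \<theta> 2" "nat_le T x x'" "nat_le T y y'"
    "x' \<in> carrier T" "y' \<in> carrier T"
  shows "nat_le A (h [x, y]) (h [x', y'])"
  using assms T.nat_le_carrier by (simp add: ord_cochains_iff)

lemma cochain_3:
  assumes "c \<in> ord_cochains T A \<theta> 3" "x \<in> carrier T" "y \<in> carrier T" "z \<in> carrier T"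
  shows "c [x, y, z] \<in> carrier A" "rng A (c [x, y, z]) = \<rho> (x \<odot> (y \<odot> z))"
  using assms by (simp_all add: ord_cochains_iff)

lemma cochain_3_mono:
  assumes "c \<in> ord_cochains T A \<theta> 3" "nat_le T x x'" "nat_le T y y'" "nat_le T z z'"
    "x' \<in> carrier T" "y' \<in> carrier T" "z' \<in> carrier T"
  shows "nat_le A (c [x, y, z]) (c [x', y', z'])"
  using assms T.nat_le_carrier by (simp add: ord_cochains_iff)

text \<open>The two values are comparable by order preservation and have the same range, because the
  range depends on the product of the arguments alone. It allows idempotents to be moved between
  neighbouring arguments.\<close>

lemma cochain_3_eq:
  assumes "c \<in> ord_cochains T A \<theta> 3" "nat_le T x x'" "nat_le T y y'" "nat_le T z z'"
    "x' \<in> carrier T" "y' \<in> carrier T" "z' \<in> carrier T"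
    and "x \<odot> (y \<odot> z) = x' \<odot> (y' \<odot> z')"
  shows "c [x, y, z] = c [x', y', z']"
proof (rule A.nat_le_eq_rng[OF cochain_3_mono[OF assms(1-7)]])
  have "x \<in> carrier T" "y \<in> carrier T" "z \<in> carrier T"
    using T.nat_le_carrier assms by blast+
  then show "rng A (c [x, y, z]) = rng A (c [x', y', z'])"
    using cochain_3(2)[OF assms(1)] assms by simp
qed (use cochain_3[OF assms(1)] assms in simp)

abbreviation (input) "\<delta> \<equiv> coboundary T A \<eta>"

lemma coboundary_2:
  assumes "x \<in> carrier T" "y \<in> carrier T" "z \<in> carrier T"
  shows "\<delta> 2 h [x, y, z]
    = \<eta> x (h [y, z]) \<bullet> (sinv A (h [x \<odot> y, z]) \<bullet> (h [x, y \<odot> z] \<bullet> sinv A (h [x, y])))"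
  using assms
  by (simp add: coboundary_def merge_at_def upt_rec numeral_eq_Suc tuples_def, simp add: sgn_pow_def)

lemma coboundary_3:
  assumes "x \<in> carrier T" "y \<in> carrier T" "z \<in> carrier T" "w \<in> carrier T"
  shows "\<delta> 3 c [x, y, z, w] = \<eta> x (c [y, z, w]) \<bullet> (sinv A (c [x \<odot> y, z, w]) \<bullet>
    (c [x, y \<odot> z, w] \<bullet> (sinv A (c [x, y, z \<odot> w]) \<bullet> c [x, y, z])))"
  using assms
  by (simp add: coboundary_def merge_at_def upt_rec numeral_eq_Suc tuples_def, simp add: sgn_pow_def)

lemma coboundary_extensional [simp]: "\<delta> 2 h \<in> extensional (tuples T 3)" "\<delta> 3 c \<in> extensional (tuples T 4)"
  by (simp_all add: coboundary_def)

lemma \<rho>_le3 [simp]: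
  "x \<in> carrier T \<Longrightarrow> y \<in> carrier T \<Longrightarrow> z \<in> carrier T \<Longrightarrow>
    \<rho> (x \<odot> (y \<odot> z)) \<bullet> \<rho> (x \<odot> y) = \<rho> (x \<odot> (y \<odot> z))"
  using \<rho>_le[of "x \<odot> y" z] by (simp add: T.assoc)

lemma \<rho>_le4 [simp]:
  "x \<in> carrier T \<Longrightarrow> y \<in> carrier T \<Longrightarrow> z \<in> carrier T \<Longrightarrow> w \<in> carrier T \<Longrightarrow>
    \<rho> (x \<odot> (y \<odot> (z \<odot> w))) \<bullet> \<rho> (x \<odot> (y \<odot> z)) = \<rho> (x \<odot> (y \<odot> (z \<odot> w)))"
  using \<rho>_le3[of "x \<odot> y" z w] by (simp add: T.assoc)

lemma coboundary_2_closed: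
  assumes h: "h \<in> ord_cochains T A \<theta> 2"
  shows "\<delta> 2 h \<in> ord_cochains T A \<theta> 3"
  unfolding ord_cochains_iff
proof (intro conjI ballI impI)
  note [simp] = cochain_2[OF h]
  fix xs assume "xs \<in> tuples T 3"
  then obtain x y z where xs: "xs = [x, y, z]" "x \<in> carrier T" "y \<in> carrier T" "z \<in> carrier T"
    by (rule tuples_3E)
  then show "\<delta> 2 h xs \<in> carrier A"
    by (simp add: coboundary_2)
  show "rng A (\<delta> 2 h xs) = \<rho> (sprod T xs)"
    using xs by (simp add: coboundary_2 A.rng_mult_comm \<eta>_rng \<eta>_\<rho> T.assoc)
  fix ys assume "ys \<in> tuples T 3"
  then obtain x' y' z' where ys: "ys = [x', y', z']" "x' \<in> carrier T" "y' \<in> carrier T" "z' \<in> carrier T"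
    by (rule tuples_3E)
  assume "list_all2 (nat_le T) xs ys"
  then show "nat_le A (\<delta> 2 h xs) (\<delta> 2 h ys)"
    using xs ys
    by (auto simp: coboundary_2 intro!: A.nat_le_mult A.nat_le_sinv \<eta>_nat_le cochain_2_mono[OF h]
        T.nat_le_mult)
qed simp

lemma coboundary_coboundary:
  assumes h: "h \<in> ord_cochains T A \<theta> 2" and xs: "xs \<in> tuples T 4"
  shows "\<delta> 3 (\<delta> 2 h) xs = \<rho> (sprod T xs)"
proof -
  note [simp] = cochain_2[OF h]
  obtain x y z w where xs: "xs = [x, y, z, w]" "x \<in> carrier T" "y \<in> carrier T" "z \<in> carrier T"
    "w \<in> carrier T"
    using xs by (rule tuples_4E)
  have "\<delta> 3 (\<delta> 2 h) xs = rng A (\<eta> (x \<odot> y) (h [z, w])) \<bullet> (rng A (\<eta> x (h [y \<odot> z, w])) \<bullet>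
      (rng A (\<eta> x (h [y, z \<odot> w])) \<bullet> (rng A (\<eta> x (h [y, z])) \<bullet> (rng A (h [x \<odot> (y \<odot> z), w]) \<bullet>
      (rng A (h [x \<odot> y, z \<odot> w]) \<bullet> (rng A (h [x \<odot> y, z]) \<bullet> (rng A (h [x, y \<odot> (z \<odot> w)]) \<bullet>
      (rng A (h [x, y \<odot> z]) \<bullet> rng A (h [x, y])))))))))"
    using xs by (subst A.coboundary_cancel[symmetric])
      (auto simp: coboundary_3 coboundary_2 \<eta>_mult \<eta>_sinv \<eta>_comp T.assoc)
  also have "\<dots> = \<rho> (sprod T xs)"
  proof -
    have absorb: "\<rho> (x \<odot> (y \<odot> (z \<odot> w))) \<bullet> \<rho> (x \<odot> y) = \<rho> (x \<odot> (y \<odot> (z \<odot> w)))"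
      using xs \<rho>_le3[of x y "z \<odot> w"] by simp
    have "\<rho> (x \<odot> (y \<odot> (z \<odot> w))) \<bullet> (\<rho> (x \<odot> (y \<odot> z)) \<bullet> \<rho> (x \<odot> y)) = \<rho> (x \<odot> (y \<odot> (z \<odot> w)))"
      using xs by simp
    then show ?thesis
      using xs \<rho>_le4[of x y z w]
      by (simp add: \<eta>_rng \<eta>_\<rho> T.assoc A.ac absorb del: \<rho>_le4)
  qed
  finally show ?thesis .
qed

lemma coboundary_2_mult:
  assumes h: "h \<in> ord_cochains T A \<theta> 2" and k: "k \<in> ord_cochains T A \<theta> 2" and xs: "xs \<in> tuples T 3"
  shows "\<delta> 2 (\<lambda>xs\<in>tuples T 2. h xs \<bullet> k xs) xs = \<delta> 2 h xs \<bullet> \<delta> 2 k xs"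
  using xs cochain_2[OF h] cochain_2[OF k]
  by (elim tuples_3E) (simp add: coboundary_2 \<eta>_mult A.sinv_mult_comm A.ac)

lemma coboundary_2_sinv:
  assumes h: "h \<in> ord_cochains T A \<theta> 2" and xs: "xs \<in> tuples T 3"
  shows "\<delta> 2 (\<lambda>xs\<in>tuples T 2. sinv A (h xs)) xs = sinv A (\<delta> 2 h xs)"
  using xs cochain_2[OF h]
  by (elim tuples_3E) (simp add: coboundary_2 \<eta>_sinv A.sinv_mult_comm A.ac)

lemma coboundary_3_mult:
  assumes h: "c \<in> ord_cochains T A \<theta> 3" and k: "d \<in> ord_cochains T A \<theta> 3" and xs: "xs \<in> tuples T 4"
  shows "\<delta> 3 (\<lambda>xs\<in>tuples T 3. c xs \<bullet> d xs) xs = \<delta> 3 c xs \<bullet> \<delta> 3 d xs"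
  using xs cochain_3[OF h] cochain_3[OF k]
  by (elim tuples_4E) (simp add: coboundary_3 \<eta>_mult A.sinv_mult_comm A.ac)

lemma ord_cocycles_iff:
  "c \<in> ord_cocycles T A \<theta> \<eta> \<longleftrightarrow>
    c \<in> ord_cochains T A \<theta> 3 \<and> (\<forall>xs\<in>tuples T 4. \<delta> 3 c xs = \<rho> (sprod T xs))"
proof -
  have "\<delta> 3 c = (\<lambda>xs\<in>tuples T 4. \<rho> (sprod T xs)) \<longleftrightarrow> (\<forall>xs\<in>tuples T 4. \<delta> 3 c xs = \<rho> (sprod T xs))"
    using coboundary_extensional(2)[of c] by (auto simp: fun_eq_iff extensional_def)
  then show ?thesis
    by (auto simp: ord_cocycles_def kernel_def cochain_group_def ord_cochains_def)
qed

lemma ord_cocycles_translate: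
  assumes c: "c \<in> ord_cocycles T A \<theta> \<eta>" and h: "h \<in> ord_cochains T A \<theta> 2"
  shows "(\<lambda>xs\<in>tuples T 3. \<delta> 2 h xs \<bullet> c xs) \<in> ord_cocycles T A \<theta> \<eta>"
proof -
  have c': "c \<in> ord_cochains T A \<theta> 3"
    using c by (simp add: ord_cocycles_iff)
  show ?thesis
    unfolding ord_cocycles_iff
  proof (intro conjI ballI)
    fix xs assume xs: "xs \<in> tuples T 4"
    then have "\<delta> 3 (\<lambda>xs\<in>tuples T 3. \<delta> 2 h xs \<bullet> c xs) xs = \<rho> (sprod T xs) \<bullet> \<rho> (sprod T xs)"
      using c by (simp add: coboundary_3_mult[OF coboundary_2_closed[OF h] c']
          coboundary_coboundary[OF h] ord_cocycles_iff)
    then show "\<delta> 3 (\<lambda>xs\<in>tuples T 3. \<delta> 2 h xs \<bullet> c xs) xs = \<rho> (sprod T xs)"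
      using xs by (elim tuples_4E) simp
  qed (rule ord_cochains_mult[OF coboundary_2_closed[OF h] c'])
qed

lemma cohomology_class_iff:
  "c' \<in> cohomology_class T A \<theta> \<eta> c \<longleftrightarrow>
    (\<exists>h\<in>ord_cochains T A \<theta> 2. c' = (\<lambda>xs\<in>tuples T 3. \<delta> 2 h xs \<bullet> c xs))"
  by (auto simp: cohomology_class_def r_coset_def ord_coboundaries_def ord_cocycle_group_def
      cochain_group_def)

lemma cohomology_class_refl:
  assumes c: "c \<in> ord_cocycles T A \<theta> \<eta>"
  shows "c \<in> cohomology_class T A \<theta> \<eta> c"
  unfolding cohomology_class_iff
proof (rule bexI[OF _ one_ord_cochain])
  have c': "c \<in> ord_cochains T A \<theta> 3"
    using c by (simp add: ord_cocycles_iff)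
  show "c = (\<lambda>xs\<in>tuples T 3. \<delta> 2 (\<lambda>xs\<in>tuples T 2. \<rho> (sprod T xs)) xs \<bullet> c xs)"
  proof (rule extensionalityI[where A = "tuples T 3"])
    fix xs assume "xs \<in> tuples T 3"
    then show "c xs = (\<lambda>xs\<in>tuples T 3. \<delta> 2 (\<lambda>xs\<in>tuples T 2. \<rho> (sprod T xs)) xs \<bullet> c xs) xs"
    proof (rule tuples_3E)
      fix x y z assume *: "xs = [x, y, z]" "x \<in> carrier T" "y \<in> carrier T" "z \<in> carrier T"
      have "\<rho> (x \<odot> (y \<odot> z)) \<bullet> c xs = c xs"
        using * A.rng_mult_self[of "c xs"] cochain_3[OF c'] by simp
      then show ?thesis
        using * by (simp add: coboundary_2 \<eta>_\<rho> T.assoc)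
    qed
  qed (use c' in \<open>auto simp: ord_cochains_iff\<close>)
qed

text \<open>If \<open>c'\<close> is the translate of \<open>c\<close> by \<open>h\<close>, then
  translating \<open>c'\<close> by \<open>k\<close> is translating \<open>c\<close> by
  \<open>k h\<close>, and translating \<open>c\<close> by \<open>k\<close> is translating
  \<open>c'\<close> by \<open>k h\<^sup>-\<^sup>1\<close>.\<close>

lemma cohomology_class_eq:
  assumes c: "c \<in> ord_cocycles T A \<theta> \<eta>" and c': "c' \<in> cohomology_class T A \<theta> \<eta> c"
  shows "cohomology_class T A \<theta> \<eta> c' = cohomology_class T A \<theta> \<eta> c"
proof -
  obtain h where h: "h \<in> ord_cochains T A \<theta> 2" "c' = (\<lambda>xs\<in>tuples T 3. \<delta> 2 h xs \<bullet> c xs)"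
    using c' by (auto simp: cohomology_class_iff)
  have [simp]: "xs \<in> tuples T 3 \<Longrightarrow> c xs \<in> carrier A"
    "k \<in> ord_cochains T A \<theta> 2 \<Longrightarrow> xs \<in> tuples T 3 \<Longrightarrow> \<delta> 2 k xs \<in> carrier A" for xs k
    using c coboundary_2_closed[of k] by (auto simp: ord_cocycles_iff ord_cochains_iff)
  let ?t = "\<lambda>k c. \<lambda>xs\<in>tuples T 3. \<delta> 2 k xs \<bullet> c xs"
  have sub: "\<exists>k'\<in>ord_cochains T A \<theta> 2. ?t k c' = ?t k' c" if "k \<in> ord_cochains T A \<theta> 2" for k
    using h that
    by (intro bexI[OF _ ord_cochains_mult[OF that h(1)]])
      (auto simp: coboundary_2_mult A.assoc intro!: restrict_ext)
  have sup: "\<exists>k'\<in>ord_cochains T A \<theta> 2. ?t k c = ?t k' c'" if k: "k \<in> ord_cochains T A \<theta> 2" for k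
  proof (rule bexI[OF _ ord_cochains_mult[OF k ord_cochains_sinv[OF h(1)]]], rule restrict_ext)
    fix xs assume xs: "xs \<in> tuples T 3"
    have "rng A (\<delta> 2 h xs) = \<rho> (sprod T xs)" "rng A (c xs) = \<rho> (sprod T xs)"
      using h(1) c xs coboundary_2_closed[of h] by (auto simp: ord_cocycles_iff ord_cochains_iff)
    then have "rng A (\<delta> 2 h xs) \<bullet> c xs = c xs"
      using xs A.rng_mult_self[of "c xs"] by simp
    then show "\<delta> 2 k xs \<bullet> c xs
      = \<delta> 2 (\<lambda>xs\<in>tuples T 2. k xs \<bullet> (\<lambda>xs\<in>tuples T 2. sinv A (h xs)) xs) xs \<bullet> c' xs"
      using xs h k coboundary_2_mult[OF k ord_cochains_sinv[OF h(1)] xs] coboundary_2_sinv[OF h(1) xs]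
      by (simp add: rng_def A.ac)
  qed
  show ?thesis
    using sub sup by (auto simp: set_eq_iff cohomology_class_iff h(2)[symmetric])
qed

lemma ord_cohomology_carrier:
  "carrier (ord_cohomology T A \<theta> \<eta>) = cohomology_class T A \<theta> \<eta> ` ord_cocycles T A \<theta> \<eta>"
  by (auto simp: ord_cohomology_def FactGroup_def RCOSETS_def cohomology_class_def ord_cocycle_group_def)

end

context comm_inv_semigroup
begin

lemma square_eq_rng:
  assumes "a \<in> carrier A" "a \<cdot> a = a"
  shows "a = rng A a"
  using assms by (simp add: idemsI)

text \<open>At degenerate arguments the cocycle identity takes the form \<open>a a = a e\<close>
  with \<open>e\<close> above the range of \<open>a\<close>; then \<open>a\<close> is idempotent and
  hence trivial in its component.\<close>

lemma eq_rng_of_mult_eq: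
  assumes "a \<in> carrier A" "e \<in> idems A" "a \<cdot> a = a \<cdot> e" "rng A a \<cdot> e = rng A a"
  shows "a = rng A a"
  using assms rng_mult_absorb[of a e] commute[of a e] by (intro square_eq_rng) auto

end

context inv_module
begin

lemma cocycle_eq:
  assumes c: "c \<in> ord_cocycles T A \<theta> \<eta>"
    and x: "x \<in> carrier T" and y: "y \<in> carrier T" and z: "z \<in> carrier T" and w: "w \<in> carrier T"
  shows "\<eta> x (c [y, z, w]) \<bullet> c [x, y \<odot> z, w]
    = c [x \<odot> y, z, w] \<bullet> (c [x, y, z \<odot> w] \<bullet> sinv A (c [x, y, z]))"
proof (rule A.cocycle_rearrange)
  have c': "c \<in> ord_cochains T A \<theta> 3"
    using c by (simp add: ord_cocycles_iff)
  note [simp] = cochain_3[OF c'] x y z w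
  show "\<eta> x (c [y, z, w]) \<bullet> (sinv A (c [x \<odot> y, z, w]) \<bullet>
    (c [x, y \<odot> z, w] \<bullet> (sinv A (c [x, y, z \<odot> w]) \<bullet> c [x, y, z]))) = \<rho> (x \<odot> (y \<odot> (z \<odot> w)))"
    using c coboundary_3[OF x y z w, of c] by (simp add: ord_cocycles_iff)
qed (use c x y z w cochain_3[of c] in \<open>simp_all add: ord_cocycles_iff \<eta>_rng \<eta>_\<rho> T.assoc\<close>)

subsection \<open>Normalization\<close>

text \<open>With \<open>a = c(e, e, e)\<close>, the cocycle identity at \<open>(e, e, e, e)\<close>
  reads \<open>a a = a (a a\<^sup>-\<^sup>1)\<close>.\<close>

lemma cocycle_idem:
  assumes c: "c \<in> ord_cocycles T A \<theta> \<eta>" and e: "e \<in> idems T"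
  shows "c [e, e, e] = \<theta> e"
proof -
  have c3: "c [e, e, e] \<in> carrier A" "rng A (c [e, e, e]) = \<theta> e"
    using c e cochain_3[of c e e e] by (simp_all add: ord_cocycles_iff)
  then have "c [e, e, e] \<bullet> c [e, e, e] = c [e, e, e] \<bullet> \<theta> e"
    using cocycle_eq[OF c, of e e e e] e A.rng_mult_self[of "c [e, e, e]"]
    by (simp add: \<eta>_idem rng_def)
  then show ?thesis
    using A.eq_rng_of_mult_eq[of "c [e, e, e]" "\<theta> e"] c3 e by simp
qed

text \<open>For a cocycle on a group, \<open>h(x, y) = c(x, 1, y) c(x, 1, 1)\<^sup>-\<^sup>2\<close> satisfies
  \<open>(\<delta> h)(x, 1, y) = c(x, 1, y)\<close>.  Here the identity is replaced by \<open>x\<^sup>-\<^sup>1 x\<close>.\<close>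

definition normalizer :: "('t list \<Rightarrow> 'a) \<Rightarrow> 't list \<Rightarrow> 'a" where
  "normalizer c = (\<lambda>xs\<in>tuples T 2. let x = xs ! 0; y = xs ! 1; d = sinv T x \<odot> x in
     c [x, d, y] \<bullet> (sinv A (c [x, d, d]) \<bullet> sinv A (c [x, d, d])))"

lemma normalizer_closed:
  assumes c: "c \<in> ord_cochains T A \<theta> 3"
  shows "normalizer c \<in> ord_cochains T A \<theta> 2"
  unfolding ord_cochains_iff
proof (intro conjI ballI impI)
  note [simp] = cochain_3[OF c]
  fix xs assume "xs \<in> tuples T 2"
  then obtain x y where xs: "xs = [x, y]" "x \<in> carrier T" "y \<in> carrier T"
    by (rule tuples_2E)
  then show "normalizer c xs \<in> carrier A"
    by (simp add: normalizer_def Let_def)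
  show "rng A (normalizer c xs) = \<rho> (sprod T xs)"
    using xs by (simp add: normalizer_def Let_def A.rng_mult_comm T.assoc)
  fix ys assume "ys \<in> tuples T 2"
  then obtain x' y' where ys: "ys = [x', y']" "x' \<in> carrier T" "y' \<in> carrier T"
    by (rule tuples_2E)
  assume "list_all2 (nat_le T) xs ys"
  then show "nat_le A (normalizer c xs) (normalizer c ys)"
    using xs ys
    by (auto simp: normalizer_def Let_def
        intro!: A.nat_le_mult A.nat_le_sinv cochain_3_mono[OF c] T.nat_le_mult T.nat_le_sinv)
qed (simp add: normalizer_def)

text \<open>With \<open>h\<close> the normalizer, the terms \<open>h(x e, y)\<close> and
  \<open>h(x, e y)\<close> cancel, \<open>h(e, y) = c(e, e, y)\<close> and
  \<open>h(x, e) = c(x, e, e)\<^sup>-\<^sup>1\<close>. What remains is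
  \<open>\<eta> x (c(e, e, y)) c(x, e, e)\<close>, and this is \<open>c(x, e, y)\<close> by the
  cocycle identity at \<open>(x, e, e, y)\<close>.\<close>

lemma coboundary_normalizer:
  assumes c: "c \<in> ord_cocycles T A \<theta> \<eta>" and e: "e \<in> idems T"
    and x: "x \<in> carrier T" "x \<odot> e = x" and y: "y \<in> carrier T" "e \<odot> y = y"
  shows "\<delta> 2 (normalizer c) [x, e, y] = c [x, e, y]"
proof -
  have c': "c \<in> ord_cochains T A \<theta> 3"
    using c by (simp add: ord_cocycles_iff)
  note n = cochain_2[OF normalizer_closed[OF c']] and [simp] = cochain_3[OF c']
  define d where "d = sinv T x \<odot> x"
  have d: "d \<in> idems T" "d \<in> carrier T" "x \<odot> d = x"
    using x by (auto simp: d_def)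
  have de_eq: "d \<odot> e = d"
    using x e by (simp add: d_def T.assoc)
  then have de: "nat_le T d e"
    using d e T.nat_leI[of d e] by simp
  have "normalizer c [e, y] = c [e, e, y] \<bullet> \<theta> e"
    using e y by (simp add: normalizer_def cocycle_idem[OF c])
  also have "\<dots> = \<theta> e \<bullet> c [e, e, y]"
    using e y by (intro A.commute) auto
  also have "\<dots> = c [e, e, y]"
    using e y \<rho>_le[of e y] by (intro A.rng_mult_absorb) auto
  finally have "normalizer c [e, y] = c [e, e, y]" .
  moreover have "normalizer c [x, e] = sinv A (c [x, e, e])"
  proof -
    \<comment> \<open>Here \<open>d\<close> lies below \<open>e\<close> and
      \<open>x d = x = x e\<close>, so the products of the arguments coincide and order preservation
      forces equal values.\<close>
    have "c [x, d, e] = c [x, e, e]" "c [x, d, d] = c [x, e, e]"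
      using x e d de by (auto simp: de_eq intro!: cochain_3_eq[OF c'])
    then have "normalizer c [x, e] = rng A (c [x, e, e]) \<bullet> sinv A (c [x, e, e])"
      using x e by (simp add: normalizer_def Let_def d_def[symmetric] rng_def A.assoc)
    also have "\<dots> = sinv A (c [x, e, e])"
      using x e A.rng_mult_self[of "sinv A (c [x, e, e])"] by simp
    finally show ?thesis .
  qed
  ultimately have "\<delta> 2 (normalizer c) [x, e, y]
      = rng A (normalizer c [x, y]) \<bullet> (\<eta> x (c [e, e, y]) \<bullet> c [x, e, e])"
    using x y e n[of x y] by (simp add: coboundary_2 rng_def A.ac)
  also have "\<dots> = rng A (c [x, e, y]) \<bullet> (\<eta> x (c [e, e, y]) \<bullet> c [x, e, e])"
    using x y e n[of x y] by simp
  also have "\<dots> = (\<eta> x (c [e, e, y]) \<bullet> c [x, e, y]) \<bullet> (sinv A (c [x, e, y]) \<bullet> c [x, e, e])"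
    using x y e by (simp add: rng_def A.ac)
  also have "\<eta> x (c [e, e, y]) \<bullet> c [x, e, y] = c [x, e, y] \<bullet> (c [x, e, y] \<bullet> sinv A (c [x, e, e]))"
    using cocycle_eq[OF c, of x e e y] x y e by simp
  also have "c [x, e, y] \<bullet> (c [x, e, y] \<bullet> sinv A (c [x, e, e])) \<bullet> (sinv A (c [x, e, y]) \<bullet> c [x, e, e])
      = rng A (c [x, e, y]) \<bullet> (rng A (c [x, e, e]) \<bullet> c [x, e, y])"
    using x y e by (simp add: rng_def A.ac)
  also have "\<dots> = c [x, e, y]"
  proof -
    have "rng A (c [x, e, e]) \<bullet> c [x, e, y] = c [x, e, y]"
      using x y e by (intro A.rng_mult_absorb) auto
    then show ?thesis
      using x y e A.rng_mult_self[of "c [x, e, y]"] by simp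
  qed
  finally show ?thesis .
qed

text \<open>The two outer conditions follow from the middle one by the cocycle identity at
  \<open>(e, e, e x, y)\<close> and at \<open>(x, y e, e, e)\<close>.\<close>

lemma normalized_if_middle:
  assumes c: "c \<in> ord_cocycles T A \<theta> \<eta>"
    and middle: "\<And>x e y. x \<in> carrier T \<Longrightarrow> e \<in> idems T \<Longrightarrow> y \<in> carrier T \<Longrightarrow> x \<odot> e = x \<Longrightarrow> e \<odot> y = y \<Longrightarrow>
      c [x, e, y] = \<rho> (x \<odot> y)"
  shows "normalized T \<theta> c"
  unfolding normalized_def
proof (intro ballI conjI)
  have c': "c \<in> ord_cochains T A \<theta> 3"
    using c by (simp add: ord_cocycles_iff)
  note c3 [simp] = cochain_3[OF c']
  fix x y e assume x: "x \<in> carrier T" and y: "y \<in> carrier T" and e: "e \<in> idems T"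
  then have [simp]: "e \<in> carrier T"
    by simp
  show "c [e, e \<odot> x, y] = \<rho> (e \<odot> x \<odot> y)"
  proof -
    let ?a = "c [e, e \<odot> x, y]"
    have "\<theta> e \<bullet> ?a \<bullet> ?a = ?a \<bullet> (\<rho> (e \<odot> (x \<odot> y)) \<bullet> \<rho> (e \<odot> x))"
      using cocycle_eq[OF c, of e e "e \<odot> x" y] x y e middle[of e e "e \<odot> x"]
        middle[of e e "e \<odot> (x \<odot> y)"] by (simp add: \<eta>_idem T.assoc)
    moreover have "\<theta> e \<bullet> ?a = ?a"
      using x y e \<rho>_le[of e "x \<odot> y"] by (intro A.rng_mult_absorb) (auto simp: T.assoc)
    ultimately have "?a = rng A ?a"
      using x y e by (intro A.eq_rng_of_mult_eq[of _ "\<rho> (e \<odot> (x \<odot> y)) \<bullet> \<rho> (e \<odot> x)"])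
        (auto simp: T.assoc A.idem_mult_idem)
    then show ?thesis
      using x y e by (simp add: T.assoc)
  qed
  show "c [x \<odot> e, e, e \<odot> y] = \<rho> (x \<odot> e \<odot> y)"
    using x y e middle[of "x \<odot> e" e "e \<odot> y"] by (simp add: T.assoc)
  show "c [x, y \<odot> e, e] = \<rho> (x \<odot> y \<odot> e)"
  proof -
    let ?a = "c [x, y \<odot> e, e]"
    have "\<rho> (x \<odot> (y \<odot> e)) \<bullet> ?a = \<rho> (x \<odot> (y \<odot> e)) \<bullet> rng A ?a"
      using cocycle_eq[OF c, of x "y \<odot> e" e e] x y e middle[of "y \<odot> e" e e]
        middle[of "x \<odot> (y \<odot> e)" e e] by (simp add: \<eta>_\<rho> T.assoc rng_def[of A])
    then show ?thesis
      using x y e A.rng_mult_self[of ?a] by (simp add: T.assoc)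
  qed
qed

lemma ex_normalized:
  assumes c: "c \<in> ord_cocycles T A \<theta> \<eta>"
  obtains c' where "c' \<in> ord_cocycles T A \<theta> \<eta>" "c' \<in> cohomology_class T A \<theta> \<eta> c"
    "normalized T \<theta> c'"
proof -
  have c3: "c \<in> ord_cochains T A \<theta> 3"
    using c by (simp add: ord_cocycles_iff)
  define h where "h = (\<lambda>xs\<in>tuples T 2. sinv A (normalizer c xs))"
  have h: "h \<in> ord_cochains T A \<theta> 2"
    unfolding h_def by (intro ord_cochains_sinv normalizer_closed c3)
  define c' where "c' = (\<lambda>xs\<in>tuples T 3. \<delta> 2 h xs \<bullet> c xs)"
  have c': "c' \<in> ord_cocycles T A \<theta> \<eta>"
    unfolding c'_def by (rule ord_cocycles_translate[OF c h])
  have "normalized T \<theta> c'"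
  proof (rule normalized_if_middle[OF c'])
    fix x e y assume *: "x \<in> carrier T" "e \<in> idems T" "y \<in> carrier T" "x \<odot> e = x" "e \<odot> y = y"
    then have "c' [x, e, y] = sinv A (c [x, e, y]) \<bullet> c [x, e, y]"
      by (simp add: c'_def h_def coboundary_2_sinv[OF normalizer_closed[OF c3]] coboundary_normalizer[OF c])
    also have "\<dots> = rng A (c [x, e, y])"
      using * cochain_3[OF c3] by (simp add: rng_def A.commute)
    finally show "c' [x, e, y] = \<rho> (x \<odot> y)"
      using * cochain_3[OF c3] by simp
  qed
  then show thesis
    using that c' h by (auto simp: c'_def cohomology_class_iff)
qed

subsection \<open>Twists\<close>

text \<open>This is the product called \<open>X t e w\<close> in the overview, for an arbitrary
  starting prefix in place of \<open>e\<close>.\<close>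

definition twist :: "('t list \<Rightarrow> 'a) \<Rightarrow> 't \<Rightarrow> 't \<Rightarrow> 't letter list \<Rightarrow> 'a" where
  "twist c t = run T A (\<lambda>p. \<rho> (t \<odot> p)) (\<lambda>p x. c [t, p, x])"

lemma weighted_cocycle:
  assumes c: "c \<in> ord_cochains T A \<theta> 3" and t: "t \<in> carrier T"
  shows "weighted (\<lambda>p. \<rho> (t \<odot> p)) (\<lambda>p x. c [t, p, x])"
  unfolding weighted_def
proof (intro ballI conjI)
  note [simp] = cochain_3[OF c] t
  fix p x e assume *: "p \<in> carrier T" "x \<in> carrier T" "e \<in> idems T"
  have "nat_le A (c [t, e \<odot> p, x]) (c [t, p, x])"
    using * by (intro cochain_3_mono[OF c] T.nat_leI) auto
  then show "c [t, e \<odot> p, x] = \<rho> (t \<odot> (e \<odot> p \<odot> x)) \<bullet> c [t, p, x]"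
    using * by (intro A.nat_leD') (auto simp: T.assoc)
qed (use cochain_3[OF c] t in auto)

lemma weighted_cochain_2:
  assumes h: "h \<in> ord_cochains T A \<theta> 2"
  shows "weighted \<rho> (\<lambda>p x. h [p, x])"
  unfolding weighted_def
proof (intro ballI conjI)
  note [simp] = cochain_2[OF h]
  fix p x e assume *: "p \<in> carrier T" "x \<in> carrier T" "e \<in> idems T"
  have "nat_le A (h [e \<odot> p, x]) (h [p, x])"
    using * by (intro cochain_2_mono[OF h] T.nat_leI) auto
  then show "h [e \<odot> p, x] = \<rho> (e \<odot> p \<odot> x) \<bullet> h [p, x]"
    using * by (intro A.nat_leD') (auto simp: T.assoc)
qed (use cochain_2[OF h] in auto)

context
  fixes c
  assumes c: "c \<in> ord_cocycles T A \<theta> \<eta>"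
begin

private lemma c': "c \<in> ord_cochains T A \<theta> 3"
  using c by (simp add: ord_cocycles_iff)

lemmas twist_run = weight_translate weighted_cocycle[OF c']

lemma
  assumes "t \<in> carrier T" "p \<in> carrier T" "letters_in w (carrier T)"
  shows twist_closed: "twist c t p w \<in> carrier A"
    and twist_rng: "rng A (twist c t p w) = \<rho> (t \<odot> endpt T p w)"
  using run_closed[OF twist_run] run_rng[OF twist_run] assms by (auto simp: twist_def)

lemma twist_twist:
  assumes t: "t \<in> carrier T" and x: "x \<in> carrier T" and e: "e \<in> idems T"
    and w: "letters_in w (carrier T)" "endpt T e w = e"
  shows "twist c t (x \<odot> e) w \<bullet> \<eta> t (twist c x e w) = twist c (t \<odot> x) e w"
proof -
  note [simp] = cochain_3[OF c'] t x e
  define g where "g p = \<rho> (t \<odot> x \<odot> p)" for p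
  define k where "k p = c [t, x, p]" for p
  have g: "weight g"
    unfolding g_def by (rule weight_translate) simp
  have k: "k p \<in> carrier A" "rng A (k p) = g p" if "p \<in> carrier T" for p
    using that by (simp_all add: k_def g_def T.assoc)
  have k_restrict: "k (f \<odot> p) = g (f \<odot> p) \<bullet> k p" if "f \<in> idems T" "p \<in> carrier T" for f p
  proof -
    have "nat_le A (k (f \<odot> p)) (k p)"
      unfolding k_def using that by (intro cochain_3_mono[OF c'] T.nat_leI) auto
    then show ?thesis
      using that k by (intro A.nat_leD') auto
  qed
  have "run T A g (\<lambda>p y. \<eta> t (c [x, p, y]) \<bullet> c [t, x \<odot> p, y]) e w
      = run T A g (\<lambda>p y. \<eta> t (c [x, p, y])) e w \<bullet> run T A g (\<lambda>p y. c [t, x \<odot> p, y]) e w"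
    using w by (intro run_mult) (auto simp: g_def)
  also have "run T A g (\<lambda>p y. \<eta> t (c [x, p, y])) e w = \<eta> t (twist c x e w)"
    unfolding twist_def using w
    by (subst run_\<eta>) (auto simp: \<eta>_\<rho> g_def T.assoc intro!: run_cong)
  also have "run T A g (\<lambda>p y. c [t, x \<odot> p, y]) e w = twist c t (x \<odot> e) w"
    unfolding twist_def using w
    by (subst run_translate) (auto simp: g_def T.assoc intro!: run_cong)
  finally have 1: "run T A g (\<lambda>p y. \<eta> t (c [x, p, y]) \<bullet> c [t, x \<odot> p, y]) e w
      = \<eta> t (twist c x e w) \<bullet> twist c t (x \<odot> e) w" .
  \<comment> \<open>The cocycle identity at \<open>(t, x, p, y)\<close>, edge by edge; its
    correction term is the increment of the potential \<open>k p = c(t, x, p)\<close> from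
    \<open>p\<close> to \<open>p y\<close>.\<close>
  have "run T A g (\<lambda>p y. \<eta> t (c [x, p, y]) \<bullet> c [t, x \<odot> p, y]) e w
      = run T A g (\<lambda>p y. c [t \<odot> x, p, y] \<bullet> (k (p \<odot> y) \<bullet> sinv A (k p))) e w"
    using w cocycle_eq[OF c t x] by (intro run_cong) (auto simp: k_def)
  also have "\<dots> = run T A g (\<lambda>p y. c [t \<odot> x, p, y]) e w
      \<bullet> run T A g (\<lambda>p y. k (p \<odot> y) \<bullet> sinv A (k p)) e w"
    using w by (intro run_mult) (auto simp: g_def k_def)
  also have "run T A g (\<lambda>p y. k (p \<odot> y) \<bullet> sinv A (k p)) e w = k (endpt T e w) \<bullet> sinv A (k e)"
    using k k_restrict w by (intro run_telescope[OF g]) auto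
  also have "\<dots> = g e"
    using w k by (simp flip: rng_def)
  also have "run T A g (\<lambda>p y. c [t \<odot> x, p, y]) e w = twist c (t \<odot> x) e w"
    unfolding twist_def using w by (intro run_cong) (auto simp: g_def)
  also have "twist c (t \<odot> x) e w \<bullet> g e = twist c (t \<odot> x) e w"
    using w A.rng_mult_self[of "twist c (t \<odot> x) e w"]
    by (simp add: twist_rng twist_closed g_def A.commute)
  finally show ?thesis
    using 1 w by (simp add: A.commute twist_closed)
qed

lemma twist_conj:
  assumes t: "t \<in> carrier T" and p: "p \<in> carrier T" and v: "letters_in v (carrier T)" "reduced v"
    and w: "letters_in w (carrier T)" "endpt T (endpt T p v) w = endpt T p v"
    and ret: "rng T (endpt T p v) \<odot> p = p"
  shows "twist c t p (v @ w @ winv v) = twist c t (endpt T p v) w"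
  using run_conj[OF weight_translate[OF t] weighted_cocycle[OF c' t] p v w ret] by (simp add: twist_def)

lemma twist_append:
  "t \<in> carrier T \<Longrightarrow> p \<in> carrier T \<Longrightarrow> letters_in u (carrier T) \<Longrightarrow> letters_in v (carrier T) \<Longrightarrow>
    twist c t p (u @ v) = twist c t p u \<bullet> twist c t (endpt T p u) v"
  unfolding twist_def by (rule run_append[OF twist_run])

lemma twist_reduce:
  "t \<in> carrier T \<Longrightarrow> p \<in> carrier T \<Longrightarrow> letters_in w (carrier T) \<Longrightarrow> endpt T p w = endpt T p (reduce w) \<Longrightarrow>
    twist c t p (reduce w) = twist c t p w"
  unfolding twist_def by (rule run_eq_reduce[OF twist_run])

lemma twist_restrict:
  "t \<in> carrier T \<Longrightarrow> p \<in> carrier T \<Longrightarrow> letters_in w (carrier T) \<Longrightarrow> e \<in> idems T \<Longrightarrow>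
    twist c t (e \<odot> p) w = \<rho> (t \<odot> endpt T (e \<odot> p) w) \<bullet> twist c t p w"
  unfolding twist_def by (rule run_restrict[OF twist_run])

text \<open>For an idempotent \<open>t\<close> the value \<open>c(t, q, x)\<close> equals
  \<open>c(t, t q, x)\<close> by order preservation, and the latter is trivial by normalization; so
  every edge contributes only an idempotent.\<close>

lemma twist_idem:
  assumes n: "normalized T \<theta> c" and t: "t \<in> idems T" and p: "p \<in> carrier T"
    and w: "letters_in w (carrier T)"
  shows "twist c t p w = \<rho> (t \<odot> endpt T p w)"
proof -
  have "c [t, q, x] = \<rho> (t \<odot> q \<odot> x)" if "q \<in> carrier T" "x \<in> carrier T" for q x
  proof -
    have "c [t, t \<odot> q, x] = c [t, q, x]"
      using that t by (intro cochain_3_eq[OF c'] T.nat_leI) (auto simp: T.assoc)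
    then show ?thesis
      using n that t by (auto simp: normalized_def)
  qed
  then have step: "step T A (\<lambda>p x. c [t, p, x]) q l = \<rho> (t \<odot> (q \<odot> letter_val T l))"
    if "q \<in> carrier T" "letter_base l \<in> carrier T" for q l
    using that t g_mult_sinv[OF weight_translate, of t q "letter_base l"]
    by (cases l) (auto simp: T.assoc)
  show ?thesis
    unfolding twist_def using p w
  proof (induction w arbitrary: p)
    case (Cons l w)
    let ?p = "p \<odot> letter_val T l"
    have "\<rho> (t \<odot> endpt T ?p w) \<bullet> \<rho> (t \<odot> ?p) = \<rho> (t \<odot> endpt T ?p w)"
      using Cons.prems t by (intro g_endpt[OF weight_translate]) auto
    then show ?case
      using Cons t by (simp add: step A.commute)
  qed simp
qed

text \<open>On the edge from \<open>p\<close> to \<open>p x\<close>, the coboundary of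
  \<open>h\<close> splits into \<open>\<eta> t (h(p, x))\<close>, the inverse of
  \<open>h(t p, x)\<close>, and the increment of the potential \<open>h(t, p)\<close>. The first two
  give \<open>H\<close> along the walk and along its translate by \<open>t\<close>; the third
  telescopes away.\<close>

lemma twist_coboundary:
  assumes h: "h \<in> ord_cochains T A \<theta> 2" and t: "t \<in> carrier T" and e: "e \<in> idems T"
    and w: "letters_in w (carrier T)" "endpt T e w = e"
  defines "H \<equiv> run T A \<rho> (\<lambda>p x. h [p, x])"
  shows "twist (\<lambda>xs\<in>tuples T 3. \<delta> 2 h xs \<bullet> c xs) t e w
    = \<eta> t (H e w) \<bullet> sinv A (H (t \<odot> e) w) \<bullet> twist c t e w"
proof -
  note [simp] = cochain_3[OF c'] cochain_2[OF h] t e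
  define g where "g p = \<rho> (t \<odot> p)" for p
  define k where "k p = h [t, p]" for p
  have g: "weight g"
    unfolding g_def by (rule weight_translate) simp
  have k: "k p \<in> carrier A" "rng A (k p) = g p" if "p \<in> carrier T" for p
    using that by (simp_all add: k_def g_def)
  have k_restrict: "k (f \<odot> p) = g (f \<odot> p) \<bullet> k p" if "f \<in> idems T" "p \<in> carrier T" for f p
  proof -
    have "nat_le A (k (f \<odot> p)) (k p)"
      unfolding k_def using that by (intro cochain_2_mono[OF h] T.nat_leI) auto
    then show ?thesis
      using that k by (intro A.nat_leD') auto
  qed
  have Hc: "H p w \<in> carrier A" if "p \<in> carrier T" for p
    unfolding H_def using that w by (intro run_closed[OF weight_\<rho> weighted_cochain_2[OF h]]) auto
  have g_idem: "g p \<in> idems A" if "p \<in> carrier T" for p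
    using that by (simp add: g_def)
  have "twist (\<lambda>xs\<in>tuples T 3. \<delta> 2 h xs \<bullet> c xs) t e w = run T A g
      (\<lambda>p x. (\<eta> t (h [p, x]) \<bullet> sinv A (h [t \<odot> p, x]) \<bullet> (k (p \<odot> x) \<bullet> sinv A (k p))) \<bullet> c [t, p, x]) e w"
    unfolding twist_def using w
    by (intro run_cong) (auto simp: g_def k_def coboundary_2 A.assoc)
  also have "\<dots> = run T A g (\<lambda>p x. \<eta> t (h [p, x])) e w \<bullet>
      run T A g (\<lambda>p x. sinv A (h [t \<odot> p, x])) e w \<bullet>
      run T A g (\<lambda>p x. k (p \<odot> x) \<bullet> sinv A (k p)) e w \<bullet> twist c t e w"
    using w g_idem unfolding twist_def
    by (simp add: run_mult k_def flip: g_def)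
  also have "run T A g (\<lambda>p x. \<eta> t (h [p, x])) e w = \<eta> t (H e w)"
    unfolding H_def using w by (subst run_\<eta>) (auto simp: \<eta>_\<rho> g_def intro!: run_cong)
  also have "run T A g (\<lambda>p x. sinv A (h [t \<odot> p, x])) e w = sinv A (H (t \<odot> e) w)"
    unfolding H_def using w g_idem
    by (subst run_translate)
      (auto simp: run_sinv g_def intro!: arg_cong[where f = "sinv A"] run_cong)
  also have "run T A g (\<lambda>p x. k (p \<odot> x) \<bullet> sinv A (k p)) e w = k (endpt T e w) \<bullet> sinv A (k e)"
    using k k_restrict w by (intro run_telescope[OF g]) auto
  also have "\<dots> = rng A (twist c t e w)"
    using w k by (simp add: twist_rng g_def flip: rng_def)
  also have "\<eta> t (H e w) \<bullet> sinv A (H (t \<odot> e) w) \<bullet> rng A (twist c t e w) \<bullet> twist c t e w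
      = \<eta> t (H e w) \<bullet> sinv A (H (t \<odot> e) w) \<bullet> twist c t e w"
    using w Hc by (simp add: A.assoc twist_closed)
  finally show ?thesis .
qed

end

end

section \<open>Actions by relatively invertible endomorphisms\<close>

text \<open>Relative invertibility comes with the action: the relative inverse of
  \<open>\<Lambda> s\<close> is \<open>\<Lambda> (s\<^sup>-\<^sup>1)\<close>, with idempotent
  \<open>\<alpha> (s\<^sup>-\<^sup>1 s)\<close>. The constructed extension and its isomorphic copies
  both go through this criterion.\<close>

lemma shom_rel_endI:
  assumes S: "inverse_semigroup S" and N: "inverse_semigroup N"
    and central: "\<And>f n. f \<in> idems N \<Longrightarrow> n \<in> carrier N \<Longrightarrow> n \<cdot>\<^bsub>N\<^esub> f = f \<cdot>\<^bsub>N\<^esub> n"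
    and \<alpha>: "\<And>e. e \<in> idems S \<Longrightarrow> \<alpha> e \<in> idems N"
    and endo: "\<And>s. s \<in> carrier S \<Longrightarrow> \<Lambda> s \<in> endos N"
    and comp: "\<And>s t n. s \<in> carrier S \<Longrightarrow> t \<in> carrier S \<Longrightarrow> n \<in> carrier N \<Longrightarrow>
      \<Lambda> (s \<cdot>\<^bsub>S\<^esub> t) n = \<Lambda> s (\<Lambda> t n)"
    and idem: "\<And>e n. e \<in> idems S \<Longrightarrow> n \<in> carrier N \<Longrightarrow> \<Lambda> e n = \<alpha> e \<cdot>\<^bsub>N\<^esub> n"
    and act: "\<And>s e. s \<in> carrier S \<Longrightarrow> e \<in> idems S \<Longrightarrow> \<Lambda> s (\<alpha> e) = \<alpha> (s \<cdot>\<^bsub>S\<^esub> e \<cdot>\<^bsub>S\<^esub> sinv S s)"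
  shows "\<Lambda> \<in> shom S (rel_end N)"
proof -
  interpret S: inv_semigroup S by unfold_locales (rule S)
  interpret N: inv_semigroup N by unfold_locales (rule N)
  have closed: "\<Lambda> s n \<in> carrier N" if "s \<in> carrier S" "n \<in> carrier N" for s n
    using endo[OF that(1)] that(2) by (auto simp: endos_def shom_def)
  have identity: "is_identity_of N (\<alpha> (s \<cdot>\<^bsub>S\<^esub> sinv S s)) (\<Lambda> s ` carrier N)" if s: "s \<in> carrier S" for s
    unfolding is_identity_of_def
  proof (intro conjI ballI)
    have "\<Lambda> s (\<alpha> (sinv S s \<cdot>\<^bsub>S\<^esub> s)) = \<alpha> (s \<cdot>\<^bsub>S\<^esub> sinv S s)"
      using s by (simp add: act S.assoc)
    moreover have "\<alpha> (sinv S s \<cdot>\<^bsub>S\<^esub> s) \<in> carrier N"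
      using s \<alpha>[of "sinv S s \<cdot>\<^bsub>S\<^esub> s"] by simp
    ultimately show "\<alpha> (s \<cdot>\<^bsub>S\<^esub> sinv S s) \<in> \<Lambda> s ` carrier N"
      by (metis image_eqI)
    fix b assume "b \<in> \<Lambda> s ` carrier N"
    then obtain n where n: "n \<in> carrier N" "b = \<Lambda> s n"
      by blast
    have "\<Lambda> (s \<cdot>\<^bsub>S\<^esub> sinv S s) (\<Lambda> s n) = \<Lambda> s n"
      using s n by (simp add: comp[symmetric] S.assoc)
    then show 1: "\<alpha> (s \<cdot>\<^bsub>S\<^esub> sinv S s) \<cdot>\<^bsub>N\<^esub> b = b"
      using s n closed idem[of "s \<cdot>\<^bsub>S\<^esub> sinv S s" "\<Lambda> s n"] by simp
    have "b \<cdot>\<^bsub>N\<^esub> \<alpha> (s \<cdot>\<^bsub>S\<^esub> sinv S s) = \<alpha> (s \<cdot>\<^bsub>S\<^esub> sinv S s) \<cdot>\<^bsub>N\<^esub> b"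
      using s n closed \<alpha> by (intro central) auto
    then show "b \<cdot>\<^bsub>N\<^esub> \<alpha> (s \<cdot>\<^bsub>S\<^esub> sinv S s) = b"
      by (simp add: 1)
  qed
  have "rel_invertible N (\<Lambda> s)" if s: "s \<in> carrier S" for s
    unfolding rel_invertible_def
  proof (rule bexI[where x = "\<Lambda> (sinv S s)"], rule bexI[where x = "\<alpha> (sinv S s \<cdot>\<^bsub>S\<^esub> s)"], intro conjI ballI)
    fix n assume n: "n \<in> carrier N"
    show "\<Lambda> (sinv S s) (\<Lambda> s n) = \<alpha> (sinv S s \<cdot>\<^bsub>S\<^esub> s) \<cdot>\<^bsub>N\<^esub> n"
      using s n by (simp add: comp[symmetric] idem)
    show "\<Lambda> s (\<Lambda> (sinv S s) n) = \<Lambda> s (\<alpha> (sinv S s \<cdot>\<^bsub>S\<^esub> s)) \<cdot>\<^bsub>N\<^esub> n"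
      using s n by (simp add: comp[symmetric] idem act S.assoc)
  next
    show "is_identity_of N (\<alpha> (sinv S s \<cdot>\<^bsub>S\<^esub> s)) (\<Lambda> (sinv S s) ` carrier N)"
      using identity[of "sinv S s"] s by simp
    show "is_identity_of N (\<Lambda> s (\<alpha> (sinv S s \<cdot>\<^bsub>S\<^esub> s))) (\<Lambda> s ` carrier N)"
      using identity[OF s] s by (simp add: act S.assoc)
  qed (use s endo \<alpha> in auto)
  moreover have "\<Lambda> (s \<cdot>\<^bsub>S\<^esub> t) = compose (carrier N) (\<Lambda> s) (\<Lambda> t)"
    if "s \<in> carrier S" "t \<in> carrier S" for s t
    using that endo[of "s \<cdot>\<^bsub>S\<^esub> t"] comp
    by (intro extensionalityI[where A = "carrier N"]) (auto simp: compose_def endos_def)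
  ultimately show ?thesis
    using endo by (auto simp: shom_def rel_end_def)
qed

section \<open>The semigroups \<open>S\<close> and \<open>N\<close>\<close>

context inv_module
begin

abbreviation "FG \<equiv> free_group (carrier T)"
abbreviation "CS \<equiv> constr_S T"
abbreviation "CN \<equiv> constr_N T A \<theta>"

sublocale FG: group FG
  by (rule group_free_group)

lemma FG_carrier: "w \<in> carrier FG \<longleftrightarrow> reduced w \<and> letters_in w (carrier T)"
  by (simp add: free_group_def letters_in_def)

lemma FG_mult: "u \<otimes>\<^bsub>FG\<^esub> v = reduce (u @ v)"
  and FG_one: "\<one>\<^bsub>FG\<^esub> = []"
  by (simp_all add: free_group_def)

lemma FG_inv: "u \<in> carrier FG \<Longrightarrow> inv\<^bsub>FG\<^esub> u = winv u"
  by (rule FG.inv_equality)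
    (auto simp: FG_mult FG_one FG_carrier reduce_winv_append reduced_winv)

lemma FG_Nil [simp]: "[] \<in> carrier FG"
  using FG.one_closed by (simp add: FG_one)

lemma FG_winv [simp]: "u \<in> carrier FG \<Longrightarrow> winv u \<in> carrier FG"
  by (simp add: FG_carrier reduced_winv)

lemma reduce_FG [simp]: "u \<in> carrier FG \<Longrightarrow> reduce u = u"
  by (simp add: FG_carrier reduce_reduced)

lemma FG_letters: "u \<in> carrier FG \<Longrightarrow> letters_in u (carrier T)"
  by (simp add: FG_carrier)

lemma FG_reduce [simp]: "letters_in u (carrier T) \<Longrightarrow> reduce u \<in> carrier FG"
  by (simp add: FG_carrier reduced_reduce)

lemma reduce_winv_cancel:
  assumes "u \<in> carrier FG"
  shows "reduce (u @ winv u @ u) = u" "reduce (winv u @ u @ winv u) = winv u"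
  using assms reduce_append_reduce(2)[of u "winv u @ u"] reduce_append_reduce(2)[of "winv u" "u @ winv u"]
  by (simp_all add: reduce_winv_append reduce_append_winv FG_carrier reduced_winv reduce_reduced)

definition wconj :: "'t letter list \<Rightarrow> 't letter list \<Rightarrow> 't letter list" where
  "wconj u w = reduce (u @ w @ winv u)"

lemma wconj_eq: "u \<in> carrier FG \<Longrightarrow> w \<in> carrier FG \<Longrightarrow> wconj u w = u \<otimes>\<^bsub>FG\<^esub> w \<otimes>\<^bsub>FG\<^esub> inv\<^bsub>FG\<^esub> u"
  by (simp add: wconj_def FG_mult FG_inv reduce_append_reduce)

lemma wconj_closed [simp]: "u \<in> carrier FG \<Longrightarrow> w \<in> carrier FG \<Longrightarrow> wconj u w \<in> carrier FG"
  by (simp add: wconj_eq)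

lemma wconj_wconj:
  "u \<in> carrier FG \<Longrightarrow> v \<in> carrier FG \<Longrightarrow> w \<in> carrier FG \<Longrightarrow>
    wconj u (wconj v w) = wconj (u \<otimes>\<^bsub>FG\<^esub> v) w"
  by (simp add: wconj_eq FG.inv_mult_group FG.m_assoc)

lemma wconj_mult:
  assumes "u \<in> carrier FG" "v \<in> carrier FG" "w \<in> carrier FG"
  shows "wconj u (v \<otimes>\<^bsub>FG\<^esub> w) = wconj u v \<otimes>\<^bsub>FG\<^esub> wconj u w"
proof -
  have "inv\<^bsub>FG\<^esub> u \<otimes>\<^bsub>FG\<^esub> (u \<otimes>\<^bsub>FG\<^esub> (w \<otimes>\<^bsub>FG\<^esub> inv\<^bsub>FG\<^esub> u)) = w \<otimes>\<^bsub>FG\<^esub> inv\<^bsub>FG\<^esub> u"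
    using assms by (simp add: FG.m_assoc[symmetric])
  then show ?thesis
    using assms by (simp add: wconj_eq FG.m_assoc)
qed

lemma wconj_Nil [simp]: "w \<in> carrier FG \<Longrightarrow> wconj [] w = w"
  by (simp add: wconj_def)

lemma wconj_to_Nil [simp]: "u \<in> carrier FG \<Longrightarrow> wconj u [] = []"
  by (simp add: wconj_def reduce_append_winv FG_carrier)

section \<open>Membership in \<open>S\<close> and \<open>N\<close> as a condition on walks\<close>

lemma sprod_closed: "w \<noteq> [] \<Longrightarrow> letters_in w (carrier T) \<Longrightarrow> sprod T (map (letter_val T) w) \<in> carrier T"
  by (induction w rule: induct_list012) auto

lemma endpt_sprod:
  "w \<noteq> [] \<Longrightarrow> p \<in> carrier T \<Longrightarrow> letters_in w (carrier T) \<Longrightarrow>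
    endpt T p w = p \<odot> sprod T (map (letter_val T) w)"
proof (induction w arbitrary: p)
  case (Cons l w)
  show ?case
  proof (cases "w = []")
    case False
    then have "endpt T p (l # w) = p \<odot> letter_val T l \<odot> sprod T (map (letter_val T) w)"
      using Cons by simp
    also have "\<dots> = p \<odot> (letter_val T l \<odot> sprod T (map (letter_val T) w))"
      using Cons.prems sprod_closed[OF False] by (intro T.assoc) auto
    finally show ?thesis
      using False by (cases w) auto
  qed simp
qed simp

text \<open>Both sides amount to \<open>t = rng t \<odot> \<nu>(w)\<close>. For the empty word,
  being below the adjoined identity means being idempotent, that is \<open>rng t = t\<close>; so no
  case distinction on \<open>w\<close> is needed afterwards.\<close>

lemma nat_le_nu:
  assumes t: "t \<in> carrier T" and w: "letters_in w (carrier T)"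
  shows "nat_le (adjoin_one T) (Some t) (nu T w) \<longleftrightarrow> endpt T (rng T t) w = t"
proof -
  have mult: "None \<cdot>\<^bsub>adjoin_one T\<^esub> y = y" "x \<cdot>\<^bsub>adjoin_one T\<^esub> None = x"
    "Some s \<cdot>\<^bsub>adjoin_one T\<^esub> Some s' = Some (s \<odot> s')" for x y s s'
    by (auto simp: adjoin_one_def split: option.splits)
  have "x \<in> idems (adjoin_one T) \<longleftrightarrow> x \<in> insert None (Some ` idems T)" for x
    by (cases x) (auto simp: idems_def[of "adjoin_one T"] mult adjoin_one_def[THEN arg_cong[where f = carrier]]
        intro: T.idemsI)
  then have idems: "idems (adjoin_one T) = insert None (Some ` idems T)"
    by blast
  show ?thesis
  proof (cases "w = []")
    case True
    have "nat_le (adjoin_one T) (Some t) (nu T w) \<longleftrightarrow> t \<in> idems T"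
      using True by (auto simp: nat_le_def idems nu_def mult)
    also have "\<dots> \<longleftrightarrow> rng T t = t"
      using t by (metis T.rng_idem T.rng_of_idem)
    finally show ?thesis
      using True by simp
  next
    case False
    define s where "s = sprod T (map (letter_val T) w)"
    have s: "s \<in> carrier T"
      using sprod_closed[OF False w] by (simp add: s_def)
    \<comment> \<open>The disjunct \<open>t = s\<close> comes from the adjoined identity, which is
      itself an idempotent of the enlarged semigroup.\<close>
    have "nat_le (adjoin_one T) (Some t) (nu T w) \<longleftrightarrow> t = s \<or> nat_le T t s"
      using False by (auto simp: nat_le_def idems nu_def mult s_def)
    also have "\<dots> \<longleftrightarrow> nat_le T t s"
      using s by auto
    also have "\<dots> \<longleftrightarrow> rng T t \<odot> s = t"
      using T.nat_leD[of t s] T.nat_leI[of "rng T t" s] s t by auto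
    finally show ?thesis
      using False w t by (simp add: endpt_sprod s_def)
  qed
qed

lemma CS_carrier:
  "(t, w) \<in> carrier CS \<longleftrightarrow> t \<in> carrier T \<and> w \<in> carrier FG \<and> endpt T (rng T t) w = t"
  using nat_le_nu FG_letters by (auto simp: constr_S_def)

lemma CN_carrier:
  "(a, e, w) \<in> carrier CN \<longleftrightarrow> a \<in> carrier A \<and> rng A a = \<theta> e \<and> e \<in> idems T \<and> w \<in> carrier FG \<and>
    endpt T e w = e"
  using nat_le_nu FG_letters by (auto simp: constr_N_def A.component_iff)

lemma CS_mult [simp]: "(t, w) \<cdot>\<^bsub>CS\<^esub> (t', w') = (t \<odot> t', reduce (w @ w'))"
  by (simp add: constr_S_def FG_mult)

lemma CN_mult [simp]: "(a, e, w) \<cdot>\<^bsub>CN\<^esub> (a', e', w') = (a \<bullet> a', e \<odot> e', reduce (w @ w'))"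
  by (simp add: constr_N_def FG_mult)

text \<open>Reduction can only enlarge the endpoint. If the range of the endpoint is still the
  starting idempotent \<open>e\<close>, nothing was lost on the way and the inequality is an
  equality.\<close>

lemma endpt_reduce_eq:
  assumes e: "e \<in> idems T" and w: "letters_in w (carrier T)" and s: "rng T (endpt T e w) = e"
  shows "endpt T e (reduce w) = endpt T e w"
proof -
  have "endpt T e w = e \<odot> endpt T e (reduce w)"
    using T.nat_leD[OF T.endpt_reduce[of e w]] e w s by simp
  also have "\<dots> = endpt T e (reduce w)"
    using T.endpt_mult[of e e "reduce w"] e w by simp
  finally show ?thesis ..
qed

text \<open>From \<open>rng (t t')\<close> the word \<open>u\<close> leads to
  \<open>t \<odot> rng t'\<close>, a left translate of the start of the second walk, and
  \<open>u'\<close> leads on to \<open>t \<odot> t'\<close>.\<close>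

lemma CS_mult_closed:
  assumes "(t, u) \<in> carrier CS" "(t', u') \<in> carrier CS"
  shows "(t \<odot> t', reduce (u @ u')) \<in> carrier CS"
proof -
  note * = assms[unfolded CS_carrier]
  have l: "letters_in u (carrier T)" "letters_in u' (carrier T)"
    using * FG_letters by auto
  have "endpt T (rng T (t \<odot> t')) u = endpt T (rng T (t \<odot> t') \<odot> rng T t) u"
    using * by simp
  also have "\<dots> = rng T (t \<odot> t') \<odot> t"
    using * l T.endpt_mult[of "rng T (t \<odot> t')" "rng T t" u] by simp
  also have "\<dots> = t \<odot> rng T t'"
    using * T.mult_idem_eq[of t "rng T t'"] by (simp add: T.rng_mult)
  finally have "endpt T (rng T (t \<odot> t')) (u @ u') = t \<odot> t'"
    using * l T.endpt_mult[of t "rng T t'" u'] by simp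
  then show ?thesis
    using * l endpt_reduce_eq[of "rng T (t \<odot> t')" "u @ u'"] by (simp add: CS_carrier)
qed

lemma CN_mult_closed:
  assumes "(a, e, w) \<in> carrier CN" "(a', e', w') \<in> carrier CN"
  shows "(a \<bullet> a', e \<odot> e', reduce (w @ w')) \<in> carrier CN"
proof -
  note * = assms[unfolded CN_carrier]
  have "(e \<odot> e', reduce (w @ w')) \<in> carrier CS"
    using * by (intro CS_mult_closed) (auto simp: CS_carrier)
  then show ?thesis
    using * T.idem_mult_idem[of e e'] by (auto simp: CN_carrier CS_carrier A.rng_mult_comm \<theta>_mult)
qed

lemma FG_inverse_unique:
  assumes u: "u \<in> carrier FG" "v \<in> carrier FG" "u \<otimes>\<^bsub>FG\<^esub> v \<otimes>\<^bsub>FG\<^esub> u = u"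
  shows "v = winv u"
proof -
  have "u \<otimes>\<^bsub>FG\<^esub> v \<otimes>\<^bsub>FG\<^esub> u = \<one>\<^bsub>FG\<^esub> \<otimes>\<^bsub>FG\<^esub> u"
    using u by simp
  then have "u \<otimes>\<^bsub>FG\<^esub> v = \<one>\<^bsub>FG\<^esub>"
    using u FG.right_cancel[of "u" "u \<otimes>\<^bsub>FG\<^esub> v" "\<one>\<^bsub>FG\<^esub>"] by simp
  then show ?thesis
    using u FG.inv_equality[of v u] FG.inv_comm[of u v] by (simp add: FG_inv)
qed

lemma FG_idem: "u \<in> carrier FG \<Longrightarrow> reduce (u @ u) = u \<longleftrightarrow> u = []"
  using FG.r_cancel_one[of u u] by (simp add: FG_mult FG_one)

lemma CS_sinv_closed:
  assumes "(t, u) \<in> carrier CS"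
  shows "(sinv T t, winv u) \<in> carrier CS"
proof -
  note * = assms[unfolded CS_carrier]
  have "endpt T t (winv u) = rng T t"
    using * T.endpt_winv[of "rng T t" u] FG_letters[of u] by simp
  then have "endpt T (sinv T t \<odot> t) (winv u) = sinv T t"
    using * T.endpt_mult[of "sinv T t" t "winv u"] FG_letters[of u] by (simp add: rng_def)
  then show ?thesis
    using * by (simp add: CS_carrier rng_def)
qed

lemma CS_inverse_semigroup: "inverse_semigroup CS"
  unfolding inverse_semigroup_def
proof (intro conjI ballI)
  fix x y z assume x: "x \<in> carrier CS" and y: "y \<in> carrier CS" and z: "z \<in> carrier CS"
  obtain t u t' u' t'' u'' where [simp]: "x = (t, u)" "y = (t', u')" "z = (t'', u'')"
    by (metis surj_pair)
  show "x \<cdot>\<^bsub>CS\<^esub> y \<in> carrier CS"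
    using x y by (simp add: CS_mult_closed)
  show "(x \<cdot>\<^bsub>CS\<^esub> y) \<cdot>\<^bsub>CS\<^esub> z = x \<cdot>\<^bsub>CS\<^esub> (y \<cdot>\<^bsub>CS\<^esub> z)"
    using x y z by (simp add: CS_carrier T.assoc reduce_append_reduce)
next
  fix x assume x: "x \<in> carrier CS"
  obtain t u where [simp]: "x = (t, u)"
    by (metis surj_pair)
  have tu: "t \<in> carrier T" "u \<in> carrier FG"
    using x by (simp_all add: CS_carrier)
  show "\<exists>!y. y \<in> carrier CS \<and> x \<cdot>\<^bsub>CS\<^esub> y \<cdot>\<^bsub>CS\<^esub> x = x \<and> y \<cdot>\<^bsub>CS\<^esub> x \<cdot>\<^bsub>CS\<^esub> y = y"
  proof (rule ex1I[of _ "(sinv T t, winv u)"])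
    show "(sinv T t, winv u) \<in> carrier CS \<and> x \<cdot>\<^bsub>CS\<^esub> (sinv T t, winv u) \<cdot>\<^bsub>CS\<^esub> x = x \<and>
      (sinv T t, winv u) \<cdot>\<^bsub>CS\<^esub> x \<cdot>\<^bsub>CS\<^esub> (sinv T t, winv u) = (sinv T t, winv u)"
      using x tu by (simp add: CS_sinv_closed T.assoc reduce_append_reduce reduce_winv_cancel)
  next
    fix y assume y: "y \<in> carrier CS \<and> x \<cdot>\<^bsub>CS\<^esub> y \<cdot>\<^bsub>CS\<^esub> x = x \<and> y \<cdot>\<^bsub>CS\<^esub> x \<cdot>\<^bsub>CS\<^esub> y = y"
    obtain t' u' where [simp]: "y = (t', u')"
      by (metis surj_pair)
    have "sinv T t = t'"
      using y tu by (intro T.sinv_eqI) (auto simp: CS_carrier T.assoc)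
    moreover have "u' = winv u"
      using y tu by (intro FG_inverse_unique) (auto simp: CS_carrier FG_mult)
    ultimately show "y = (sinv T t, winv u)"
      by simp
  qed
qed

sublocale CS: inv_semigroup CS
  by unfold_locales (rule CS_inverse_semigroup)

lemma CS_sinv:
  assumes "(t, u) \<in> carrier CS"
  shows "sinv CS (t, u) = (sinv T t, winv u)"
proof (rule CS.sinv_eqI)
  have tu: "t \<in> carrier T" "u \<in> carrier FG"
    using assms by (simp_all add: CS_carrier)
  show "(t, u) \<cdot>\<^bsub>CS\<^esub> ((sinv T t, winv u) \<cdot>\<^bsub>CS\<^esub> (t, u)) = (t, u)"
    "(sinv T t, winv u) \<cdot>\<^bsub>CS\<^esub> ((t, u) \<cdot>\<^bsub>CS\<^esub> (sinv T t, winv u)) = (sinv T t, winv u)"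
    using tu by (simp_all add: reduce_append_reduce reduce_winv_cancel)
qed (use assms CS_sinv_closed in auto)

lemma CS_idems: "(t, u) \<in> idems CS \<longleftrightarrow> t \<in> idems T \<and> u = []"
  unfolding idems_def[of CS] using FG_idem
  by (auto simp: CS_carrier intro: T.idemsI)

lemma CN_inverse_semigroup: "inverse_semigroup CN"
  unfolding inverse_semigroup_def
proof (intro conjI ballI)
  fix x y z assume x: "x \<in> carrier CN" and y: "y \<in> carrier CN" and z: "z \<in> carrier CN"
  obtain a e w a' e' w' a'' e'' w'' where [simp]: "x = (a, e, w)" "y = (a', e', w')" "z = (a'', e'', w'')"
    by (metis surj_pair)
  show "x \<cdot>\<^bsub>CN\<^esub> y \<in> carrier CN"
    using x y by (simp add: CN_mult_closed)
  show "(x \<cdot>\<^bsub>CN\<^esub> y) \<cdot>\<^bsub>CN\<^esub> z = x \<cdot>\<^bsub>CN\<^esub> (y \<cdot>\<^bsub>CN\<^esub> z)"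
    using x y z by (simp add: CN_carrier T.assoc A.assoc reduce_append_reduce)
next
  fix x assume x: "x \<in> carrier CN"
  obtain a e w where [simp]: "x = (a, e, w)"
    by (metis surj_pair)
  have c: "a \<in> carrier A" "rng A a = \<theta> e" "e \<in> idems T" "(e, w) \<in> carrier CS" "w \<in> carrier FG"
    using x by (simp_all add: CN_carrier CS_carrier)
  have w: "(e, winv w) \<in> carrier CS"
    using CS_sinv_closed[OF c(4)] c by simp
  show "\<exists>!y. y \<in> carrier CN \<and> x \<cdot>\<^bsub>CN\<^esub> y \<cdot>\<^bsub>CN\<^esub> x = x \<and> y \<cdot>\<^bsub>CN\<^esub> x \<cdot>\<^bsub>CN\<^esub> y = y"
  proof (rule ex1I[of _ "(sinv A a, e, winv w)"])
    show "(sinv A a, e, winv w) \<in> carrier CN \<and> x \<cdot>\<^bsub>CN\<^esub> (sinv A a, e, winv w) \<cdot>\<^bsub>CN\<^esub> x = x \<and>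
      (sinv A a, e, winv w) \<cdot>\<^bsub>CN\<^esub> x \<cdot>\<^bsub>CN\<^esub> (sinv A a, e, winv w) = (sinv A a, e, winv w)"
      using c w by (simp add: CN_carrier CS_carrier A.assoc reduce_append_reduce reduce_winv_cancel)
  next
    fix y assume y: "y \<in> carrier CN \<and> x \<cdot>\<^bsub>CN\<^esub> y \<cdot>\<^bsub>CN\<^esub> x = x \<and> y \<cdot>\<^bsub>CN\<^esub> x \<cdot>\<^bsub>CN\<^esub> y = y"
    obtain a' e' w' where [simp]: "y = (a', e', w')"
      by (metis surj_pair)
    have "sinv A a = a'"
      using y c by (intro A.sinv_eqI) (auto simp: CN_carrier A.assoc)
    moreover have "sinv T e = e'"
      using y c by (intro T.sinv_eqI) (auto simp: CN_carrier T.assoc)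
    moreover have "w' = winv w"
      using y c by (intro FG_inverse_unique) (auto simp: CN_carrier FG_mult)
    ultimately show "y = (sinv A a, e, winv w)"
      using c by simp
  qed
qed

sublocale CN: inv_semigroup CN
  by unfold_locales (rule CN_inverse_semigroup)

lemma CN_sinv_closed:
  assumes "(a, e, w) \<in> carrier CN"
  shows "(sinv A a, e, winv w) \<in> carrier CN"
  using assms CS_sinv_closed[of e w] by (auto simp: CN_carrier CS_carrier)

lemma CN_sinv:
  assumes "(a, e, w) \<in> carrier CN"
  shows "sinv CN (a, e, w) = (sinv A a, e, winv w)"
proof (rule CN.sinv_eqI)
  have c: "a \<in> carrier A" "e \<in> idems T" "(e, w) \<in> carrier CS" "w \<in> carrier FG"
    using assms by (simp_all add: CN_carrier CS_carrier)
  show "(a, e, w) \<cdot>\<^bsub>CN\<^esub> ((sinv A a, e, winv w) \<cdot>\<^bsub>CN\<^esub> (a, e, w)) = (a, e, w)"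
    "(sinv A a, e, winv w) \<cdot>\<^bsub>CN\<^esub> ((a, e, w) \<cdot>\<^bsub>CN\<^esub> (sinv A a, e, winv w)) = (sinv A a, e, winv w)"
    using c by (simp_all add: reduce_append_reduce reduce_winv_cancel)
qed (use assms CN_sinv_closed in auto)

lemma CN_idems: "(a, e, w) \<in> idems CN \<longleftrightarrow> e \<in> idems T \<and> a = \<theta> e \<and> w = []"
proof
  assume n: "(a, e, w) \<in> idems CN"
  then have *: "(a, e, w) \<in> carrier CN" "a \<bullet> a = a" "reduce (w @ w) = w"
    using CN.idem_idem[OF n] by auto
  then have "a \<in> idems A"
    by (intro A.idemsI) (auto simp: CN_carrier)
  then show "e \<in> idems T \<and> a = \<theta> e \<and> w = []"
    using * A.rng_of_idem[of a] FG_idem[of w] by (auto simp: CN_carrier)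
next
  assume "e \<in> idems T \<and> a = \<theta> e \<and> w = []"
  then show "(a, e, w) \<in> idems CN"
    by (intro CN.idemsI) (auto simp: CN_carrier reduce_reduced)
qed

lemma CN_semilattice_of_groups: "semilattice_of_groups CN"
proof (rule semilattice_of_groupsI[OF CN_inverse_semigroup])
  fix x assume x: "x \<in> carrier CN"
  then obtain a e w where "x = (a, e, w)" "(a, e, w) \<in> carrier CN"
    by (metis surj_pair)
  then show "x \<cdot>\<^bsub>CN\<^esub> sinv CN x = sinv CN x \<cdot>\<^bsub>CN\<^esub> x"
    by (simp add: CN_sinv CN_carrier FG_carrier reduce_append_winv reduce_winv_append A.commute)
qed

end

section \<open>The action in closed form\<close>

context inv_module
begin

definition act :: "('t list \<Rightarrow> 'a) \<Rightarrow> 't \<times> 't letter list \<Rightarrow> 'a \<times> 't \<times> 't letter list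
    \<Rightarrow> 'a \<times> 't \<times> 't letter list" where
  "act c = (\<lambda>(t, u) (a, e, w). (twist c t e w \<bullet> \<eta> t a, t \<odot> e \<odot> sinv T t, wconj u w))"

lemma act_simp [simp]:
  "act c (t, u) (a, e, w) = (twist c t e w \<bullet> \<eta> t a, t \<odot> e \<odot> sinv T t, wconj u w)"
  by (simp add: act_def)

lemma \<theta>_conj: "t \<in> carrier T \<Longrightarrow> e \<in> idems T \<Longrightarrow> \<theta> (t \<odot> e \<odot> sinv T t) = \<rho> (t \<odot> e)"
  by (simp add: T.rng_mult)

context
  fixes t u e
  assumes s: "(t, u) \<in> carrier CS" and e: "e \<in> idems T"
begin

text \<open>The start \<open>t e t\<^sup>-\<^sup>1\<close> is a restriction of \<open>rng t\<close>,
  from which \<open>u\<close> leads to \<open>t\<close>.\<close>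

lemma endpt_conj: "endpt T (t \<odot> e \<odot> sinv T t) u = t \<odot> e"
proof -
  have *: "t \<in> carrier T" "letters_in u (carrier T)" "endpt T (rng T t) u = t"
    using s FG_letters by (auto simp: CS_carrier)
  have "t \<odot> e \<odot> sinv T t = t \<odot> e \<odot> sinv T t \<odot> rng T t"
    using * e by (simp add: rng_def T.assoc)
  then have "endpt T (t \<odot> e \<odot> sinv T t) u = t \<odot> e \<odot> sinv T t \<odot> t"
    using * e T.endpt_mult[of "t \<odot> e \<odot> sinv T t" "rng T t" u] by simp
  then show ?thesis
    using T.mult_idem_eq[of t e] * e by simp
qed

text \<open>The walk goes out along \<open>u\<close> to \<open>t e\<close>, runs through the loop
  \<open>w\<close>, which is the left translate by \<open>t\<close> of the loop at \<open>e\<close>,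
  and comes back along the inverse of \<open>u\<close>.\<close>

lemma endpt_wconj:
  assumes w: "w \<in> carrier FG" "endpt T e w = e"
  shows "endpt T (t \<odot> e \<odot> sinv T t) (u @ w @ winv u) = t \<odot> e \<odot> sinv T t"
proof -
  have *: "t \<in> carrier T" "letters_in u (carrier T)" "letters_in w (carrier T)"
    using s w FG_letters by (auto simp: CS_carrier)
  have "endpt T (t \<odot> e) w = t \<odot> e"
    using * e w by (simp add: T.endpt_mult)
  then have "endpt T (t \<odot> e \<odot> sinv T t) (u @ w @ winv u)
      = endpt T (endpt T (t \<odot> e \<odot> sinv T t) u) (winv u)"
    by (simp add: endpt_conj)
  also have "\<dots> = rng T (t \<odot> e) \<odot> (t \<odot> e \<odot> sinv T t)"
    using * e by (subst T.endpt_winv) (auto simp: endpt_conj)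
  also have "rng T (t \<odot> e) = t \<odot> e \<odot> sinv T t"
    using * e by (simp add: T.rng_mult)
  finally show ?thesis
    using * e by simp
qed

lemma endpt_wconj_reduce:
  assumes w: "w \<in> carrier FG" "endpt T e w = e"
  shows "endpt T (t \<odot> e \<odot> sinv T t) (wconj u w) = t \<odot> e \<odot> sinv T t"
  unfolding wconj_def
  using endpt_reduce_eq[of "t \<odot> e \<odot> sinv T t" "u @ w @ winv u"] endpt_wconj[OF w] s w e FG_letters
  by (auto simp: CS_carrier)

end

context
  fixes c
  assumes c: "c \<in> ord_cocycles T A \<theta> \<eta>"
begin

lemma act_closed:
  assumes "s \<in> carrier CS" "n \<in> carrier CN"
  shows "act c s n \<in> carrier CN"
proof -
  obtain t u a e w where [simp]: "s = (t, u)" "n = (a, e, w)"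
    by (metis surj_pair)
  have *: "t \<in> carrier T" "u \<in> carrier FG" "a \<in> carrier A" "rng A a = \<theta> e" "e \<in> idems T"
    "w \<in> carrier FG" "endpt T e w = e" "letters_in w (carrier T)"
    using assms FG_letters by (auto simp: CS_carrier CN_carrier)
  have "rng A (twist c t e w \<bullet> \<eta> t a) = \<theta> (t \<odot> e \<odot> sinv T t)"
    using * by (simp add: A.rng_mult_comm twist_closed[OF c] twist_rng[OF c] \<eta>_rng \<eta>_\<theta> \<theta>_conj
        flip: A.rng_of_idem)
  then show ?thesis
    using * assms endpt_wconj_reduce[of t u e w] by (simp add: CN_carrier twist_closed[OF c])
qed

text \<open>Read from \<open>x e x\<^sup>-\<^sup>1\<close>, the word
  \<open>v w v\<^sup>-\<^sup>1\<close> gives the same product as the loop \<open>w\<close> read at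
  \<open>x e\<close>, because the two passages along \<open>v\<close> cancel. Then
  \<open>twist_twist\<close> combines the two twists.\<close>

lemma act_act:
  assumes "s \<in> carrier CS" "s' \<in> carrier CS" "n \<in> carrier CN"
  shows "act c s (act c s' n) = act c (s \<cdot>\<^bsub>CS\<^esub> s') n"
proof -
  obtain t u x v a e w where [simp]: "s = (t, u)" "s' = (x, v)" "n = (a, e, w)"
    by (metis surj_pair)
  have *: "t \<in> carrier T" "u \<in> carrier FG" "x \<in> carrier T" "v \<in> carrier FG" "a \<in> carrier A"
    "e \<in> idems T" "w \<in> carrier FG" "endpt T e w = e" "letters_in w (carrier T)" "letters_in v (carrier T)"
    "reduced v"
    using assms by (auto simp: CS_carrier CN_carrier FG_carrier)
  let ?f = "x \<odot> e \<odot> sinv T x"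
  have f: "?f \<in> idems T" "?f \<in> carrier T"
    using * by auto
  have fv: "endpt T ?f v = x \<odot> e"
    using assms * by (intro endpt_conj) auto
  have xe: "endpt T (x \<odot> e) w = x \<odot> e"
    using * by (simp add: T.endpt_mult)
  have "twist c t ?f (wconj v w) = twist c t ?f (v @ w @ winv v)"
    unfolding wconj_def
    using * f assms endpt_wconj[of x v e w] endpt_wconj_reduce[of x v e w]
    by (intro twist_reduce[OF c]) (auto simp: wconj_def)
  also have "\<dots> = twist c t (endpt T ?f v) w"
    using * f by (intro twist_conj[OF c]) (auto simp: fv xe T.rng_mult simp del: T.conj_idem)
  finally have "twist c t ?f (wconj v w) = twist c t (x \<odot> e) w"
    by (simp add: fv)
  then have "twist c t ?f (wconj v w) \<bullet> \<eta> t (twist c x e w \<bullet> \<eta> x a)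
      = twist c t (x \<odot> e) w \<bullet> \<eta> t (twist c x e w) \<bullet> \<eta> (t \<odot> x) a"
    using * by (simp add: \<eta>_mult \<eta>_comp twist_closed[OF c] A.assoc)
  also have "\<dots> = twist c (t \<odot> x) e w \<bullet> \<eta> (t \<odot> x) a"
    using * by (simp add: twist_twist[OF c])
  finally show ?thesis
    using * by (simp add: wconj_wconj FG_mult T.sinv_mult T.assoc)
qed

text \<open>Both words are loops at \<open>e e'\<close> too, so the twist of their concatenation
  splits into the two twists restricted to \<open>?r\<close>. This idempotent is the range of
  \<open>\<eta> t (a \<bullet> a')\<close> and is absorbed there.\<close>

lemma act_mult:
  assumes "s \<in> carrier CS" "n \<in> carrier CN" "n' \<in> carrier CN"
  shows "act c s (n \<cdot>\<^bsub>CN\<^esub> n') = act c s n \<cdot>\<^bsub>CN\<^esub> act c s n'"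
proof -
  obtain t u a e w a' e' w' where [simp]: "s = (t, u)" "n = (a, e, w)" "n' = (a', e', w')"
    by (metis surj_pair)
  have *: "t \<in> carrier T" "u \<in> carrier FG" "a \<in> carrier A" "e \<in> idems T" "w \<in> carrier FG"
    "endpt T e w = e" "letters_in w (carrier T)" "rng A a = \<theta> e"
    "a' \<in> carrier A" "e' \<in> idems T" "w' \<in> carrier FG" "endpt T e' w' = e'" "letters_in w' (carrier T)"
    "rng A a' = \<theta> e'"
    using assms by (auto simp: CS_carrier CN_carrier FG_carrier)
  have ee: "e \<odot> e' \<in> idems T" "e \<odot> e' = e' \<odot> e"
    using * by (auto intro: T.idem_mult_idem T.idem_commute)
  have ends: "endpt T (e \<odot> e') w = e \<odot> e'" "endpt T (e \<odot> e') w' = e \<odot> e'"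
    using * T.endpt_mult[of e' e w] T.endpt_mult[of e e' w'] ee by simp_all
  let ?r = "\<rho> (t \<odot> (e \<odot> e'))"
  have "twist c t (e \<odot> e') (reduce (w @ w')) = twist c t (e \<odot> e') (w @ w')"
    using * ee ends endpt_reduce_eq[of "e \<odot> e'" "w @ w'"] by (intro twist_reduce[OF c]) auto
  also have "\<dots> = twist c t (e \<odot> e') w \<bullet> twist c t (e \<odot> e') w'"
    using * ee ends by (simp add: twist_append[OF c])
  also have "twist c t (e \<odot> e') w = ?r \<bullet> twist c t e w"
    using * ee ends twist_restrict[OF c, of t e w e'] by simp
  also have "twist c t (e \<odot> e') w' = ?r \<bullet> twist c t e' w'"
    using * ends twist_restrict[OF c, of t e' w' e] by simp
  finally have tw: "twist c t (e \<odot> e') (reduce (w @ w'))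
      = ?r \<bullet> twist c t e w \<bullet> (?r \<bullet> twist c t e' w')" .
  have "?r = rng A (\<eta> t (a \<bullet> a'))"
    using * ee by (simp add: \<eta>_rng A.rng_mult_comm \<eta>_\<theta> flip: \<theta>_mult \<theta>_conj)
  then have r: "?r \<bullet> \<eta> t (a \<bullet> a') = \<eta> t (a \<bullet> a')"
    using * by simp
  have "twist c t (e \<odot> e') (reduce (w @ w')) \<bullet> \<eta> t (a \<bullet> a')
      = twist c t e w \<bullet> twist c t e' w' \<bullet> (?r \<bullet> (?r \<bullet> \<eta> t (a \<bullet> a')))"
    unfolding tw using * ee by (simp add: twist_closed[OF c] A.ac)
  also have "\<dots> = twist c t e w \<bullet> \<eta> t a \<bullet> (twist c t e' w' \<bullet> \<eta> t a')"
    unfolding r using * by (simp add: \<eta>_mult twist_closed[OF c] A.ac)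
  finally have "twist c t (e \<odot> e') (reduce (w @ w')) \<bullet> \<eta> t (a \<bullet> a')
      = twist c t e w \<bullet> \<eta> t a \<bullet> (twist c t e' w' \<bullet> \<eta> t a')" .
  moreover have "t \<odot> e \<odot> sinv T t \<odot> (t \<odot> e' \<odot> sinv T t) = t \<odot> (e \<odot> e') \<odot> sinv T t"
    using * T.mult_idem_eq[of t e] by (simp add: T.assoc[symmetric])
  moreover have "wconj u (reduce (w @ w')) = reduce (wconj u w @ wconj u w')"
    using * wconj_mult[of u w w'] by (simp add: FG_mult)
  ultimately show ?thesis
    by simp
qed

lemma act_alpha:
  assumes "s \<in> carrier CS" "e \<in> idems CS"
  shows "act c s (constr_alpha \<theta> e) = constr_alpha \<theta> (s \<cdot>\<^bsub>CS\<^esub> e \<cdot>\<^bsub>CS\<^esub> sinv CS s)"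
proof -
  obtain t u f where *: "s = (t, u)" "e = (f, [])" "f \<in> idems T" "t \<in> carrier T" "u \<in> carrier FG"
    using assms by (cases s, cases e) (auto simp: CS_carrier CS_idems)
  then show ?thesis
    using assms CS_sinv[of t u]
    by (simp add: constr_alpha_def twist_def \<eta>_\<theta> \<theta>_conj)
qed

section \<open>Normalized cocycles: the given definition of \<open>\<lambda>\<close> agrees with the
  closed form\<close>

context
  assumes n: "normalized T \<theta> c"
begin

lemma act_idem:
  assumes "e \<in> idems CS" "n \<in> carrier CN"
  shows "act c e n = constr_alpha \<theta> e \<cdot>\<^bsub>CN\<^esub> n"
proof -
  obtain f a e' w where *: "e = (f, [])" "n = (a, e', w)" "f \<in> idems T"
    using assms by (cases e, cases n) (auto simp: CS_idems)
  then have **: "a \<in> carrier A" "e' \<in> idems T" "w \<in> carrier FG" "endpt T e' w = e'"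
    "letters_in w (carrier T)" "rng A a = \<theta> e'"
    using assms by (auto simp: CN_carrier FG_carrier)
  have "f \<odot> e' \<odot> f = f \<odot> e'"
    using * ** T.idem_commute[of e' f] by (simp add: T.assoc)
  moreover have "\<theta> (f \<odot> e') \<bullet> (\<theta> f \<bullet> a) = (\<theta> f \<bullet> \<theta> f) \<bullet> (\<theta> e' \<bullet> a)"
    using * ** by (simp add: \<theta>_mult A.ac)
  moreover have "\<theta> e' \<bullet> a = a"
    using ** A.rng_mult_self[of a] by simp
  ultimately show ?thesis
    using * ** T.idem_mult_idem[of f e']
    by (simp add: twist_idem[OF c n] constr_alpha_def \<eta>_idem)
qed

text \<open>The recursion for \<open>xi\<close> merges the first two letters, so its leading letter
  plays the role of the current prefix of the walk.\<close>

lemma xi_eq_twist: "xi T A \<theta> c t (Pos x # u) = twist c t x u"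
proof (induction u arbitrary: x)
  case (Cons l u)
  then show ?case
    by (cases l) (auto simp: twist_def)
qed (simp add: twist_def)

text \<open>\<open>zeta\<close> starts from the first letter of \<open>w\<close> where
  \<open>twist\<close> starts from \<open>e\<close>. The factor \<open>\<rho> (t \<odot> e)\<close>
  restricts the former walk to the latter, and normalization disposes of the one edge that
  \<open>xi\<close> leaves out.\<close>

lemma zeta_twist:
  assumes t: "t \<in> carrier T" and e: "e \<in> idems T" and w: "letters_in w (carrier T)" "endpt T e w = e"
  shows "zeta T A \<theta> c t w \<in> carrier A" "\<rho> (t \<odot> e) \<bullet> zeta T A \<theta> c t w = twist c t e w"
proof -
  have c': "c \<in> ord_cochains T A \<theta> 3"
    using c by (simp add: ord_cocycles_iff)
  note c3 = cochain_3[OF c']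
  have "zeta T A \<theta> c t w \<in> carrier A \<and> \<rho> (t \<odot> e) \<bullet> zeta T A \<theta> c t w = twist c t e w"
  proof (cases w)
    case Nil
    then show ?thesis
      using t e by (simp add: zeta_def twist_def)
  next
    case (Cons l u)
    note g = weight_translate[OF t]
    show ?thesis
    proof (cases l)
      case (Pos x)
      have u: "x \<in> carrier T" "letters_in u (carrier T)" "endpt T (e \<odot> x) u = e"
        using w Cons Pos by auto
      \<comment> \<open>The edge from \<open>e\<close> to \<open>e x\<close> has no counterpart in
        \<open>xi\<close>. Redistributing \<open>e\<close> over the arguments brings it into the
        form covered by the middle normalization condition.\<close>
      have "c [t, e, x] = c [t \<odot> e, e, e \<odot> x]"
        using t e u by (intro cochain_3_eq[OF c', symmetric] T.nat_leI T.nat_le_multI) (auto simp: T.assoc)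
      also have "\<dots> = \<rho> (t \<odot> (e \<odot> x))"
        using n t e u by (auto simp: normalized_def T.assoc)
      finally have ce: "c [t, e, x] = \<rho> (t \<odot> (e \<odot> x))" .
      have "twist c t e w = \<rho> (t \<odot> (e \<odot> x)) \<bullet> twist c t (e \<odot> x) u"
        using Cons Pos by (simp add: twist_def ce)
      also have "\<dots> = (\<rho> (t \<odot> e) \<bullet> \<rho> (t \<odot> (e \<odot> x))) \<bullet> twist c t x u"
        using t e u by (simp add: twist_restrict[OF c] twist_closed[OF c] A.ac)
      \<comment> \<open>The remaining word leads from \<open>e x\<close> back to \<open>e\<close>,
        so the weight at \<open>e\<close> lies below the weight at \<open>e x\<close>.\<close>
      also have "\<rho> (t \<odot> e) \<bullet> \<rho> (t \<odot> (e \<odot> x)) = \<rho> (t \<odot> e)"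
        using g_endpt[OF g, of "e \<odot> x" u] t e u by simp
      also have "twist c t x u = zeta T A \<theta> c t w"
        using Cons Pos by (simp add: zeta_def xi_eq_twist)
      finally show ?thesis
        using t u Cons Pos by (simp add: zeta_def xi_eq_twist twist_closed[OF c])
    next
      case (Neg x)
      have u: "x \<in> carrier T" "letters_in u (carrier T)" "endpt T (e \<odot> sinv T x) u = e"
        using w Cons Neg by auto
      have z: "zeta T A \<theta> c t w = sinv A (c [t, sinv T x, x]) \<bullet> twist c t (sinv T x) u"
        using Cons Neg by (simp add: zeta_def xi_eq_twist)
      \<comment> \<open>A first letter \<open>[x]\<^sup>-\<^sup>1\<close> does leave a factor in
        \<open>xi\<close>, taken at the prefix \<open>x\<^sup>-\<^sup>1\<close>; it only has to be
        restricted to \<open>e x\<^sup>-\<^sup>1\<close>.\<close>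
      have "c [t, e \<odot> sinv T x, x] = \<rho> (t \<odot> (e \<odot> sinv T x \<odot> x)) \<bullet> c [t, sinv T x, x]"
        using weighted_cocycle[OF c' t] e u by (simp add: weighted_def)
      also have "\<rho> (t \<odot> (e \<odot> sinv T x \<odot> x)) = \<rho> (t \<odot> (e \<odot> sinv T x))"
        using g_mult_sinv[OF g, of e x] e u by simp
      finally have "sinv A (c [t, e \<odot> sinv T x, x])
          = \<rho> (t \<odot> (e \<odot> sinv T x)) \<bullet> sinv A (c [t, sinv T x, x])"
        using t e u c3 by (simp add: A.sinv_mult_comm)
      then have "twist c t e w = \<rho> (t \<odot> (e \<odot> sinv T x)) \<bullet> sinv A (c [t, sinv T x, x])
          \<bullet> twist c t (e \<odot> sinv T x) u"
        using Cons Neg by (simp add: twist_def)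
      also have "\<dots> = (\<rho> (t \<odot> e) \<bullet> \<rho> (t \<odot> (e \<odot> sinv T x))) \<bullet> zeta T A \<theta> c t w"
        using t e u c3 by (simp add: z twist_restrict[OF c] twist_closed[OF c] A.ac)
      also have "\<rho> (t \<odot> e) \<bullet> \<rho> (t \<odot> (e \<odot> sinv T x)) = \<rho> (t \<odot> e)"
        using g_endpt[OF g, of "e \<odot> sinv T x" u] t e u by simp
      finally show ?thesis
        using t u c3 by (simp add: z twist_closed[OF c])
    qed
  qed
  then show "zeta T A \<theta> c t w \<in> carrier A" "\<rho> (t \<odot> e) \<bullet> zeta T A \<theta> c t w = twist c t e w"
    by auto
qed

lemma letter_CS: "letter_base l \<in> carrier T \<Longrightarrow> (letter_val T l, [l]) \<in> carrier CS"
  by (simp add: CS_carrier FG_carrier reduced_def)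

lemma gamma_eq_act:
  assumes l: "letter_base l \<in> carrier T" and m: "m \<in> carrier CN"
  shows "gamma T A \<theta> \<eta> c l m = act c (letter_val T l, [l]) m"
proof -
  obtain a e w where [simp]: "m = (a, e, w)"
    by (metis surj_pair)
  have *: "a \<in> carrier A" "e \<in> idems T" "w \<in> carrier FG" "endpt T e w = e"
    "letters_in w (carrier T)" "rng A a = \<theta> e"
    using m by (auto simp: CN_carrier FG_carrier)
  \<comment> \<open>The idempotent that separates \<open>zeta\<close> from \<open>twist\<close> is
    the range of \<open>\<eta> t a\<close>, so the difference vanishes in the product.\<close>
  have first: "zeta T A \<theta> c t w \<bullet> \<eta> t a = twist c t e w \<bullet> \<eta> t a" if t: "t \<in> carrier T" for t
  proof -
    have "\<rho> (t \<odot> e) \<bullet> \<eta> t a = \<eta> t a"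
      using * t A.rng_mult_self[of "\<eta> t a"] by (simp add: \<eta>_rng \<eta>_\<theta> \<theta>_conj)
    moreover have "twist c t e w \<bullet> \<eta> t a = zeta T A \<theta> c t w \<bullet> (\<rho> (t \<odot> e) \<bullet> \<eta> t a)"
      using zeta_twist[OF t *(2,5,4)] * t by (simp add: A.ac flip: zeta_twist(2)[OF t *(2,5,4)])
    ultimately show ?thesis
      by simp
  qed
  show ?thesis
    using * l by (cases l) (auto simp: first wconj_def FG_mult reduce_append_reduce)
qed

lemma word_CS:
  assumes "u \<in> carrier FG" "u \<noteq> []"
  shows "(sprod T (map (letter_val T) u), u) \<in> carrier CS"
  using assms sprod_closed[of u] endpt_sprod[of u] FG_letters[of u] by (simp add: CS_carrier)

text \<open>The homomorphism property \<open>act_act\<close> collapses the composite. The words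
  multiply without cancellation because the given word is reduced.\<close>

lemma foldr_gamma:
  assumes "u \<in> carrier FG" "u \<noteq> []" "m \<in> carrier CN"
  shows "foldr (gamma T A \<theta> \<eta> c) u m = act c (sprod T (map (letter_val T) u), u) m"
  using assms(1,2)
proof (induction u)
  case (Cons l u)
  have l: "letter_base l \<in> carrier T" "u \<in> carrier FG"
    using Cons.prems reduced_tl by (auto simp: FG_carrier)
  show ?case
  proof (cases "u = []")
    case True
    then show ?thesis
      using gamma_eq_act[OF l(1) assms(3)] by simp
  next
    case False
    let ?s = "(sprod T (map (letter_val T) u), u)"
    have s: "?s \<in> carrier CS"
      using l False by (intro word_CS)
    have "foldr (gamma T A \<theta> \<eta> c) (l # u) m = act c (letter_val T l, [l]) (act c ?s m)"
      using Cons.IH l False s assms(3) by (simp add: gamma_eq_act act_closed)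
    also have "\<dots> = act c ((letter_val T l, [l]) \<cdot>\<^bsub>CS\<^esub> ?s) m"
      using letter_CS[OF l(1)] s assms(3) by (rule act_act)
    also have "(letter_val T l, [l]) \<cdot>\<^bsub>CS\<^esub> ?s = (letter_val T l \<odot> sprod T (map (letter_val T) u), l # u)"
      using Cons.prems by simp
    finally show ?thesis
      using False by (cases u) auto
  qed
qed simp

text \<open>The composite over the letters is the action of \<open>(\<nu>(u), u)\<close>;
  multiplying it by the idempotent \<open>(rng t, [])\<close>, which acts through
  \<open>\<alpha>\<close>, gives the action of \<open>(t, u)\<close>.\<close>

lemma constr_lambda_eq_act:
  assumes s: "s \<in> carrier CS" and m: "m \<in> carrier CN"
  shows "constr_lambda T A \<theta> \<eta> c s m = act c s m"
proof -
  obtain t u where su [simp]: "s = (t, u)"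
    by (metis surj_pair)
  have *: "t \<in> carrier T" "u \<in> carrier FG" "endpt T (rng T t) u = t"
    using s by (simp_all add: CS_carrier)
  show ?thesis
  proof (cases "u = []")
    case True
    then have "(t, []) \<in> idems CS"
      using * T.rng_idem[of t] by (simp add: CS_idems)
    then show ?thesis
      using m True act_idem[of "(t, [])" m] by (simp add: constr_lambda_def)
  next
    case False
    let ?\<tau> = "sprod T (map (letter_val T) u)"
    have r: "rng CS s = (rng T t, [])"
      using s * CS_sinv[of t u] by (simp add: rng_def reduce_append_winv FG_carrier)
    have ri: "(rng T t, []) \<in> idems CS"
      using * by (simp add: CS_idems)
    have "constr_lambda T A \<theta> \<eta> c s m = act c (rng T t, []) (act c (?\<tau>, u) m)"
      using False m * word_CS[of u] act_idem[OF ri, of "act c (?\<tau>, u) m"]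
      by (simp add: constr_lambda_def r[simplified] foldr_gamma act_closed)
    also have "\<dots> = act c ((rng T t, []) \<cdot>\<^bsub>CS\<^esub> (?\<tau>, u)) m"
      using ri word_CS[OF *(2) False] m by (intro act_act) auto
    also have "(rng T t, []) \<cdot>\<^bsub>CS\<^esub> (?\<tau>, u) = s"
      using * False endpt_sprod[of u "rng T t"] FG_letters[of u] by simp
    finally show ?thesis .
  qed
qed

section \<open>The constructed extension\<close>

lemma constr_crossed_module:
  "crossed_module CS CN (constr_alpha \<theta>) (constr_lambda T A \<theta> \<eta> c) constr_beta"
proof -
  have alpha_idem: "constr_alpha \<theta> e \<in> idems CN" if "e \<in> idems CS" for e
    using that by (cases e) (auto simp: constr_alpha_def CS_idems CN_idems)
  have alpha_shom: "constr_alpha \<theta> \<in> shom (idem_sgroup CS) (idem_sgroup CN)"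
    using alpha_idem by (auto simp: shom_def idem_sgroup_def CS_idems constr_alpha_def \<theta>_mult reduce_def)
  have bij: "bij_betw (constr_alpha \<theta>) (idems CS) (idems CN)"
  proof (rule bij_betwI')
    fix x y assume "x \<in> idems CS" "y \<in> idems CS"
    then show "constr_alpha \<theta> x = constr_alpha \<theta> y \<longleftrightarrow> x = y"
      by (cases x, cases y) (auto simp: constr_alpha_def CS_idems)
  next
    fix y assume "y \<in> idems CN"
    then have "(fst (snd y), []) \<in> idems CS \<and> y = constr_alpha \<theta> (fst (snd y), [])"
      by (cases y) (auto simp: constr_alpha_def CS_idems CN_idems)
    then show "\<exists>x\<in>idems CS. y = constr_alpha \<theta> x"
      by blast
  qed (rule alpha_idem)
  have alpha: "constr_alpha \<theta> \<in> siso (idem_sgroup CS) (idem_sgroup CN)"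
    using bij alpha_shom by (simp add: siso_def idem_sgroup_def)
  have beta_alpha: "constr_beta (constr_alpha \<theta> e) = e" if "e \<in> idems CS" for e
    using that by (cases e) (auto simp: constr_alpha_def constr_beta_def CS_idems)
  note eq = constr_lambda_eq_act
  have endo: "constr_lambda T A \<theta> \<eta> c s \<in> endos CN" if "s \<in> carrier CS" for s
    using that act_closed act_mult
    by (auto simp: endos_def shom_def eq) (simp add: constr_lambda_def)
  have "constr_lambda T A \<theta> \<eta> c \<in> shom CS (rel_end CN)"
  proof (rule shom_rel_endI[where \<alpha> = "constr_alpha \<theta>"])
    show "n \<cdot>\<^bsub>CN\<^esub> f = f \<cdot>\<^bsub>CN\<^esub> n" if "f \<in> idems CN" "n \<in> carrier CN" for f n
      using semilattice_of_groups_central[OF CN_semilattice_of_groups that] by simp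
    show "constr_lambda T A \<theta> \<eta> c (s \<cdot>\<^bsub>CS\<^esub> t) n
        = constr_lambda T A \<theta> \<eta> c s (constr_lambda T A \<theta> \<eta> c t n)"
      if "s \<in> carrier CS" "t \<in> carrier CS" "n \<in> carrier CN" for s t n
      using that by (simp add: eq act_closed act_act)
    show "constr_lambda T A \<theta> \<eta> c e n = constr_alpha \<theta> e \<cdot>\<^bsub>CN\<^esub> n"
      if "e \<in> idems CS" "n \<in> carrier CN" for e n
      using that by (simp add: eq act_idem)
    show "constr_lambda T A \<theta> \<eta> c s (constr_alpha \<theta> e) = constr_alpha \<theta> (s \<cdot>\<^bsub>CS\<^esub> e \<cdot>\<^bsub>CS\<^esub> sinv CS s)"
      if "s \<in> carrier CS" "e \<in> idems CS" for s e
      using that alpha_idem by (simp add: eq act_alpha)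
  qed (use CS_inverse_semigroup CN_inverse_semigroup alpha_idem endo in auto)
  moreover have "constr_beta \<in> shom CN CS"
    by (auto simp: shom_def constr_beta_def CN_carrier CS_carrier)
  moreover have "inj_on constr_beta (idems CN)"
    by (auto simp: inj_on_def constr_beta_def CN_idems)
  moreover have "constr_beta f = inv_into (idems CS) (constr_alpha \<theta>) f" if f: "f \<in> idems CN" for f
  proof -
    obtain e where "e \<in> idems CS" "f = constr_alpha \<theta> e"
      using f bij_betw_imp_surj_on[OF bij] by blast
    then show ?thesis
      using bij by (simp add: beta_alpha bij_betw_def inv_into_f_f)
  qed
  \<comment> \<open>Since \<open>f\<close> is idempotent, the twist is trivial and
    \<open>\<eta> f\<close> is multiplication by \<open>\<theta> f\<close>. In the commutative
    \<open>A\<close> this is conjugation by \<open>b\<close>, an element of the component of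
    \<open>\<theta> f\<close>.\<close>
  moreover have "constr_lambda T A \<theta> \<eta> c (constr_beta m) m' = m \<cdot>\<^bsub>CN\<^esub> m' \<cdot>\<^bsub>CN\<^esub> sinv CN m"
    if m: "m \<in> carrier CN" "m' \<in> carrier CN" for m m'
  proof -
    obtain b f v a e w where [simp]: "m = (b, f, v)" "m' = (a, e, w)"
      by (metis surj_pair)
    have *: "b \<in> carrier A" "f \<in> idems T" "v \<in> carrier FG" "rng A b = \<theta> f"
      "a \<in> carrier A" "e \<in> idems T" "w \<in> carrier FG" "rng A a = \<theta> e" "endpt T e w = e"
      "letters_in w (carrier T)"
      using m by (auto simp: CN_carrier FG_carrier)
    have fv: "(f, v) \<in> carrier CS"
      using m by (simp add: CN_carrier CS_carrier)
    have "\<theta> f \<bullet> \<theta> e \<bullet> (\<theta> f \<bullet> a) = (\<theta> f \<bullet> \<theta> f) \<bullet> (\<theta> e \<bullet> a)"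
      using * by (simp add: A.ac)
    also have "\<dots> = rng A b \<bullet> a"
      using * A.rng_mult_self[of a] by simp
    also have "\<dots> = b \<bullet> a \<bullet> sinv A b"
      using *(1,5) by (simp add: rng_def A.ac)
    finally show ?thesis
      using * m fv CN_sinv[of b f v] T.idem_mult_idem[of f e] eq[of "(f, v)" "(a, e, w)"]
      by (simp add: constr_beta_def twist_idem[OF c n] \<eta>_idem \<theta>_mult wconj_def reduce_append_reduce)
  qed
  moreover have "constr_beta (constr_lambda T A \<theta> \<eta> c s m) = s \<cdot>\<^bsub>CS\<^esub> constr_beta m \<cdot>\<^bsub>CS\<^esub> sinv CS s"
    if "s \<in> carrier CS" "m \<in> carrier CN" for s m
    using that by (cases s, cases m)
      (simp add: eq constr_beta_def CS_sinv wconj_def reduce_append_reduce)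
  ultimately show ?thesis
    unfolding crossed_module_def
    using CS_inverse_semigroup CN_semilattice_of_groups alpha act_idem act_alpha alpha_idem
    by (auto simp: eq)
qed

lemma constr_i_simp: "e \<in> idems T \<Longrightarrow> rng A a = \<theta> e \<Longrightarrow> constr_i T A \<theta> a = (a, e, [])"
  using \<theta>_bij by (simp add: constr_i_def bij_betw_def inv_into_f_f flip: rng_def)

theorem constr_ext_closed: "constr_ext T A \<theta> \<eta> c \<in> cm_exts T A \<theta> \<eta>"
proof -
  let ?i = "constr_i T A \<theta>"
  have i: "\<exists>e. e \<in> idems T \<and> rng A a = \<theta> e \<and> ?i a = (a, e, [])" if "a \<in> carrier A" for a
    using that \<theta>_surj[of "rng A a"] constr_i_simp by (metis A.rng_idem)
  have i_closed: "?i a \<in> carrier CN" if "a \<in> carrier A" for a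
    using i[OF that] that by (auto simp: CN_carrier)
  have i_mult: "?i (a \<bullet> b) = ?i a \<cdot>\<^bsub>CN\<^esub> ?i b" if ab: "a \<in> carrier A" "b \<in> carrier A" for a b
  proof -
    obtain e f where *: "e \<in> idems T" "rng A a = \<theta> e" "?i a = (a, e, [])"
      "f \<in> idems T" "rng A b = \<theta> f" "?i b = (b, f, [])"
      using i ab by metis
    then have "?i (a \<bullet> b) = (a \<bullet> b, e \<odot> f, [])"
      using ab by (intro constr_i_simp) (auto simp: A.rng_mult_comm \<theta>_mult T.idem_mult_idem)
    then show ?thesis
      using * by (simp add: reduce_def)
  qed
  have i_inj: "inj_on ?i (carrier A)"
    by (auto simp: inj_on_def constr_i_def)
  have inv_i: "inv_into (carrier A) ?i (a, e, []) = a" if "a \<in> carrier A" "e \<in> idems T" "rng A a = \<theta> e"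
    for a e
    using inv_into_f_f[OF i_inj that(1)] constr_i_simp[OF that(2,3)] by simp
  have inv_\<pi>: "inv_into (idems CS) fst e = (e, [])" if "e \<in> idems T" for e
    using that by (intro inv_into_f_eq) (auto simp: inj_on_def CS_idems)
  have "?i ` carrier A = {m \<in> carrier CN. constr_beta m \<in> idems CS}"
  proof (intro equalityI subsetI)
    fix m assume "m \<in> ?i ` carrier A"
    then show "m \<in> {m \<in> carrier CN. constr_beta m \<in> idems CS}"
      using i i_closed by (force simp: constr_beta_def CS_idems)
  next
    fix m assume "m \<in> {m \<in> carrier CN. constr_beta m \<in> idems CS}"
    then obtain a e where "m = (a, e, [])" "a \<in> carrier A" "e \<in> idems T" "rng A a = \<theta> e"
      by (cases m) (auto simp: constr_beta_def CS_idems CN_carrier)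
    then show "m \<in> ?i ` carrier A"
      using constr_i_simp[of e a] by (metis image_eqI)
  qed
  moreover have "constr_beta ` carrier CN = {s \<in> carrier CS. fst s \<in> idems T}"
  proof (intro equalityI subsetI)
    fix s assume "s \<in> {s \<in> carrier CS. fst s \<in> idems T}"
    then obtain e w where "s = (e, w)" "(\<theta> e, e, w) \<in> carrier CN"
      by (cases s) (auto simp: CN_carrier CS_carrier)
    then show "s \<in> constr_beta ` carrier CN"
      by (force simp: constr_beta_def)
  qed (auto simp: constr_beta_def CN_carrier CS_carrier)
  moreover have "fst ` carrier CS = carrier T"
  proof (intro equalityI subsetI)
    fix t assume "t \<in> carrier T"
    then show "t \<in> fst ` carrier CS"
      using letter_CS[of "Pos t"] by force
  qed (auto simp: CS_carrier)
  moreover have "fst \<in> shom CS T"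
    by (auto simp: shom_def CS_carrier)
  moreover have "inj_on fst (idems CS)"
    by (auto simp: inj_on_def CS_idems)
  moreover have "\<theta> e = inv_into (carrier A) ?i (constr_alpha \<theta> (inv_into (idems CS) fst e))"
    if "e \<in> idems T" for e
    using that by (simp add: inv_\<pi> constr_alpha_def inv_i)
  moreover have "\<eta> (fst s) a = inv_into (carrier A) ?i (constr_lambda T A \<theta> \<eta> c s (?i a))"
    if sa: "s \<in> carrier CS" "a \<in> carrier A" for s a
  proof -
    obtain t u where [simp]: "s = (t, u)"
      by (metis surj_pair)
    obtain e where e: "e \<in> idems T" "rng A a = \<theta> e" "?i a = (a, e, [])"
      using i sa by blast
    have t: "t \<in> carrier T" "u \<in> carrier FG"
      using sa by (simp_all add: CS_carrier)
    have r: "rng A (\<eta> t a) = \<rho> (t \<odot> e)"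
      using t e sa by (simp add: \<eta>_rng \<eta>_\<theta> \<theta>_conj)
    \<comment> \<open>The word of \<open>?i a\<close> is empty, so the twist is the bare idempotent
      \<open>\<rho> (t \<odot> e)\<close>; hence the induced action is the given
      \<open>\<eta>\<close>, whatever cocycle is used.\<close>
    have "constr_lambda T A \<theta> \<eta> c s (?i a) = (\<rho> (t \<odot> e) \<bullet> \<eta> t a, t \<odot> e \<odot> sinv T t, [])"
      using sa e t i_closed[of a] by (simp add: constr_lambda_eq_act twist_def)
    also have "\<rho> (t \<odot> e) \<bullet> \<eta> t a = \<eta> t a"
      using A.rng_mult_self[of "\<eta> t a"] t sa r by simp
    finally show ?thesis
      using t e sa r by (simp add: inv_i \<theta>_conj)
  qed
  ultimately show ?thesis
    using constr_crossed_module i_closed i_mult i_inj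
    by (auto simp: cm_exts_def constr_ext_def shom_def)
qed

end

end

section \<open>Cohomologous cocycles\<close>

lemma constr_ext_hom:
  assumes c: "c \<in> ord_cocycles T A \<theta> \<eta>" "normalized T \<theta> c"
    and c': "c' \<in> ord_cocycles T A \<theta> \<eta>" "normalized T \<theta> c'"
    and cohom: "c' \<in> cohomology_class T A \<theta> \<eta> c"
  shows "cm_ext_hom A (constr_ext T A \<theta> \<eta> c) (constr_ext T A \<theta> \<eta> c')"
proof -
  obtain h where h: "h \<in> ord_cochains T A \<theta> 2" and c'_eq: "c' = (\<lambda>xs\<in>tuples T 3. \<delta> 2 h xs \<bullet> c xs)"
    using cohom by (auto simp: cohomology_class_iff)
  define H where "H = run T A \<rho> (\<lambda>p x. h [p, x])"
  note wh = weight_\<rho> weighted_cochain_2[OF h]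
  have Hc: "H p w \<in> carrier A" and Hr: "rng A (H p w) = \<rho> (endpt T p w)"
    if "p \<in> carrier T" "letters_in w (carrier T)" for p w
    using that run_closed[OF wh] run_rng[OF wh] by (auto simp: H_def)
  define \<phi> where "\<phi> = (\<lambda>(a, e, w). (sinv A (H e w) \<bullet> a, e :: 't, w))"
  have closed: "\<phi> m \<in> carrier CN" if "m \<in> carrier CN" for m
    using that Hc Hr by (cases m) (auto simp: \<phi>_def CN_carrier FG_carrier A.rng_mult_comm)
  have mult: "\<phi> (m \<cdot>\<^bsub>CN\<^esub> m') = \<phi> m \<cdot>\<^bsub>CN\<^esub> \<phi> m'" if m: "m \<in> carrier CN" "m' \<in> carrier CN" for m m'
  proof -
    obtain a e w a' e' w' where [simp]: "m = (a, e, w)" "m' = (a', e', w')"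
      by (metis surj_pair)
    have *: "a \<in> carrier A" "e \<in> idems T" "w \<in> carrier FG"
      "endpt T e w = e" "letters_in w (carrier T)" "rng A a = \<theta> e"
      "a' \<in> carrier A" "e' \<in> idems T" "w' \<in> carrier FG" "endpt T e' w' = e'" "letters_in w' (carrier T)"
      "rng A a' = \<theta> e'"
      using m by (auto simp: CN_carrier FG_carrier)
    have ee: "e \<odot> e' \<in> idems T" "e \<odot> e' = e' \<odot> e"
      using * by (auto intro: T.idem_mult_idem T.idem_commute)
    have ends: "endpt T (e \<odot> e') w = e \<odot> e'" "endpt T (e \<odot> e') w' = e \<odot> e'"
      using * T.endpt_mult[of e' e w] T.endpt_mult[of e e' w'] ee by simp_all
    let ?r = "\<theta> (e \<odot> e')"
    have "H (e \<odot> e') (reduce (w @ w')) = H (e \<odot> e') (w @ w')"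
      unfolding H_def using * ee ends endpt_reduce_eq[of "e \<odot> e'" "w @ w'"]
      by (intro run_eq_reduce[OF wh]) auto
    also have "\<dots> = H (e \<odot> e') w \<bullet> H (e \<odot> e') w'"
      unfolding H_def using * ee ends by (simp add: run_append[OF wh])
    also have "H (e \<odot> e') w = ?r \<bullet> H e w"
      using * ee ends run_restrict[OF wh, of e w e'] by (simp add: H_def)
    also have "H (e \<odot> e') w' = ?r \<bullet> H e' w'"
      using * ee ends run_restrict[OF wh, of e' w' e] by (simp add: H_def)
    finally have Hee: "H (e \<odot> e') (reduce (w @ w')) = ?r \<bullet> H e w \<bullet> (?r \<bullet> H e' w')" .
    have r: "?r \<bullet> (a \<bullet> a') = a \<bullet> a'"
      using * by (intro A.rng_mult_absorb) (auto simp: A.rng_mult_comm \<theta>_mult A.idem_mult_idem)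
    have "sinv A (H (e \<odot> e') (reduce (w @ w'))) \<bullet> (a \<bullet> a')
        = sinv A (H e w) \<bullet> sinv A (H e' w') \<bullet> (?r \<bullet> (?r \<bullet> (a \<bullet> a')))"
      unfolding Hee using * ee Hc[of e w] Hc[of e' w'] by (simp add: A.sinv_mult_comm A.ac)
    also have "\<dots> = sinv A (H e w) \<bullet> a \<bullet> (sinv A (H e' w') \<bullet> a')"
      unfolding r using * Hc[of e w] Hc[of e' w'] by (simp add: A.ac)
    finally show ?thesis
      by (simp add: \<phi>_def)
  qed
  have i: "\<phi> (constr_i T A \<theta> a) = constr_i T A \<theta> a" if a: "a \<in> carrier A" for a
  proof -
    obtain e where e: "e \<in> idems T" "\<theta> e = rng A a"
      using \<theta>_surj[of "rng A a"] a by auto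
    then show ?thesis
      using a constr_i_simp[OF c, of e a] by (simp add: \<phi>_def H_def)
  qed
  have act: "\<phi> (act c s m) = act c' s (\<phi> m)" if sm: "s \<in> carrier CS" "m \<in> carrier CN" for s m
  proof -
    obtain t u a e w where [simp]: "s = (t, u)" "m = (a, e, w)"
      by (metis surj_pair)
    have *: "t \<in> carrier T" "u \<in> carrier FG" "letters_in u (carrier T)" "reduced u"
      "a \<in> carrier A" "e \<in> idems T" "w \<in> carrier FG"
      "endpt T e w = e" "letters_in w (carrier T)" "rng A a = \<theta> e"
      using sm by (auto simp: CS_carrier CN_carrier FG_carrier)
    let ?f = "t \<odot> e \<odot> sinv T t"
    have f: "?f \<in> idems T" "?f \<in> carrier T" "endpt T ?f u = t \<odot> e" "endpt T (t \<odot> e) w = t \<odot> e"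
      using * sm endpt_conj[of t u e] by (auto simp: T.endpt_mult)
    \<comment> \<open>The cancellation of the two passages along \<open>u\<close>, as for the twist
      in \<open>act_act\<close>, now for products of the \<open>2\<close>-cochain
      \<open>h\<close>.\<close>
    have "H ?f (wconj u w) = H ?f (u @ w @ winv u)"
      unfolding H_def wconj_def
      using * f sm endpt_wconj[of t u e w] endpt_wconj_reduce[of t u e w]
      by (intro run_eq_reduce[OF wh]) (auto simp: wconj_def)
    also have "\<dots> = H (t \<odot> e) w"
      unfolding H_def using * f run_conj[OF wh, of ?f u w] by (simp add: T.rng_mult del: T.conj_idem)
    finally have H: "H ?f (wconj u w) = H (t \<odot> e) w" .
    have Hs [simp]: "H (t \<odot> e) w \<in> carrier A" "H e w \<in> carrier A" "twist c t e w \<in> carrier A"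
      using * by (auto intro: Hc twist_closed[OF c(1)])
    \<comment> \<open>The two sides will differ by the image under \<open>\<eta> t\<close> of
      \<open>H e w\<close> times its inverse. Since \<open>w\<close> is a loop at \<open>e\<close>,
      this is the identity of the component of \<open>a\<close> and can be inserted.\<close>
    have "H e w \<bullet> sinv A (H e w) = \<theta> e"
      using Hr[of e w] * by (simp flip: rng_def)
    then have "\<eta> t (H e w \<bullet> sinv A (H e w) \<bullet> a) = \<eta> t a"
      using A.rng_mult_self[of a] * by simp
    then have "\<eta> t a = \<eta> t (H e w) \<bullet> \<eta> t (sinv A (H e w)) \<bullet> \<eta> t a"
      using * by (simp add: \<eta>_mult)
    then have "sinv A (H (t \<odot> e) w) \<bullet> (twist c t e w \<bullet> \<eta> t a) = sinv A (H (t \<odot> e) w) \<bullet>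
        (twist c t e w \<bullet> (\<eta> t (H e w) \<bullet> \<eta> t (sinv A (H e w)) \<bullet> \<eta> t a))"
      by simp
    moreover have "act c' s (\<phi> m) = (\<eta> t (H e w) \<bullet> sinv A (H (t \<odot> e) w) \<bullet> twist c t e w
        \<bullet> \<eta> t (sinv A (H e w) \<bullet> a), ?f, wconj u w)"
      using * twist_coboundary[OF c(1) h, of t e w] by (simp add: \<phi>_def c'_eq H_def)
    ultimately show ?thesis
      using * by (simp add: \<phi>_def H \<eta>_mult A.ac)
  qed
  show ?thesis
    unfolding cm_ext_hom_def constr_ext_def
    using closed mult i act constr_lambda_eq_act[OF c] constr_lambda_eq_act[OF c'] act_closed[OF c(1)]
    by (intro bexI[of _ \<phi>] bexI[of _ "\<lambda>s. s"]) (auto simp: shom_def \<phi>_def constr_beta_def)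
qed

end

section \<open>Isomorphic copies of extensions\<close>

lemma siso_shom: "j \<in> siso S S' \<Longrightarrow> j \<in> shom S S'"
  by (simp add: siso_def)

lemma siso_inj: "j \<in> siso S S' \<Longrightarrow> inj_on j (carrier S)"
  by (simp add: siso_def bij_betw_def)

lemma siso_image: "j \<in> siso S S' \<Longrightarrow> j ` carrier S = carrier S'"
  by (simp add: siso_def bij_betw_def)

lemma siso_eq_iff:
  "j \<in> siso S S' \<Longrightarrow> x \<in> carrier S \<Longrightarrow> y \<in> carrier S \<Longrightarrow> j x = j y \<longleftrightarrow> x = y"
  using siso_inj by (auto dest: inj_onD)

lemma siso_elim:
  assumes "j \<in> siso S S'" "y \<in> carrier S'"
  obtains x where "x \<in> carrier S" "y = j x"
  using assms siso_image[OF assms(1)] by (metis imageE)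

lemma siso_inverse_semigroup:
  assumes S: "inverse_semigroup S" and j: "j \<in> siso S S'"
  shows "inverse_semigroup S'"
proof -
  interpret inv_semigroup S
    by unfold_locales (rule S)
  note m = shom_mult[OF siso_shom[OF j], symmetric]
  note cl = shom_closed[OF siso_shom[OF j]]
  show ?thesis
    unfolding inverse_semigroup_def
  proof (intro conjI ballI)
    fix x' y' z' assume *: "x' \<in> carrier S'" "y' \<in> carrier S'" "z' \<in> carrier S'"
    obtain x y z where "x \<in> carrier S" "x' = j x" "y \<in> carrier S" "y' = j y" "z \<in> carrier S" "z' = j z"
      using siso_elim[OF j *(1)] siso_elim[OF j *(2)] siso_elim[OF j *(3)] by metis
    then show "x' \<cdot>\<^bsub>S'\<^esub> y' \<in> carrier S'" "(x' \<cdot>\<^bsub>S'\<^esub> y') \<cdot>\<^bsub>S'\<^esub> z' = x' \<cdot>\<^bsub>S'\<^esub> (y' \<cdot>\<^bsub>S'\<^esub> z')"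
      by (simp_all add: m cl assoc)
  next
    fix x' assume "x' \<in> carrier S'"
    then obtain x where x: "x \<in> carrier S" "x' = j x"
      by (rule siso_elim[OF j])
    show "\<exists>!y. y \<in> carrier S' \<and> x' \<cdot>\<^bsub>S'\<^esub> y \<cdot>\<^bsub>S'\<^esub> x' = x' \<and> y \<cdot>\<^bsub>S'\<^esub> x' \<cdot>\<^bsub>S'\<^esub> y = y"
    proof (rule ex1I[of _ "j (sinv S x)"])
      show "j (sinv S x) \<in> carrier S' \<and> x' \<cdot>\<^bsub>S'\<^esub> j (sinv S x) \<cdot>\<^bsub>S'\<^esub> x' = x' \<and>
        j (sinv S x) \<cdot>\<^bsub>S'\<^esub> x' \<cdot>\<^bsub>S'\<^esub> j (sinv S x) = j (sinv S x)"
        using x by (simp add: m cl assoc)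
    next
      fix y' assume y': "y' \<in> carrier S' \<and> x' \<cdot>\<^bsub>S'\<^esub> y' \<cdot>\<^bsub>S'\<^esub> x' = x' \<and> y' \<cdot>\<^bsub>S'\<^esub> x' \<cdot>\<^bsub>S'\<^esub> y' = y'"
      then obtain y where y: "y \<in> carrier S" "y' = j y"
        using siso_elim[OF j] by metis
      have "sinv S x = y"
        using x y y' by (intro sinv_eqI) (auto simp: m assoc siso_eq_iff[OF j])
      then show "y' = j (sinv S x)"
        using y by simp
    qed
  qed
qed

lemma siso_idems:
  assumes S: "inverse_semigroup S" and j: "j \<in> siso S S'"
  shows "idems S' = j ` idems S"
proof (intro equalityI subsetI)
  interpret inv_semigroup S
    by unfold_locales (rule S)
  interpret S': inv_semigroup S'
    by unfold_locales (rule siso_inverse_semigroup[OF S j])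
  fix e' assume e': "e' \<in> idems S'"
  obtain e where e: "e \<in> carrier S" "e' = j e"
    using siso_elim[OF j S'.idems_carrier[OF e']] .
  then have "j (e \<cdot>\<^bsub>S\<^esub> e) = j e"
    using S'.idem_idem[OF e'] by (simp add: shom_mult[OF siso_shom[OF j]])
  then have "e \<in> idems S"
    using e by (intro idemsI) (auto simp: siso_eq_iff[OF j])
  then show "e' \<in> j ` idems S"
    using e by simp
qed (auto intro: shom_idems[OF siso_shom[OF j]])

lemma siso_semilattice_of_groups:
  assumes N: "semilattice_of_groups N" and j: "j \<in> siso N N'"
  shows "semilattice_of_groups N'"
proof -
  have iN: "inverse_semigroup N"
    using N by (simp add: semilattice_of_groups_def)
  interpret inv_semigroup N
    by unfold_locales (rule iN)
  note iN' = siso_inverse_semigroup[OF iN j]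
  show ?thesis
  proof (rule semilattice_of_groupsI[OF iN'])
    fix x' assume "x' \<in> carrier N'"
    then obtain x where x: "x \<in> carrier N" "x' = j x"
      by (rule siso_elim[OF j])
    then show "x' \<cdot>\<^bsub>N'\<^esub> sinv N' x' = sinv N' x' \<cdot>\<^bsub>N'\<^esub> x'"
      using shom_sinv[OF iN iN' siso_shom[OF j] x(1), symmetric] semilattice_of_groups_rng[OF N x(1)]
      by (simp add: shom_mult[OF siso_shom[OF j], symmetric])
  qed
qed

text \<open>Only equations along \<open>jN\<close> and \<open>jS\<close> occur, so the arguments
  below need not unfold the inverses in \<open>transport_ext\<close>. Extensionality is required
  because endomorphisms are compared as HOL functions.\<close>

definition ext_iso :: "'a sgroup \<Rightarrow> ('n \<Rightarrow> 'm) \<Rightarrow> ('s \<Rightarrow> 'r) \<Rightarrow> ('t, 'a, 'n, 's) cm_ext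
    \<Rightarrow> ('t, 'a, 'm, 'r) cm_ext \<Rightarrow> bool" where
  "ext_iso A jN jS X X' \<longleftrightarrow>
     jN \<in> siso (ext_N X) (ext_N X') \<and> jS \<in> siso (ext_S X) (ext_S X') \<and>
     (\<forall>e\<in>idems (ext_S X). ext_alpha X' (jS e) = jN (ext_alpha X e)) \<and>
     (\<forall>s\<in>carrier (ext_S X). \<forall>n\<in>carrier (ext_N X).
        ext_lambda X' (jS s) (jN n) = jN (ext_lambda X s n)) \<and>
     (\<forall>s\<in>carrier (ext_S X'). ext_lambda X' s \<in> extensional (carrier (ext_N X'))) \<and>
     (\<forall>n\<in>carrier (ext_N X). ext_beta X' (jN n) = jS (ext_beta X n)) \<and>
     (\<forall>a\<in>carrier A. ext_i X' a = jN (ext_i X a)) \<and>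
     (\<forall>s\<in>carrier (ext_S X). ext_pi X' (jS s) = ext_pi X s)"

lemma transport_siso:
  "inj_on j (carrier S) \<Longrightarrow> j \<in> siso S (transport_sgroup j S)"
  by (auto simp: siso_def shom_def transport_sgroup_def bij_betw_def)

lemma ext_iso_transport:
  assumes "inj_on jN (carrier (ext_N X))" "inj_on jS (carrier (ext_S X))"
  shows "ext_iso A jN jS X (transport_ext jN jS X)"
proof -
  have "idems (ext_S X) \<subseteq> carrier (ext_S X)"
    by (auto simp: idems_def)
  then show ?thesis
    using assms transport_siso[OF assms(1)] transport_siso[OF assms(2)]
    by (auto simp: ext_iso_def transport_ext_def Let_def transport_sgroup_def)
qed

text \<open>Elements of the copy are pulled back along \<open>jN\<close> and \<open>jS\<close>,
  which reduces the equational axioms to those of the original. The homomorphism into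
  \<open>rel_end\<close> is rederived with \<open>shom_rel_endI\<close>, so relative inverses need
  not be transported.\<close>

lemma crossed_module_iso:
  assumes X: "crossed_module S N \<alpha> \<Lambda> \<beta>"
    and jN: "jN \<in> siso N N'" and jS: "jS \<in> siso S S'"
    and \<alpha>': "\<And>e. e \<in> idems S \<Longrightarrow> \<alpha>' (jS e) = jN (\<alpha> e)"
    and \<Lambda>': "\<And>s n. s \<in> carrier S \<Longrightarrow> n \<in> carrier N \<Longrightarrow> \<Lambda>' (jS s) (jN n) = jN (\<Lambda> s n)"
    and ext: "\<And>s. s \<in> carrier S' \<Longrightarrow> \<Lambda>' s \<in> extensional (carrier N')"
    and \<beta>': "\<And>n. n \<in> carrier N \<Longrightarrow> \<beta>' (jN n) = jS (\<beta> n)"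
  shows "crossed_module S' N' \<alpha>' \<Lambda>' \<beta>'"
proof -
  have S: "inverse_semigroup S" and N: "semilattice_of_groups N" and iN: "inverse_semigroup N"
    and \<alpha>: "\<alpha> \<in> shom (idem_sgroup S) (idem_sgroup N)" "bij_betw \<alpha> (idems S) (idems N)"
    and \<Lambda>: "\<Lambda> \<in> shom S (rel_end N)" and \<beta>: "\<beta> \<in> shom N S" "inj_on \<beta> (idems N)"
    and \<beta>\<alpha>: "\<And>f. f \<in> idems N \<Longrightarrow> \<beta> f = inv_into (idems S) \<alpha> f"
    and idem: "\<And>e n. e \<in> idems S \<Longrightarrow> n \<in> carrier N \<Longrightarrow> \<Lambda> e n = \<alpha> e \<cdot>\<^bsub>N\<^esub> n"
    and act: "\<And>s e. s \<in> carrier S \<Longrightarrow> e \<in> idems S \<Longrightarrow> \<Lambda> s (\<alpha> e) = \<alpha> (s \<cdot>\<^bsub>S\<^esub> e \<cdot>\<^bsub>S\<^esub> sinv S s)"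
    and inner: "\<And>n n'. n \<in> carrier N \<Longrightarrow> n' \<in> carrier N \<Longrightarrow> \<Lambda> (\<beta> n) n' = n \<cdot>\<^bsub>N\<^esub> n' \<cdot>\<^bsub>N\<^esub> sinv N n"
    and equivariant: "\<And>s n. s \<in> carrier S \<Longrightarrow> n \<in> carrier N \<Longrightarrow> \<beta> (\<Lambda> s n) = s \<cdot>\<^bsub>S\<^esub> \<beta> n \<cdot>\<^bsub>S\<^esub> sinv S s"
    using X by (auto simp: crossed_module_def semilattice_of_groups_def siso_def idem_sgroup_def)
  interpret S: inv_semigroup S by unfold_locales (rule S)
  interpret N: inv_semigroup N by unfold_locales (rule iN)
  note S' = siso_inverse_semigroup[OF S jS] and N' = siso_semilattice_of_groups[OF N jN]
  note iN' = siso_inverse_semigroup[OF iN jN]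
  note iS = siso_idems[OF S jS] and idN = siso_idems[OF iN jN]
  note mN = shom_mult[OF siso_shom[OF jN], symmetric] and mS = shom_mult[OF siso_shom[OF jS], symmetric]
  note cN = shom_closed[OF siso_shom[OF jN]] and cS = shom_closed[OF siso_shom[OF jS]]
  note vN = shom_sinv[OF iN iN' siso_shom[OF jN], symmetric]
  note vS = shom_sinv[OF S S' siso_shom[OF jS], symmetric]
  have \<alpha>_idem: "\<alpha> e \<in> idems N" if "e \<in> idems S" for e
    using \<alpha>(2) that by (rule bij_betwE[THEN bspec])
  have \<alpha>_mult: "\<alpha> (e \<cdot>\<^bsub>S\<^esub> f) = \<alpha> e \<cdot>\<^bsub>N\<^esub> \<alpha> f" if "e \<in> idems S" "f \<in> idems S" for e f
    using shom_mult[OF \<alpha>(1), of e f] that by (simp add: idem_sgroup_def)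
  have \<beta>_closed: "\<beta> n \<in> carrier S" if "n \<in> carrier N" for n
    using shom_closed[OF \<beta>(1) that] .
  have \<beta>_idem: "\<beta> n \<in> idems S" if "n \<in> idems N" for n
    using shom_idems[OF \<beta>(1) that] .
  have \<Lambda>_endo: "\<Lambda> s \<in> shom N N" if "s \<in> carrier S" for s
    using shom_closed[OF \<Lambda> that] by (simp add: rel_end_def endos_def)
  note \<Lambda>_closed = shom_closed[OF \<Lambda>_endo] and \<Lambda>_mult = shom_mult[OF \<Lambda>_endo]
  have \<Lambda>_comp: "\<Lambda> (s \<cdot>\<^bsub>S\<^esub> t) n = \<Lambda> s (\<Lambda> t n)" if "s \<in> carrier S" "t \<in> carrier S" "n \<in> carrier N" for s t n
    using shom_mult[OF \<Lambda> that(1,2)] that(3) by (simp add: rel_end_def compose_def)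
  note eN = siso_elim[OF jN] and eS = siso_elim[OF jS]
  have bij: "bij_betw \<alpha>' (idems S') (idems N')"
  proof -
    have "bij_betw jS (idems S) (idems S')"
      unfolding iS using siso_inj[OF jS] by (intro inj_on_imp_bij_betw) (auto intro: inj_on_subset)
    moreover have "bij_betw jN (idems N) (idems N')"
      unfolding idN using siso_inj[OF jN] by (intro inj_on_imp_bij_betw) (auto intro: inj_on_subset)
    then have "bij_betw (jN \<circ> \<alpha>) (idems S) (idems N')"
      using \<alpha>(2) by (rule bij_betw_trans[rotated])
    then have "bij_betw (\<alpha>' \<circ> jS) (idems S) (idems N')"
      using \<alpha>' by (subst bij_betw_cong[of _ _ "jN \<circ> \<alpha>"]) auto
    ultimately show ?thesis
      by (simp add: bij_betw_comp_iff)
  qed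
  have \<alpha>'_idem: "\<alpha>' e \<in> idems N'" if "e \<in> idems S'" for e
    using bij that by (rule bij_betwE[THEN bspec])
  have \<alpha>'_siso: "\<alpha>' \<in> siso (idem_sgroup S') (idem_sgroup N')"
    using bij \<alpha>'_idem
    by (auto simp: siso_def shom_def idem_sgroup_def iS mS \<alpha>' S.idem_mult_idem \<alpha>_mult
        shom_mult[OF siso_shom[OF jN]] \<alpha>_idem)
  have idem': "\<Lambda>' e' n' = \<alpha>' e' \<cdot>\<^bsub>N'\<^esub> n'" if e': "e' \<in> idems S'" and n': "n' \<in> carrier N'" for e' n'
  proof -
    obtain e n where "e \<in> idems S" "e' = jS e" "n \<in> carrier N" "n' = jN n"
      using e' eN[OF n'] unfolding iS by blast
    then show ?thesis
      by (simp add: \<Lambda>' \<alpha>' idem \<alpha>_idem mN)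
  qed
  have act': "\<Lambda>' s' (\<alpha>' e') = \<alpha>' (s' \<cdot>\<^bsub>S'\<^esub> e' \<cdot>\<^bsub>S'\<^esub> sinv S' s')"
    if s': "s' \<in> carrier S'" and e': "e' \<in> idems S'" for s' e'
  proof -
    obtain s e where "s \<in> carrier S" "s' = jS s" "e \<in> idems S" "e' = jS e"
      using e' eS[OF s'] unfolding iS by blast
    then show ?thesis
      by (simp add: \<Lambda>' \<alpha>' act \<alpha>_idem mS vS)
  qed
  have endo': "\<Lambda>' s' \<in> endos N'" if s': "s' \<in> carrier S'" for s'
  proof -
    obtain s where s: "s \<in> carrier S" "s' = jS s"
      using eS[OF s'] .
    have "\<Lambda>' s' \<in> shom N' N'"
      unfolding shom_def siso_image[OF jN, symmetric]
      using s by (auto simp: \<Lambda>' mN \<Lambda>_closed \<Lambda>_mult)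
    then show ?thesis
      using ext[OF s'] by (simp add: endos_def)
  qed
  have \<Lambda>'_shom: "\<Lambda>' \<in> shom S' (rel_end N')"
  proof (rule shom_rel_endI[where \<alpha> = \<alpha>'])
    show "n \<cdot>\<^bsub>N'\<^esub> f = f \<cdot>\<^bsub>N'\<^esub> n" if "f \<in> idems N'" "n \<in> carrier N'" for f n
      using semilattice_of_groups_central[OF N' that] by simp
    show "\<Lambda>' (s' \<cdot>\<^bsub>S'\<^esub> t') n' = \<Lambda>' s' (\<Lambda>' t' n')"
      if *: "s' \<in> carrier S'" "t' \<in> carrier S'" "n' \<in> carrier N'" for s' t' n'
    proof -
      obtain s t n where "s \<in> carrier S" "s' = jS s" "t \<in> carrier S" "t' = jS t" "n \<in> carrier N" "n' = jN n"
        using eS[OF *(1)] eS[OF *(2)] eN[OF *(3)] by metis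
      then show ?thesis
        by (simp add: mS \<Lambda>' \<Lambda>_comp \<Lambda>_closed)
    qed
  qed (use S' iN' \<alpha>'_idem idem' act' endo' in auto)
  have \<beta>'_shom: "\<beta>' \<in> shom N' S'"
    unfolding shom_def siso_image[OF jN, symmetric]
    by (auto simp: \<beta>' mN \<beta>_closed shom_mult[OF \<beta>(1)] cS shom_mult[OF siso_shom[OF jS]])
  have \<beta>'_inj: "inj_on \<beta>' (idems N')"
    unfolding idN using \<beta>(2) by (auto simp: inj_on_def \<beta>' siso_eq_iff[OF jS] \<beta>_closed)
  have \<beta>\<alpha>': "\<beta>' f' = inv_into (idems S') \<alpha>' f'" if f': "f' \<in> idems N'" for f'
  proof -
    obtain f where f: "f \<in> idems N" "f' = jN f"
      using f' unfolding idN by blast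
    have "\<alpha> (\<beta> f) = f"
      using f \<alpha>(2) by (simp add: \<beta>\<alpha> bij_betw_def f_inv_into_f)
    then have "\<alpha>' (\<beta>' f') = f'" "\<beta>' f' \<in> idems S'"
      using f by (auto simp: \<beta>' \<alpha>' \<beta>_idem iS)
    then show ?thesis
      using bij by (metis bij_betw_imp_inj_on inv_into_f_f)
  qed
  have inner': "\<Lambda>' (\<beta>' m) m' = m \<cdot>\<^bsub>N'\<^esub> m' \<cdot>\<^bsub>N'\<^esub> sinv N' m"
    if *: "m \<in> carrier N'" "m' \<in> carrier N'" for m m'
  proof -
    obtain n n' where "n \<in> carrier N" "m = jN n" "n' \<in> carrier N" "m' = jN n'"
      using eN[OF *(1)] eN[OF *(2)] by metis
    then show ?thesis
      by (simp add: \<beta>' \<Lambda>' \<beta>_closed inner vN mN)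
  qed
  have equivariant': "\<beta>' (\<Lambda>' s' m) = s' \<cdot>\<^bsub>S'\<^esub> \<beta>' m \<cdot>\<^bsub>S'\<^esub> sinv S' s'"
    if *: "s' \<in> carrier S'" "m \<in> carrier N'" for s' m
  proof -
    obtain s n where "s \<in> carrier S" "s' = jS s" "n \<in> carrier N" "m = jN n"
      using eS[OF *(1)] eN[OF *(2)] by metis
    then show ?thesis
      by (simp add: \<beta>' \<Lambda>' \<beta>_closed \<Lambda>_closed equivariant vS mS)
  qed
  show ?thesis
    unfolding crossed_module_def
    using S' N' \<alpha>'_siso \<Lambda>'_shom \<beta>'_shom \<beta>'_inj \<beta>\<alpha>' idem' act' inner' equivariant' by blast
qed

lemma cm_exts_iso:
  assumes T: "inverse_semigroup T" and A: "inverse_semigroup A"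
    and X: "X \<in> cm_exts T A \<theta> \<eta>"
    and iso: "ext_iso A jN jS X X'"
  shows "X' \<in> cm_exts T A \<theta> \<eta>"
proof -
  obtain N S \<alpha> \<Lambda> \<beta> i \<pi> N' S' \<alpha>' \<Lambda>' \<beta>' i' \<pi>' where X_eq:
    "X = \<lparr>ext_N = N, ext_S = S, ext_alpha = \<alpha>, ext_lambda = \<Lambda>, ext_beta = \<beta>, ext_i = i, ext_pi = \<pi>\<rparr>"
    "X' = \<lparr>ext_N = N', ext_S = S', ext_alpha = \<alpha>', ext_lambda = \<Lambda>', ext_beta = \<beta>', ext_i = i', ext_pi = \<pi>'\<rparr>"
    using cm_ext.cases[of X] cm_ext.cases[of X'] by metis
  have cm: "crossed_module S N \<alpha> \<Lambda> \<beta>" and i: "i \<in> shom A N" "inj_on i (carrier A)"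
    and \<pi>: "\<pi> \<in> shom S T" "\<pi> ` carrier S = carrier T" "inj_on \<pi> (idems S)"
    and i_image: "i ` carrier A = {n \<in> carrier N. \<beta> n \<in> idems S}"
    and \<beta>_image: "\<beta> ` carrier N = {s \<in> carrier S. \<pi> s \<in> idems T}"
    and ind_\<theta>: "\<And>e. e \<in> idems T \<Longrightarrow> \<theta> e = inv_into (carrier A) i (\<alpha> (inv_into (idems S) \<pi> e))"
    using X by (auto simp: cm_exts_def X_eq)
  have ind_\<eta>: "\<eta> (\<pi> s) a = inv_into (carrier A) i (\<Lambda> s (i a))" if "s \<in> carrier S" "a \<in> carrier A" for s a
    using X that shom_closed[OF \<pi>(1)] by (simp add: cm_exts_def X_eq)
  have jN: "jN \<in> siso N N'" and jS: "jS \<in> siso S S'"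
    and \<alpha>': "\<And>e. e \<in> idems S \<Longrightarrow> \<alpha>' (jS e) = jN (\<alpha> e)"
    and \<Lambda>': "\<And>s n. s \<in> carrier S \<Longrightarrow> n \<in> carrier N \<Longrightarrow> \<Lambda>' (jS s) (jN n) = jN (\<Lambda> s n)"
    and ext: "\<And>s. s \<in> carrier S' \<Longrightarrow> \<Lambda>' s \<in> extensional (carrier N')"
    and \<beta>': "\<And>n. n \<in> carrier N \<Longrightarrow> \<beta>' (jN n) = jS (\<beta> n)"
    and i': "\<And>a. a \<in> carrier A \<Longrightarrow> i' a = jN (i a)"
    and \<pi>': "\<And>s. s \<in> carrier S \<Longrightarrow> \<pi>' (jS s) = \<pi> s"
    using iso by (auto simp: ext_iso_def X_eq)
  have S: "inverse_semigroup S" and iN: "inverse_semigroup N"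
    and \<alpha>: "bij_betw \<alpha> (idems S) (idems N)" and \<beta>: "\<beta> \<in> shom N S"
    and \<Lambda>: "\<Lambda> \<in> shom S (rel_end N)"
    and equivariant: "\<And>s n. s \<in> carrier S \<Longrightarrow> n \<in> carrier N \<Longrightarrow> \<beta> (\<Lambda> s n) = s \<cdot>\<^bsub>S\<^esub> \<beta> n \<cdot>\<^bsub>S\<^esub> sinv S s"
    using cm by (auto simp: crossed_module_def semilattice_of_groups_def siso_def idem_sgroup_def)
  interpret S: inv_semigroup S by unfold_locales (rule S)
  interpret N: inv_semigroup N by unfold_locales (rule iN)
  interpret A: inv_semigroup A by unfold_locales (rule A)
  interpret T: inv_semigroup T by unfold_locales (rule T)
  have cm': "crossed_module S' N' \<alpha>' \<Lambda>' \<beta>'"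
    using crossed_module_iso[OF cm jN jS] \<alpha>' \<Lambda>' ext \<beta>' by blast
  note iS = siso_idems[OF S jS]
  note cN = shom_closed[OF siso_shom[OF jN]] and cS = shom_closed[OF siso_shom[OF jS]]
  note i_closed = shom_closed[OF i(1)] and \<beta>_closed = shom_closed[OF \<beta>]
  have \<Lambda>_closed: "\<Lambda> s n \<in> carrier N" if "s \<in> carrier S" "n \<in> carrier N" for s n
    using shom_closed[OF \<Lambda> that(1)] that(2) by (auto simp: rel_end_def endos_def intro: shom_closed)
  have inv_i': "inv_into (carrier A) i' (jN n) = inv_into (carrier A) i n" if n: "n \<in> i ` carrier A" for n
  proof -
    obtain a where a: "a \<in> carrier A" "n = i a"
      using n by blast
    have "inj_on i' (carrier A)"
      using i(2) by (auto simp: inj_on_def i' siso_eq_iff[OF jN] i_closed)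
    then have "inv_into (carrier A) i' (i' a) = a"
      using a by simp
    then show ?thesis
      using a i(2) by (simp add: i')
  qed
  have i'_shom: "i' \<in> shom A N'"
    by (auto simp: shom_def i' cN i_closed shom_mult[OF i(1)] shom_mult[OF siso_shom[OF jN]])
  have i'_inj: "inj_on i' (carrier A)"
    using i(2) by (auto simp: inj_on_def i' siso_eq_iff[OF jN] i_closed)
  have \<pi>'_shom: "\<pi>' \<in> shom S' T" and \<pi>'_image: "\<pi>' ` carrier S' = carrier T"
    unfolding shom_def siso_image[OF jS, symmetric] using \<pi>(2)
    by (auto simp: \<pi>' shom_mult[OF siso_shom[OF jS], symmetric] shom_mult[OF \<pi>(1)] shom_closed[OF \<pi>(1)]
        image_image)
  have \<pi>'_inj: "inj_on \<pi>' (idems S')"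
    unfolding iS using \<pi>(3) by (auto simp: inj_on_def \<pi>')
  have jS_idem: "jS s \<in> idems S' \<longleftrightarrow> s \<in> idems S" if "s \<in> carrier S" for s
    unfolding iS using that siso_eq_iff[OF jS] by (auto simp: image_iff)
  have i'_image: "i' ` carrier A = {n \<in> carrier N'. \<beta>' n \<in> idems S'}"
  proof -
    have "i' ` carrier A = jN ` (i ` carrier A)"
      by (simp add: image_image i')
    also have "\<dots> = {n \<in> jN ` carrier N. \<beta>' n \<in> idems S'}"
      unfolding i_image by (auto simp: \<beta>' jS_idem \<beta>_closed)
    finally show ?thesis
      by (simp add: siso_image[OF jN])
  qed
  have \<beta>'_image: "\<beta>' ` carrier N' = {s \<in> carrier S'. \<pi>' s \<in> idems T}"
  proof -
    have "\<beta>' ` carrier N' = jS ` (\<beta> ` carrier N)"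
      by (simp add: siso_image[OF jN, symmetric] image_image \<beta>')
    also have "\<dots> = {s \<in> jS ` carrier S. \<pi>' s \<in> idems T}"
      unfolding \<beta>_image by (auto simp: \<pi>')
    finally show ?thesis
      by (simp add: siso_image[OF jS])
  qed
  have \<theta>': "\<theta> e = inv_into (carrier A) i' (\<alpha>' (inv_into (idems S') \<pi>' e))" if e: "e \<in> idems T" for e
  proof -
    obtain s where s: "s \<in> carrier S" "\<pi> s = e"
      using \<pi>(2) e T.idems_carrier[OF e] by (metis imageE)
    \<comment> \<open>Any preimage \<open>s\<close> of the idempotent \<open>e\<close> yields an
      idempotent one, namely \<open>s s\<^sup>-\<^sup>1\<close>; injectivity on idempotents makes it
      the value of the inverse.\<close>
    define f where "f = s \<cdot>\<^bsub>S\<^esub> sinv S s"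
    have f: "f \<in> idems S" "\<pi> f = e"
      using s e by (auto simp: f_def shom_mult[OF \<pi>(1)] shom_sinv[OF S T \<pi>(1)])
    have "inv_into (idems S) \<pi> e = f" "inv_into (idems S') \<pi>' e = jS f"
      using f \<pi>(3) \<pi>'_inj by (auto intro!: inv_into_f_eq simp: iS \<pi>')
    moreover have "\<alpha> f \<in> idems N"
      using \<alpha> f(1) by (rule bij_betwE[THEN bspec])
    then have "\<alpha> f \<in> i ` carrier A"
      unfolding i_image using shom_idems[OF \<beta>] by simp
    ultimately show ?thesis
      using f ind_\<theta>[OF e] by (simp add: \<alpha>' inv_i')
  qed
  have \<eta>': "\<eta> (\<pi>' s') a = inv_into (carrier A) i' (\<Lambda>' s' (i' a))"
    if s': "s' \<in> carrier S'" and a: "a \<in> carrier A" for s' a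
  proof -
    obtain s where s: "s \<in> carrier S" "s' = jS s"
      using siso_elim[OF jS s'] .
    \<comment> \<open>By equivariance \<open>\<beta>\<close> sends \<open>\<Lambda> s (i a)\<close>
      to a conjugate of this idempotent, so exactness puts \<open>\<Lambda> s (i a)\<close> back
      into the image of \<open>i\<close>.\<close>
    have "\<beta> (i a) \<in> idems S"
      using a i_image by blast
    then have "\<Lambda> s (i a) \<in> i ` carrier A"
      unfolding i_image using s a by (simp add: \<Lambda>_closed i_closed equivariant)
    then show ?thesis
      using s a by (simp add: \<pi>' i' \<Lambda>' i_closed inv_i' ind_\<eta>)
  qed
  show ?thesis
    using cm' i'_shom i'_inj \<pi>'_shom \<pi>'_image \<pi>'_inj i'_image \<beta>'_image \<theta>' \<eta>'
    by (auto simp: cm_exts_def X_eq)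
qed

text \<open>The components of the morphism are composed with the inverses of \<open>jN\<close>,
  \<open>jS\<close> on one side and with \<open>kN\<close>, \<open>kS\<close> on the other.\<close>

lemma cm_ext_hom_iso:
  assumes A: "inverse_semigroup A" and X: "X \<in> cm_exts T A \<theta> \<eta>" and hom: "cm_ext_hom A X Y"
    and X': "ext_iso A jN jS X X'" and Y': "ext_iso A kN kS Y Y'"
  shows "cm_ext_hom A X' Y'"
proof -
  obtain \<phi> \<psi> where \<phi>: "\<phi> \<in> shom (ext_N X) (ext_N Y)" and \<psi>: "\<psi> \<in> shom (ext_S X) (ext_S Y)"
    and i: "\<And>a. a \<in> carrier A \<Longrightarrow> \<phi> (ext_i X a) = ext_i Y a"
    and \<beta>: "\<And>n. n \<in> carrier (ext_N X) \<Longrightarrow> ext_beta Y (\<phi> n) = \<psi> (ext_beta X n)"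
    and \<pi>: "\<And>s. s \<in> carrier (ext_S X) \<Longrightarrow> ext_pi Y (\<psi> s) = ext_pi X s"
    and \<Lambda>: "\<And>s n. s \<in> carrier (ext_S X) \<Longrightarrow> n \<in> carrier (ext_N X) \<Longrightarrow>
      \<phi> (ext_lambda X s n) = ext_lambda Y (\<psi> s) (\<phi> n)"
    using hom by (auto simp: cm_ext_hom_def)
  have jN: "jN \<in> siso (ext_N X) (ext_N X')" and jS: "jS \<in> siso (ext_S X) (ext_S X')"
    and kN: "kN \<in> siso (ext_N Y) (ext_N Y')" and kS: "kS \<in> siso (ext_S Y) (ext_S Y')"
    using X' Y' by (simp_all add: ext_iso_def)
  have cm: "crossed_module (ext_S X) (ext_N X) (ext_alpha X) (ext_lambda X) (ext_beta X)"
    and i_closed: "\<And>a. a \<in> carrier A \<Longrightarrow> ext_i X a \<in> carrier (ext_N X)"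
    using X by (auto simp: cm_exts_def shom_def)
  have S: "inverse_semigroup (ext_S X)" and N: "inverse_semigroup (ext_N X)"
    and \<beta>_closed: "\<And>n. n \<in> carrier (ext_N X) \<Longrightarrow> ext_beta X n \<in> carrier (ext_S X)"
    using cm by (auto simp: crossed_module_def semilattice_of_groups_def shom_def)
  have \<Lambda>_closed: "ext_lambda X s n \<in> carrier (ext_N X)"
    if "s \<in> carrier (ext_S X)" "n \<in> carrier (ext_N X)" for s n
  proof -
    have "ext_lambda X \<in> shom (ext_S X) (rel_end (ext_N X))"
      using cm by (simp add: crossed_module_def)
    then have "ext_lambda X s \<in> shom (ext_N X) (ext_N X)"
      using that(1) by (auto simp: rel_end_def endos_def dest: shom_closed)
    then show ?thesis
      using that(2) by (rule shom_closed)
  qed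
  interpret S: inv_semigroup "ext_S X" by unfold_locales (rule S)
  interpret N: inv_semigroup "ext_N X" by unfold_locales (rule N)
  let ?f = "\<lambda>n. kN (\<phi> (inv_into (carrier (ext_N X)) jN n))"
  let ?g = "\<lambda>s. kS (\<psi> (inv_into (carrier (ext_S X)) jS s))"
  have [simp]: "inv_into (carrier (ext_N X)) jN (jN n) = n" if "n \<in> carrier (ext_N X)" for n
    using that siso_inj[OF jN] by simp
  have [simp]: "inv_into (carrier (ext_S X)) jS (jS s) = s" if "s \<in> carrier (ext_S X)" for s
    using that siso_inj[OF jS] by simp
  note [simp] = shom_closed[OF \<phi>] shom_closed[OF \<psi>] shom_closed[OF siso_shom[OF kN]]
    shom_closed[OF siso_shom[OF kS]] i_closed \<beta>_closed \<Lambda>_closed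
  have "?f \<in> shom (ext_N X') (ext_N Y')"
    unfolding shom_def siso_image[OF jN, symmetric]
    by (auto simp: shom_mult[OF siso_shom[OF jN], symmetric] shom_mult[OF \<phi>]
        shom_mult[OF siso_shom[OF kN]])
  moreover have "?g \<in> shom (ext_S X') (ext_S Y')"
    unfolding shom_def siso_image[OF jS, symmetric]
    by (auto simp: shom_mult[OF siso_shom[OF jS], symmetric] shom_mult[OF \<psi>]
        shom_mult[OF siso_shom[OF kS]])
  ultimately show ?thesis
    unfolding cm_ext_hom_def
  proof (intro bexI conjI)
    show "\<forall>a\<in>carrier A. ?f (ext_i X' a) = ext_i Y' a"
      using X' Y' by (simp add: ext_iso_def i)
    show "\<forall>n\<in>carrier (ext_N X'). ext_beta Y' (?f n) = ?g (ext_beta X' n)"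
      unfolding siso_image[OF jN, symmetric] using X' Y' by (simp add: ext_iso_def \<beta>)
    show "\<forall>s\<in>carrier (ext_S X'). ext_pi Y' (?g s) = ext_pi X' s"
      unfolding siso_image[OF jS, symmetric] using X' Y' by (simp add: ext_iso_def \<pi>)
    show "\<forall>s\<in>carrier (ext_S X'). \<forall>n\<in>carrier (ext_N X').
        ?f (ext_lambda X' s n) = ext_lambda Y' (?g s) (?f n)"
      unfolding siso_image[OF jS, symmetric] siso_image[OF jN, symmetric]
      using X' Y' by (simp add: ext_iso_def \<Lambda>)
  qed
qed

section \<open>Equivalence of extensions\<close>

text \<open>The total relation on the extensions belongs to the intersected family. This bounds the
  intersection, and reflexivity, symmetry and transitivity are inherited from the members.\<close>

lemma equiv_cm_ext_equiv: "equiv (cm_exts T A \<theta> \<eta>) (cm_ext_equiv T A \<theta> \<eta>)"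
proof -
  let ?C = "cm_exts T A \<theta> \<eta>"
  let ?\<R> = "{R. equiv ?C R \<and> (\<forall>X\<in>?C. \<forall>X'\<in>?C. cm_ext_hom A X X' \<longrightarrow> (X, X') \<in> R)}"
  have "?C \<times> ?C \<in> ?\<R>"
    by (auto simp: equiv_def refl_on_def sym_def trans_def)
  then have sub: "\<Inter> ?\<R> \<subseteq> ?C \<times> ?C"
    by (rule Inter_lower)
  have "refl_on ?C (\<Inter> ?\<R>)"
    by (auto simp: refl_on_def equiv_def)
  moreover have "sym (\<Inter> ?\<R>)"
    by (rule symI) (auto simp: equiv_def dest: symD)
  moreover have "trans (\<Inter> ?\<R>)"
    by (rule transI) (auto simp: equiv_def dest: transD)
  ultimately show ?thesis
    using sub unfolding cm_ext_equiv_def equiv_def by blast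
qed

lemma cm_ext_equivI:
  assumes "X \<in> cm_exts T A \<theta> \<eta>" "X' \<in> cm_exts T A \<theta> \<eta>" "cm_ext_hom A X X'"
  shows "(X, X') \<in> cm_ext_equiv T A \<theta> \<eta>"
  using assms by (auto simp: cm_ext_equiv_def)

theorem proposition4p41:
  fixes T :: "'t sgroup" and A :: "'a sgroup"
    and \<theta> :: "'t \<Rightarrow> 'a" and \<eta> :: "'t \<Rightarrow> 'a \<Rightarrow> 'a"
    and jN :: "'a \<times> 't \<times> 't letter list \<Rightarrow> 'n" and jS :: "'t \<times> 't letter list \<Rightarrow> 's"
  assumes "inverse_semigroup T"
    and "T_module T A \<theta> \<eta>"
    and "inj_on jN (carrier (constr_N T A \<theta>))"
    and "inj_on jS (carrier (constr_S T))"
  shows "(\<forall>h\<in>carrier (ord_cohomology T A \<theta> \<eta>). \<exists>c\<in>h. normalized T \<theta> c) \<and>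
    (\<forall>c\<in>ord_cocycles T A \<theta> \<eta>. normalized T \<theta> c \<longrightarrow>
       constr_ext T A \<theta> \<eta> c \<in> cm_exts T A \<theta> \<eta>) \<and>
    (\<exists>!\<Phi> :: ('t list \<Rightarrow> 'a) set \<Rightarrow> ('t, 'a, 'n, 's) cm_ext set.
       \<Phi> \<in> carrier (ord_cohomology T A \<theta> \<eta>) \<rightarrow>\<^sub>E cm_ext_classes T A \<theta> \<eta> \<and>
       (\<forall>c\<in>ord_cocycles T A \<theta> \<eta>. normalized T \<theta> c \<longrightarrow>
          \<Phi> (cohomology_class T A \<theta> \<eta> c) =
            cm_ext_equiv T A \<theta> \<eta> `` {transport_ext jN jS (constr_ext T A \<theta> \<eta> c)}))"
proof (intro conjI ballI impI)
  interpret inv_module T A \<theta> \<eta>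
    using assms by unfold_locales
  let ?H = "carrier (ord_cohomology T A \<theta> \<eta>)"
  let ?cls = "cohomology_class T A \<theta> \<eta>"
  let ?X = "\<lambda>c. constr_ext T A \<theta> \<eta> c"
  let ?Y = "\<lambda>c. transport_ext jN jS (?X c)"
  let ?Q = "\<lambda>c. cm_ext_equiv T A \<theta> \<eta> `` {?Y c}"
  let ?Z = "{c \<in> ord_cocycles T A \<theta> \<eta>. normalized T \<theta> c}"
  have representative: "\<exists>c\<in>?Z. h = ?cls c" if h: "h \<in> ?H" for h
  proof -
    obtain c where c: "c \<in> ord_cocycles T A \<theta> \<eta>" "h = ?cls c"
      using h unfolding ord_cohomology_carrier by blast
    then show ?thesis
      using ex_normalized[OF c(1)] cohomology_class_eq[OF c(1)] by (metis (no_types, lifting) mem_Collect_eq)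
  qed
  show "\<exists>c\<in>h. normalized T \<theta> c" if h: "h \<in> ?H" for h
    using representative[OF h] cohomology_class_refl by blast
  show "?X c \<in> cm_exts T A \<theta> \<eta>" if "c \<in> ord_cocycles T A \<theta> \<eta>" "normalized T \<theta> c" for c
    using that by (rule constr_ext_closed)
  have iso: "ext_iso A jN jS (?X c) (?Y c)" for c
    using assms(3,4) by (intro ext_iso_transport) (simp_all add: constr_ext_def)
  have Y: "?Y c \<in> cm_exts T A \<theta> \<eta>" if "c \<in> ?Z" for c
    by (rule cm_exts_iso[OF T A.inverse_semigroup constr_ext_closed iso]) (use that in auto)
  \<comment> \<open>Independence of the representative: \<open>c'\<close> is a translate of
    \<open>c\<close> by a coboundary, so \<open>constr_ext_hom\<close> gives a morphism of
    extensions, which carries over to the copies.\<close>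
  have Q: "?Q c = ?Q c'" if c: "c \<in> ?Z" "c' \<in> ?Z" "?cls c = ?cls c'" for c c'
  proof -
    have "c' \<in> ?cls c"
      using c cohomology_class_refl by auto
    then have hom: "cm_ext_hom A (?X c) (?X c')"
      using c by (intro constr_ext_hom) auto
    have "cm_ext_hom A (?Y c) (?Y c')"
      by (rule cm_ext_hom_iso[OF A.inverse_semigroup constr_ext_closed hom iso iso])
        (use c in auto)
    with Y Y have "(?Y c, ?Y c') \<in> cm_ext_equiv T A \<theta> \<eta>"
      by (rule cm_ext_equivI) (use c in auto)
    then show ?thesis
      by (rule equiv_class_eq[OF equiv_cm_ext_equiv])
  qed
  \<comment> \<open>Any normalized representative may be chosen, since \<open>Q\<close> makes the
    value independent of the choice.\<close>
  define \<Phi> where "\<Phi> = (\<lambda>h\<in>?H. ?Q (SOME c. c \<in> ?Z \<and> h = ?cls c))"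
  have \<Phi>: "\<Phi> (?cls c) = ?Q c" if c: "c \<in> ?Z" for c
  proof -
    have "(SOME c'. c' \<in> ?Z \<and> ?cls c = ?cls c') \<in> ?Z \<and> ?cls c = ?cls (SOME c'. c' \<in> ?Z \<and> ?cls c = ?cls c')"
      by (rule someI[of _ c]) (use c in simp)
    moreover have "?cls c \<in> ?H"
      using c by (simp add: ord_cohomology_carrier)
    ultimately show ?thesis
      using Q[OF _ c] unfolding \<Phi>_def by simp
  qed
  show "\<exists>!\<Phi>. \<Phi> \<in> ?H \<rightarrow>\<^sub>E cm_ext_classes T A \<theta> \<eta> \<and>
      (\<forall>c\<in>ord_cocycles T A \<theta> \<eta>. normalized T \<theta> c \<longrightarrow> \<Phi> (?cls c) = ?Q c)"
  proof (rule ex1I[of _ \<Phi>])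
    have "\<Phi> h \<in> cm_ext_classes T A \<theta> \<eta>" if h: "h \<in> ?H" for h
    proof -
      obtain c where c: "c \<in> ?Z" "h = ?cls c"
        using representative[OF h] by blast
      then show ?thesis
        using \<Phi>[OF c(1)] Y[OF c(1)] by (simp add: cm_ext_classes_def quotientI)
    qed
    then show "\<Phi> \<in> ?H \<rightarrow>\<^sub>E cm_ext_classes T A \<theta> \<eta> \<and>
        (\<forall>c\<in>ord_cocycles T A \<theta> \<eta>. normalized T \<theta> c \<longrightarrow> \<Phi> (?cls c) = ?Q c)"
      using \<Phi> by (auto simp: \<Phi>_def)
  next
    fix \<Psi> assume \<Psi>: "\<Psi> \<in> ?H \<rightarrow>\<^sub>E cm_ext_classes T A \<theta> \<eta> \<and>
        (\<forall>c\<in>ord_cocycles T A \<theta> \<eta>. normalized T \<theta> c \<longrightarrow> \<Psi> (?cls c) = ?Q c)"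
    \<comment> \<open>Every class has a normalized representative, so the prescribed values leave no
      freedom on \<open>?H\<close>; outside it both maps are \<open>undefined\<close>.\<close>
    show "\<Psi> = \<Phi>"
    proof (rule extensionalityI[where A = ?H])
      fix h assume "h \<in> ?H"
      then obtain c where "c \<in> ?Z" "h = ?cls c"
        using representative by blast
      then show "\<Psi> h = \<Phi> h"
        using \<Psi> \<Phi> by simp
    qed (use \<Psi> in \<open>auto simp: \<Phi>_def PiE_def\<close>)
  qed
qed

end
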